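(* Let $G$ be a finite group. Then $$\mathrm{AM}(\mathrm{ZA}(G))=\frac{1}{|G|^2}\sum_{(\pi,\pi')\in\widehat{G}\times\widehat{G}}d_\pi d_{\pi'}\left|\sum_{C\in\mathrm{Conj}(G)}|C|^2\chi_\pi(C)\overline{\chi_{\pi'}(C)}\right|.$$ In particular $1\le \mathrm{AM}(\mathrm{ZA}(G))$, with equality exactly when $G$ is abelian.
   Context: For a finite group $G$: $\widehat G$ is the set of equivalence classes of irreducible (unitary) representations, $d_\pi$ the dimension of $\pi$, $\chi_\pi$ its character, $\mathrm{Conj}(G)$ the set of conjugacy classes, $\chi_\pi(C)$ the value of $\chi_\pi$ on $C$. The central Fourier algebra $\mathrm{ZA}(G)$ is the algebra of class functions on $G$ under pointwise multiplication, with norm $\left\|\sum_{\pi\in\widehat G}\alpha_\pi\chi_\pi\right\|_{\mathrm A}=\sum_{\pi\in\widehat G}d_\pi|\alpha_\pi|$ (the norm inherited from the Fourier algebra $\mathrm{A}(G)$). For a Banach algebra $\mathcal{A}$ a bounded approximate diagonal (b.a.d.) is a bounded net $(d_\iota)$ in the projective tensor product $\mathcal{A}\hat\otimes\mathcal{A}$ such that for each $a\in\mathcal{A}$, $(a\otimes1)d_\iota-d_\iota(1\otimes a)\to0$ and $m(d_\iota)a\to a$, where $m:\mathcal{A}\hat\otimes\mathcal{A}\to\mathcal{A}$ is multiplication. The amenability constant is $\mathrm{AM}(\mathcal{A})=\inf\{M>0:\text{there is a b.a.d. }(d_\iota)\text{ for }\mathcal{A}\text{ with }\|d_\iota\|_{\mathcal{A}\hat\otimes\mathcal{A}}\le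 M\text{ for all }\iota\}$, with $\inf\varnothing=\infty$. *)

theory Defs
  imports
    "Jordan_Normal_Form.Schur_Decomposition"
    "HOL-Algebra.Group_Action"
    "HOL-Library.Extended_Real"
begin

section \<open>The dual of a finite group\<close>

definition unitary_group :: "nat \<Rightarrow> complex mat monoid" where
  "unitary_group n =
     \<lparr>carrier = {U \<in> carrier_mat n n. U * mat_adjoint U = 1\<^sub>m n \<and> mat_adjoint U * U = 1\<^sub>m n},
      monoid.mult = (*), one = 1\<^sub>m n\<rparr>"

text \<open>Representations are taken in coordinates, on the Hilbert space of \<open>n\<close>-dimensional
  complex vectors. They are extensional, so that they are determined by their values on the group.
  The type of matrices contains the matrices of all sizes, so irreducible representations of all
  degrees form a single set.\<close>

definition unitary_rep :: "('a, 'b) monoid_scheme \<Rightarrow> nat \<Rightarrow> ('a \<Rightarrow> complex mat) \<Rightarrow> bool" where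
  "unitary_rep G n \<rho> \<longleftrightarrow> \<rho> \<in> hom G (unitary_group n) \<and> \<rho> \<in> extensional (carrier G)"

definition irreducible_rep :: "('a, 'b) monoid_scheme \<Rightarrow> nat \<Rightarrow> ('a \<Rightarrow> complex mat) \<Rightarrow> bool" where
  "irreducible_rep G n \<rho> \<longleftrightarrow> unitary_rep G n \<rho> \<and> n > 0 \<and>
     (\<forall>W. VectorSpace.subspace class_ring W (module_vec TYPE(complex) n) \<and>
          (\<forall>g\<in>carrier G. \<forall>w\<in>W. \<rho> g *\<^sub>v w \<in> W)
        \<longrightarrow> W = {0\<^sub>v n} \<or> W = carrier_vec n)"

definition irreps :: "('a, 'b) monoid_scheme \<Rightarrow> ('a \<Rightarrow> complex mat) set" where
  "irreps G = {\<rho>. \<exists>n. irreducible_rep G n \<rho>}"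

definition rep_equiv ::
    "('a, 'b) monoid_scheme \<Rightarrow> (('a \<Rightarrow> complex mat) \<times> ('a \<Rightarrow> complex mat)) set" where
  "rep_equiv G = {(\<rho>, \<sigma>). \<rho> \<in> irreps G \<and> \<sigma> \<in> irreps G \<and>
     (\<exists>n. unitary_rep G n \<rho> \<and> unitary_rep G n \<sigma> \<and>
        (\<exists>U\<in>carrier (unitary_group n). \<forall>g\<in>carrier G. U * \<rho> g = \<sigma> g * U))}"

definition dual :: "('a, 'b) monoid_scheme \<Rightarrow> ('a \<Rightarrow> complex mat) set set" where
  "dual G = irreps G // rep_equiv G"

text \<open>In the next two definitions \<open>\<pi>\<close> is an equivalence class; degree and trace are constant
  on \<open>\<pi>\<close>, and \<^const>\<open>the_elem\<close> extracts the common value.\<close>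

definition degree_of :: "('a, 'b) monoid_scheme \<Rightarrow> ('a \<Rightarrow> complex mat) set \<Rightarrow> nat" where
  "degree_of G \<pi> = the_elem ((\<lambda>\<rho>. dim_row (\<rho> \<one>\<^bsub>G\<^esub>)) ` \<pi>)"

definition mat_trace :: "complex mat \<Rightarrow> complex" where
  "mat_trace A = (\<Sum>i<dim_row A. A $$ (i, i))"

definition char_of :: "('a \<Rightarrow> complex mat) set \<Rightarrow> 'a \<Rightarrow> complex" where
  "char_of \<pi> x = the_elem ((\<lambda>\<rho>. mat_trace (\<rho> x)) ` \<pi>)"

definition conj_classes :: "('a, 'b) monoid_scheme \<Rightarrow> 'a set set" where
  "conj_classes G =
     orbits G (carrier G) (\<lambda>g. \<lambda>h\<in>carrier G. g \<otimes>\<^bsub>G\<^esub> h \<otimes>\<^bsub>G\<^esub> inv\<^bsub>G\<^esub> g)"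

definition char_on_class :: "('a \<Rightarrow> complex mat) set \<Rightarrow> 'a set \<Rightarrow> complex" where
  "char_on_class \<pi> C = the_elem (char_of \<pi> ` C)"


section \<open>Amenability constants of Banach algebras\<close>

record 'v normed_algebra = "(complex, 'v) module" +
  nrm :: "'v \<Rightarrow> real"

definition bounded_bilinear_forms ::
    "('v, 'm) normed_algebra_scheme \<Rightarrow> ('v \<Rightarrow> 'v \<Rightarrow> complex) set" where
  "bounded_bilinear_forms A = {F.
     (\<forall>x\<in>carrier A. \<forall>y\<in>carrier A. \<forall>z\<in>carrier A.
        F (x \<oplus>\<^bsub>A\<^esub> y) z = F x z + F y z \<and> F z (x \<oplus>\<^bsub>A\<^esub> y) = F z x + F z y) \<and>
     (\<forall>c. \<forall>x\<in>carrier A. \<forall>y\<in>carrier A.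
        F (c \<odot>\<^bsub>A\<^esub> x) y = c * F x y \<and> F x (c \<odot>\<^bsub>A\<^esub> y) = c * F x y) \<and>
     (\<exists>K. \<forall>x\<in>carrier A. \<forall>y\<in>carrier A. cmod (F x y) \<le> K * nrm A x * nrm A y)}"

text \<open>
  The projective tensor product of a Banach algebra \<open>A\<close> with itself is realised inside the dual
  of the space of bounded bilinear forms: the elementary tensor of \<open>x\<close> and \<open>y\<close> is the evaluation
  of forms at \<open>(x, y)\<close>. The completion of the algebraic tensor product consists of the sums of the
  absolutely convergent series of elementary tensors, and the projective norm is the infimum
  of \<open>\<Sum>n. \<parallel>a n\<parallel> \<parallel>b n\<parallel>\<close> over all such series.
\<close>

type_synonym 'v tensor = "('v \<Rightarrow> 'v \<Rightarrow> complex) \<Rightarrow> complex"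

definition tensor_series ::
    "('v, 'm) normed_algebra_scheme \<Rightarrow> (nat \<Rightarrow> 'v) \<Rightarrow> (nat \<Rightarrow> 'v) \<Rightarrow> 'v tensor \<Rightarrow> bool" where
  "tensor_series A a b u \<longleftrightarrow>
     range a \<subseteq> carrier A \<and> range b \<subseteq> carrier A \<and>
     summable (\<lambda>n. nrm A (a n) * nrm A (b n)) \<and>
     u = (\<lambda>F\<in>bounded_bilinear_forms A. \<Sum>n. F (a n) (b n))"

definition proj_tensor :: "('v, 'm) normed_algebra_scheme \<Rightarrow> 'v tensor set" where
  "proj_tensor A = {u. \<exists>a b. tensor_series A a b u}"

definition proj_norm :: "('v, 'm) normed_algebra_scheme \<Rightarrow> 'v tensor \<Rightarrow> real" where
  "proj_norm A u = Inf {\<Sum>n. nrm A (a n) * nrm A (b n) | a b. tensor_series A a b u}"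

definition tensor_diff ::
    "('v, 'm) normed_algebra_scheme \<Rightarrow> 'v tensor \<Rightarrow> 'v tensor \<Rightarrow> 'v tensor" where
  "tensor_diff A u v = (\<lambda>F\<in>bounded_bilinear_forms A. u F - v F)"

text \<open>The actions \<open>(c \<otimes> 1) u\<close> and \<open>u (1 \<otimes> c)\<close>, determined on elementary tensors by
  \<open>(c \<otimes> 1) (x \<otimes> y) = c x \<otimes> y\<close> and \<open>(x \<otimes> y) (1 \<otimes> c) = x \<otimes> y c\<close>; no unit is needed.\<close>

definition left_act :: "('v, 'm) normed_algebra_scheme \<Rightarrow> 'v \<Rightarrow> 'v tensor \<Rightarrow> 'v tensor" where
  "left_act A c u = (\<lambda>F\<in>bounded_bilinear_forms A. u (\<lambda>x y. F (c \<otimes>\<^bsub>A\<^esub> x) y))"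

definition right_act :: "('v, 'm) normed_algebra_scheme \<Rightarrow> 'v tensor \<Rightarrow> 'v \<Rightarrow> 'v tensor" where
  "right_act A u c = (\<lambda>F\<in>bounded_bilinear_forms A. u (\<lambda>x y. F x (y \<otimes>\<^bsub>A\<^esub> c)))"

text \<open>The multiplication map: if \<open>u = \<Sum>n. a n \<otimes> b n\<close>, then \<open>m u = \<Sum>n. a n b n\<close>,
  the series converging in the norm of \<open>A\<close>.\<close>

definition tensor_mult :: "('v, 'm) normed_algebra_scheme \<Rightarrow> 'v tensor \<Rightarrow> 'v" where
  "tensor_mult A u = (THE c. c \<in> carrier A \<and> (\<exists>a b. tensor_series A a b u \<and>
     (\<lambda>N. nrm A ((\<Oplus>\<^bsub>A\<^esub>n\<in>{..<N}. a n \<otimes>\<^bsub>A\<^esub> b n) \<ominus>\<^bsub>A\<^esub> c)) \<longlonglongrightarrow> 0))"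

definition directed_set :: "'i set \<Rightarrow> ('i \<Rightarrow> 'i \<Rightarrow> bool) \<Rightarrow> bool" where
  "directed_set I rel \<longleftrightarrow> I \<noteq> {} \<and> (\<forall>i\<in>I. rel i i) \<and>
     (\<forall>i\<in>I. \<forall>j\<in>I. \<forall>k\<in>I. rel i j \<longrightarrow> rel j k \<longrightarrow> rel i k) \<and>
     (\<forall>i\<in>I. \<forall>j\<in>I. \<exists>k\<in>I. rel i k \<and> rel j k)"

definition net_null :: "'i set \<Rightarrow> ('i \<Rightarrow> 'i \<Rightarrow> bool) \<Rightarrow> ('i \<Rightarrow> real) \<Rightarrow> bool" where
  "net_null I rel f \<longleftrightarrow> (\<forall>\<epsilon>>0. \<exists>i\<in>I. \<forall>j\<in>I. rel i j \<longrightarrow> \<bar>f j\<bar> < \<epsilon>)"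

definition bounded_approx_diagonal ::
    "('v, 'm) normed_algebra_scheme \<Rightarrow> real \<Rightarrow> 'i set \<Rightarrow> ('i \<Rightarrow> 'i \<Rightarrow> bool) \<Rightarrow> ('i \<Rightarrow> 'v tensor) \<Rightarrow> bool"
  where
  "bounded_approx_diagonal A M I rel d \<longleftrightarrow> directed_set I rel \<and>
     (\<forall>i\<in>I. d i \<in> proj_tensor A \<and> proj_norm A (d i) \<le> M) \<and>
     (\<forall>x\<in>carrier A.
        net_null I rel (\<lambda>i. proj_norm A (tensor_diff A (left_act A x (d i)) (right_act A (d i) x))) \<and>
        net_null I rel (\<lambda>i. nrm A (tensor_mult A (d i) \<otimes>\<^bsub>A\<^esub> x \<ominus>\<^bsub>A\<^esub> x)))"

text \<open>
  The index sets range over subsets of a fixed type, which is no restriction: any net \<open>d\<close> has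
  the same tail filter as the net \<open>(u, S) \<mapsto> u\<close>, indexed by the pairs with \<open>S\<close> in the tail filter
  of \<open>d\<close> and \<open>u \<in> S\<close> a value of \<open>d\<close>, and directed by reverse inclusion of \<open>S\<close>. The infimum
  is taken in the extended reals, where \<open>Inf {} = \<infinity>\<close>.
\<close>

definition amenability_constant :: "('v, 'm) normed_algebra_scheme \<Rightarrow> ereal" where
  "amenability_constant A = Inf {ereal M | M. M > 0 \<and>
     (\<exists>(I :: ('v tensor \<times> 'v tensor set) set) rel d. bounded_approx_diagonal A M I rel d)}"


section \<open>The central Fourier algebra\<close>

definition class_functions :: "('a, 'b) monoid_scheme \<Rightarrow> ('a \<Rightarrow> complex) set" where
  "class_functions G = {f \<in> extensional (carrier G).
     \<forall>g\<in>carrier G. \<forall>x\<in>carrier G. f (g \<otimes>\<^bsub>G\<^esub> x \<otimes>\<^bsub>G\<^esub> inv\<^bsub>G\<^esub> g) = f x}"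

text \<open>The coefficients \<open>\<alpha>\<close> are unique on \<^term>\<open>dual G\<close> because the irreducible characters are
  a basis of the class functions.\<close>

definition ZA_norm :: "('a, 'b) monoid_scheme \<Rightarrow> ('a \<Rightarrow> complex) \<Rightarrow> real" where
  "ZA_norm G f = (THE r. \<exists>\<alpha>.
     (\<forall>x\<in>carrier G. f x = (\<Sum>\<pi>\<in>dual G. \<alpha> \<pi> * char_of \<pi> x)) \<and>
     r = (\<Sum>\<pi>\<in>dual G. real (degree_of G \<pi>) * cmod (\<alpha> \<pi>)))"

definition ZA :: "('a, 'b) monoid_scheme \<Rightarrow> ('a \<Rightarrow> complex) normed_algebra" where
  "ZA G =
     \<lparr>carrier = class_functions G,
      monoid.mult = (\<lambda>f g. \<lambda>x\<in>carrier G. f x * g x),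
      one = (\<lambda>x\<in>carrier G. 1),
      zero = (\<lambda>x\<in>carrier G. 0),
      add = (\<lambda>f g. \<lambda>x\<in>carrier G. f x + g x),
      module.smult = (\<lambda>c f. \<lambda>x\<in>carrier G. c * f x),
      nrm = ZA_norm G\<rparr>"

end

theory Submission
  imports Defs "Jordan_Normal_Form.Spectral_Radius"
begin

text \<open>
  The algebra \<open>ZA(G)\<close> has finite dimension and is spanned by the indicator functions \<open>1\<^sub>C\<close> of the
  conjugacy classes, which are orthogonal idempotents. In such an algebra the only tensor \<open>u\<close>
  with \<open>(a \<otimes> 1) u = u (1 \<otimes> a)\<close> for all \<open>a\<close> and \<open>m(u) = 1\<close> is \<open>\<Delta> = \<Sum>C. 1\<^sub>C \<otimes> 1\<^sub>C\<close>. The constant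
  net \<open>\<Delta>\<close> is thus a bounded approximate diagonal, and every other one converges to \<open>\<Delta>\<close> on each
  bilinear form; hence the amenability constant is the projective norm of \<open>\<Delta>\<close>.

  As a normed space \<open>ZA(G)\<close> is a weighted \<open>\<ell>\<^sup>1\<close>-space over the dual of \<open>G\<close>: the irreducible characters
  are a basis and \<open>\<chi>\<^sub>\<pi>\<close> has weight \<open>d\<^sub>\<pi>\<close>. The projective tensor square of an \<open>\<ell>\<^sup>1\<close>-space is an
  \<open>\<ell>\<^sup>1\<close>-space, so the norm of \<open>\<Delta>\<close> is read off from its coefficients in the basis \<open>\<chi>\<^sub>\<pi> \<otimes> \<chi>\<^sub>\<sigma>\<close>.
  By orthogonality \<open>1\<^sub>C\<close> has \<open>\<chi>\<^sub>\<pi>\<close>-coefficient \<open>|C| / |G|\<close> times the conjugate of \<open>\<chi>\<^sub>\<pi>(C)\<close>, which gives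
  the stated sum, up to the involution of the dual that conjugates the characters. The finite
  sum of elementary tensors bounds the norm from above (\<open>diagonal_tensor_proj\<close>). For the bound from
  below (\<open>diagonal_norm_le_bound\<close>) it is enough to evaluate tensors at one bilinear form of norm at
  most \<open>1\<close>, \<open>norming_form\<close>, whose value at \<open>\<Delta>\<close> is the norm of \<open>\<Delta>\<close>.

  Evaluation of \<open>\<Delta>\<close> at a pair \<open>(x, x)\<close> is \<open>1\<close>, and point evaluations are contractive, so the constant
  is at least \<open>1\<close>. If it is \<open>1\<close>, the triangle inequality in this evaluation is an equality, which
  forces \<open>|\<chi>\<^sub>\<pi>(x)| = d\<^sub>\<pi>\<close> for all \<open>\<pi>\<close> and \<open>x\<close>; as the sum of the \<open>|\<chi>\<^sub>\<pi>(x)|\<^sup>2\<close> is \<open>|G|\<close> divided by the size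
  of the class of \<open>x\<close>, all classes are singletons. If \<open>G\<close> is abelian, the formula collapses to
  \<open>(\<Sum>\<pi>. d\<^sub>\<pi>\<^sup>2) / |G| = 1\<close>.

  The character theory that this uses is developed from Schur's lemma: \<open>char_of_orthogonality\<close> and
  the completeness theorem \<open>class_function_expansion\<close>.
\<close>

section \<open>Complex matrices and isometries\<close>

lemma mat_adjoint_dim [simp]:
  "dim_row (mat_adjoint A) = dim_col A" "dim_col (mat_adjoint A) = dim_row A"
  unfolding mat_adjoint_def by auto

lemma mat_adjoint_carrier [simp, intro]:
  "A \<in> carrier_mat m n \<Longrightarrow> mat_adjoint A \<in> carrier_mat n m"
  by (intro carrier_matI) auto

lemma mat_adjoint_index [simp]:
  fixes A :: "complex mat"
  assumes "i < dim_col A" "j < dim_row A"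
  shows "mat_adjoint A $$ (i, j) = cnj (A $$ (j, i))"
  using assms unfolding mat_adjoint_def by (simp add: mat_of_rows_index)

lemma mat_adjoint_adjoint [simp]: "mat_adjoint (mat_adjoint A) = (A :: complex mat)"
  by (intro eq_matI) auto

lemma mat_adjoint_mult:
  fixes A B :: "complex mat"
  assumes "A \<in> carrier_mat m n" "B \<in> carrier_mat n p"
  shows "mat_adjoint (A * B) = mat_adjoint B * mat_adjoint A"
  using assms by (intro eq_matI) (auto simp: scalar_prod_def mult.commute)

lemma mat_trace_mult_comm:
  assumes "A \<in> carrier_mat m n" "B \<in> carrier_mat n m"
  shows "mat_trace (A * B) = mat_trace (B * A)"
proof -
  have "mat_trace (A * B) = (\<Sum>i<m. \<Sum>j<n. A $$ (i, j) * B $$ (j, i))"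
    using assms by (simp add: mat_trace_def scalar_prod_def atLeast0LessThan)
  also have "\<dots> = (\<Sum>j<n. \<Sum>i<m. B $$ (j, i) * A $$ (i, j))"
    by (subst sum.swap) (simp add: mult.commute)
  also have "\<dots> = mat_trace (B * A)"
    using assms by (simp add: mat_trace_def scalar_prod_def atLeast0LessThan)
  finally show ?thesis .
qed

lemma mat_trace_one: "mat_trace (1\<^sub>m n) = of_nat n"
  by (simp add: mat_trace_def)

lemma mat_trace_smult: "A \<in> carrier_mat n n \<Longrightarrow> mat_trace (c \<cdot>\<^sub>m A) = c * mat_trace A"
  by (simp add: mat_trace_def sum_distrib_left)

lemma mat_trace_adjoint_mult:
  assumes "A \<in> carrier_mat m n"
  shows "mat_trace (mat_adjoint A * A) = (\<Sum>j<n. \<Sum>i<m. of_real ((cmod (A $$ (i, j)))\<^sup>2))"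
  using assms
  by (simp add: mat_trace_def scalar_prod_def atLeast0LessThan complex_norm_square mult.commute
      del: of_real_power)

lemma mat_adjoint_mult_eq_0:
  fixes A :: "complex mat"
  assumes A: "A \<in> carrier_mat m n" and "mat_trace (mat_adjoint A * A) = 0"
  shows "A = 0\<^sub>m m n"
proof -
  have "of_real (\<Sum>j<n. \<Sum>i<m. (cmod (A $$ (i, j)))\<^sup>2) = (0::complex)"
    using mat_trace_adjoint_mult[OF A] assms(2) by simp
  then have "(\<Sum>j<n. \<Sum>i<m. (cmod (A $$ (i, j)))\<^sup>2) = 0"
    by (simp only: of_real_eq_0_iff)
  then have "\<And>i j. i < m \<Longrightarrow> j < n \<Longrightarrow> A $$ (i, j) = 0"
    by (subst (asm) sum_nonneg_eq_0_iff) (auto simp: sum_nonneg sum_nonneg_eq_0_iff)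
  with A show ?thesis by (intro eq_matI) auto
qed

text \<open>All matrices share one type, which has no neutral element for addition; the size of a possibly
  empty sum has to be given.\<close>

definition mat_sum :: "nat \<Rightarrow> nat \<Rightarrow> 'i set \<Rightarrow> ('i \<Rightarrow> complex mat) \<Rightarrow> complex mat" where
  "mat_sum m n S F = mat m n (\<lambda>ij. \<Sum>s\<in>S. F s $$ ij)"

lemma mat_sum_carrier [simp]: "mat_sum m n S F \<in> carrier_mat m n"
  and mat_sum_dim [simp]: "dim_row (mat_sum m n S F) = m" "dim_col (mat_sum m n S F) = n"
  by (simp_all add: mat_sum_def)

lemma mat_sum_index [simp]:
  "i < m \<Longrightarrow> j < n \<Longrightarrow> mat_sum m n S F $$ (i, j) = (\<Sum>s\<in>S. F s $$ (i, j))"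
  by (simp add: mat_sum_def)

lemma mult_mat_sum:
  assumes A: "A \<in> carrier_mat m n" and F: "\<And>s. s \<in> S \<Longrightarrow> F s \<in> carrier_mat n p"
  shows "A * mat_sum n p S F = mat_sum m p S (\<lambda>s. A * F s)"
proof (rule eq_matI)
  fix i j assume ij: "i < dim_row (mat_sum m p S (\<lambda>s. A * F s))"
    "j < dim_col (mat_sum m p S (\<lambda>s. A * F s))"
  then have ij: "i < m" "j < p" by auto
  have "(A * mat_sum n p S F) $$ (i, j) = (\<Sum>k<n. \<Sum>s\<in>S. A $$ (i, k) * F s $$ (k, j))"
    using A ij by (simp add: scalar_prod_def atLeast0LessThan sum_distrib_left)
  also have "\<dots> = (\<Sum>s\<in>S. \<Sum>k<n. A $$ (i, k) * F s $$ (k, j))"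
    by (rule sum.swap)
  also have "\<dots> = (\<Sum>s\<in>S. (A * F s) $$ (i, j))"
    using A ij by (intro sum.cong refl) (use F in \<open>force simp: scalar_prod_def atLeast0LessThan\<close>)
  finally show "(A * mat_sum n p S F) $$ (i, j) = mat_sum m p S (\<lambda>s. A * F s) $$ (i, j)"
    using ij by simp
qed (use A in auto)

lemma mat_sum_mult:
  assumes A: "A \<in> carrier_mat n p" and F: "\<And>s. s \<in> S \<Longrightarrow> F s \<in> carrier_mat m n"
  shows "mat_sum m n S F * A = mat_sum m p S (\<lambda>s. F s * A)"
proof (rule eq_matI)
  fix i j assume ij: "i < dim_row (mat_sum m p S (\<lambda>s. F s * A))"
    "j < dim_col (mat_sum m p S (\<lambda>s. F s * A))"
  then have ij: "i < m" "j < p" by auto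
  have "(mat_sum m n S F * A) $$ (i, j) = (\<Sum>k<n. \<Sum>s\<in>S. F s $$ (i, k) * A $$ (k, j))"
    using A ij by (simp add: scalar_prod_def atLeast0LessThan sum_distrib_right)
  also have "\<dots> = (\<Sum>s\<in>S. \<Sum>k<n. F s $$ (i, k) * A $$ (k, j))"
    by (rule sum.swap)
  also have "\<dots> = (\<Sum>s\<in>S. (F s * A) $$ (i, j))"
    using A ij by (intro sum.cong refl) (use F in \<open>force simp: scalar_prod_def atLeast0LessThan\<close>)
  finally show "(mat_sum m n S F * A) $$ (i, j) = mat_sum m p S (\<lambda>s. F s * A) $$ (i, j)"
    using ij by simp
qed (use A in auto)

lemma mat_sum_cong:
  "(\<And>s. s \<in> S \<Longrightarrow> F s = F' s) \<Longrightarrow> mat_sum m n S F = mat_sum m n S F'"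
  unfolding mat_sum_def by (intro eq_matI) auto

lemma mat_sum_reindex:
  assumes "bij_betw \<phi> S T"
  shows "mat_sum m n T F = mat_sum m n S (\<lambda>s. F (\<phi> s))"
  unfolding mat_sum_def by (intro eq_matI) (auto simp: sum.reindex_bij_betw[OF assms, symmetric])

lemma mat_trace_mat_sum:
  assumes "\<And>s. s \<in> S \<Longrightarrow> F s \<in> carrier_mat n n"
  shows "mat_trace (mat_sum n n S F) = (\<Sum>s\<in>S. mat_trace (F s))"
proof -
  have "mat_trace (mat_sum n n S F) = (\<Sum>s\<in>S. \<Sum>i<n. F s $$ (i, i))"
    by (simp add: mat_trace_def) (rule sum.swap)
  also have "\<dots> = (\<Sum>s\<in>S. mat_trace (F s))"
    using assms by (intro sum.cong) (force simp: mat_trace_def)+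
  finally show ?thesis .
qed

abbreviation vec_subspace :: "nat \<Rightarrow> complex vec set \<Rightarrow> bool" where
  "vec_subspace n W \<equiv> VectorSpace.subspace class_ring W (module_vec TYPE(complex) n)"

lemma vec_subspace_iff:
  "vec_subspace n W \<longleftrightarrow> W \<subseteq> carrier_vec n \<and> 0\<^sub>v n \<in> W \<and>
     (\<forall>v\<in>W. \<forall>w\<in>W. v + w \<in> W) \<and> (\<forall>c. \<forall>v\<in>W. c \<cdot>\<^sub>v v \<in> W)"
proof -
  have "vectorspace class_ring (module_vec TYPE(complex) n)"
    "Module.module class_ring (module_vec TYPE(complex) n)"
    by (rule vec_vs, rule vec_module)
  then show ?thesis
    unfolding VectorSpace.subspace_def submodule_def by (auto simp: module_vec_simps)
qed

lemma mult_mat_regroup: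
  assumes "A \<in> carrier_mat m n" "B \<in> carrier_mat n p" "C \<in> carrier_mat p q" "D \<in> carrier_mat q r"
  shows "A * B * (C * D) = A * (B * C) * D"
proof -
  have "A * B * (C * D) = A * B * C * D"
    by (rule assoc_mult_mat[symmetric, OF mult_carrier_mat[OF assms(1,2)] assms(3,4)])
  also have "A * B * C = A * (B * C)"
    by (rule assoc_mult_mat[OF assms(1-3)])
  finally show ?thesis .
qed

definition isometry_mat :: "nat \<Rightarrow> nat \<Rightarrow> complex mat \<Rightarrow> bool" where
  "isometry_mat n d V \<longleftrightarrow> V \<in> carrier_mat n d \<and> mat_adjoint V * V = 1\<^sub>m d"

text \<open>With \<open>d > n\<close>, adding zero rows would give a square isometry, hence a unitary matrix, with a
  zero row.\<close>

lemma isometry_mat_dim_le: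
  assumes "isometry_mat n d V"
  shows "d \<le> n"
proof (rule ccontr)
  assume "\<not> d \<le> n"
  then have nd: "n < d" by simp
  have V: "V \<in> carrier_mat n d" and VV: "mat_adjoint V * V = 1\<^sub>m d"
    using assms by (auto simp: isometry_mat_def)
  define W where "W = mat d d (\<lambda>(i, j). if i < n then V $$ (i, j) else 0)"
  have W: "W \<in> carrier_mat d d" by (simp add: W_def)
  have "mat_adjoint W * W = mat_adjoint V * V"
  proof (rule eq_matI)
    fix i j assume "i < dim_row (mat_adjoint V * V)" "j < dim_col (mat_adjoint V * V)"
    then have ij: "i < d" "j < d" using V by auto
    have "(mat_adjoint W * W) $$ (i, j) = (\<Sum>k<d. cnj (W $$ (k, i)) * W $$ (k, j))"
      using W ij by (simp add: scalar_prod_def atLeast0LessThan)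
    also have "\<dots> = (\<Sum>k<n. cnj (W $$ (k, i)) * W $$ (k, j))"
      using nd ij by (intro sum.mono_neutral_right) (auto simp: W_def)
    also have "\<dots> = (mat_adjoint V * V) $$ (i, j)"
      using V ij nd by (simp add: scalar_prod_def atLeast0LessThan W_def)
    finally show "(mat_adjoint W * W) $$ (i, j) = (mat_adjoint V * V) $$ (i, j)" .
  qed (use V W in auto)
  then have "W * mat_adjoint W = 1\<^sub>m d"
    using mat_mult_left_right_inverse[OF mat_adjoint_carrier[OF W] W] VV by simp
  moreover have "(W * mat_adjoint W) $$ (n, n) = 0"
    using nd by (simp add: W_def scalar_prod_def)
  ultimately show False using nd by simp
qed

lemma isometry_mat_mult:
  assumes "isometry_mat n d V" "isometry_mat d e U"
  shows "isometry_mat n e (V * U)"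
proof -
  have V: "V \<in> carrier_mat n d" "mat_adjoint V * V = 1\<^sub>m d"
    and U: "U \<in> carrier_mat d e" "mat_adjoint U * U = 1\<^sub>m e"
    using assms by (auto simp: isometry_mat_def)
  have "mat_adjoint (V * U) * (V * U) = mat_adjoint U * (mat_adjoint V * V) * U"
    unfolding mat_adjoint_mult[OF V(1) U(1)] 
    by (rule mult_mat_regroup[OF mat_adjoint_carrier[OF U(1)] mat_adjoint_carrier[OF V(1)] V(1) U(1)])
  with U V show ?thesis by (auto simp: isometry_mat_def)
qed

lemma mult_mat_vec_snoc_col:
  assumes V: "V \<in> carrier_mat n d" and q: "q \<in> carrier_vec n" and u: "u \<in> carrier_vec (Suc d)"
  shows "mat n (Suc d) (\<lambda>(i, j). if j < d then V $$ (i, j) else q $ i) *\<^sub>v u =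
    V *\<^sub>v vec d (\<lambda>j. u $ j) + u $ d \<cdot>\<^sub>v (q :: complex vec)"
proof (rule eq_vecI)
  fix i assume "i < dim_vec (V *\<^sub>v vec d (\<lambda>j. u $ j) + u $ d \<cdot>\<^sub>v q)"
  then have i: "i < n" using V q by simp
  show "(mat n (Suc d) (\<lambda>(i, j). if j < d then V $$ (i, j) else q $ i) *\<^sub>v u) $ i =
    (V *\<^sub>v vec d (\<lambda>j. u $ j) + u $ d \<cdot>\<^sub>v q) $ i"
    using V q u i by (simp add: scalar_prod_def atLeast0LessThan)
qed (use V q in auto)

text \<open>Gram-Schmidt: an isometry into the subspace with the largest possible number of columns
  is onto, as otherwise the normalised residue of a missed vector is one more column.\<close>

lemma subspace_isometry:
  assumes W: "vec_subspace n W"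
  obtains d V where "isometry_mat n d V" "W = (\<lambda>u. V *\<^sub>v u) ` carrier_vec d"
proof -
  have Wc: "W \<subseteq> carrier_vec n" and W0: "0\<^sub>v n \<in> W"
    and Wadd: "\<And>v w. v \<in> W \<Longrightarrow> w \<in> W \<Longrightarrow> v + w \<in> W"
    and Wsm: "\<And>c v. v \<in> W \<Longrightarrow> c \<cdot>\<^sub>v v \<in> W"
    using W by (auto simp: vec_subspace_iff)
  define P where "P d \<longleftrightarrow> (\<exists>V. isometry_mat n d V \<and> (\<forall>u\<in>carrier_vec d. V *\<^sub>v u \<in> W))" for d
  have P_le: "d \<le> n" if "P d" for d
    using that isometry_mat_dim_le by (auto simp: P_def)
  have "P 0"
  proof -
    have "isometry_mat n 0 (0\<^sub>m n 0)" by (auto simp: isometry_mat_def intro!: eq_matI)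
    moreover have "0\<^sub>m n 0 *\<^sub>v u = 0\<^sub>v n" if "u \<in> carrier_vec 0" for u :: "complex vec"
      using that by (intro eq_vecI) (auto simp: scalar_prod_def)
    ultimately show ?thesis using W0 by (auto simp: P_def)
  qed
  define d where "d = (GREATEST d. P d)"
  have "P d" unfolding d_def using \<open>P 0\<close> P_le by (rule GreatestI_nat)
  have d_max: "k \<le> d" if "P k" for k
    unfolding d_def using that P_le by (rule Greatest_le_nat)
  from \<open>P d\<close> obtain V where V: "isometry_mat n d V" and VW: "\<And>u. u \<in> carrier_vec d \<Longrightarrow> V *\<^sub>v u \<in> W"
    by (auto simp: P_def)
  have Vc: "V \<in> carrier_mat n d" and VV: "mat_adjoint V * V = 1\<^sub>m d"
    using V by (auto simp: isometry_mat_def)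
  have "w \<in> (\<lambda>u. V *\<^sub>v u) ` carrier_vec d" if w: "w \<in> W" for w
  proof (rule ccontr)
    assume nw: "w \<notin> (\<lambda>u. V *\<^sub>v u) ` carrier_vec d"
    have wc: "w \<in> carrier_vec n" using w Wc by auto
    define a where "a = mat_adjoint V *\<^sub>v w"
    have ac: "a \<in> carrier_vec d"
      unfolding a_def by (rule mult_mat_vec_carrier[OF mat_adjoint_carrier[OF Vc] wc])
    \<comment> \<open>The residue of \<open>w\<close> after projection onto the range of \<open>V\<close>; its normalisation \<open>q\<close> is the new column.\<close>
    define r where "r = w + (-1) \<cdot>\<^sub>v (V *\<^sub>v a)"
    have rc: "r \<in> carrier_vec n"
      using wc mult_mat_vec_carrier[OF Vc ac] by (simp add: r_def)
    have rW: "r \<in> W" unfolding r_def using w VW[OF ac] by (intro Wadd Wsm)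
    have r0: "r \<noteq> 0\<^sub>v n"
    proof
      assume "r = 0\<^sub>v n"
      then have "\<And>i. i < n \<Longrightarrow> r $ i = 0" by simp
      then have "w = V *\<^sub>v a"
        using wc Vc by (intro eq_vecI) (auto simp: r_def)
      with nw ac show False by auto
    qed
    have Vr: "mat_adjoint V *\<^sub>v r = 0\<^sub>v d"
    proof -
      have "mat_adjoint V *\<^sub>v r = a + mat_adjoint V *\<^sub>v ((-1) \<cdot>\<^sub>v (V *\<^sub>v a))"
        using mult_add_distrib_mat_vec[OF mat_adjoint_carrier[OF Vc] wc, of "(-1) \<cdot>\<^sub>v (V *\<^sub>v a)"]
          mult_mat_vec_carrier[OF Vc ac]
        by (simp add: r_def flip: a_def)
      also have "mat_adjoint V *\<^sub>v ((-1) \<cdot>\<^sub>v (V *\<^sub>v a)) = (-1) \<cdot>\<^sub>v (mat_adjoint V *\<^sub>v (V *\<^sub>v a))"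
        using Vc ac by (intro mult_mat_vec) auto
      also have "mat_adjoint V *\<^sub>v (V *\<^sub>v a) = (mat_adjoint V * V) *\<^sub>v a"
        using Vc ac by (intro assoc_mult_mat_vec[symmetric]) auto
      also have "\<dots> = a" using VV ac by simp
      finally show ?thesis using ac by (intro eq_vecI) auto
    qed
    define s where "s = (\<Sum>i<n. (cmod (r $ i))\<^sup>2)"
    have s0: "s > 0"
    proof -
      obtain i where "i < n" "r $ i \<noteq> 0"
        using r0 rc by (metis carrier_vecD eq_vecI index_zero_vec(1) index_zero_vec(2))
      then show ?thesis unfolding s_def by (intro sum_pos2[of _ i]) auto
    qed
    define q where "q = complex_of_real (1 / sqrt s) \<cdot>\<^sub>v r"
    have qc: "q \<in> carrier_vec n" and qW: "q \<in> W" using rc rW Wsm by (auto simp: q_def)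
    have Vq: "(\<Sum>i<n. cnj (V $$ (i, j)) * q $ i) = 0" if j: "j < d" for j
    proof -
      have "(mat_adjoint V *\<^sub>v r) $ j = 0" using Vr j by simp
      then have "(\<Sum>i<n. cnj (V $$ (i, j)) * r $ i) = 0"
        using Vc rc j by (simp add: scalar_prod_def atLeast0LessThan)
      moreover have "(\<Sum>i<n. cnj (V $$ (i, j)) * q $ i) =
          of_real (1 / sqrt s) * (\<Sum>i<n. cnj (V $$ (i, j)) * r $ i)"
        using rc by (simp add: q_def sum_distrib_left mult_ac)
      ultimately show ?thesis by simp
    qed
    have qV: "(\<Sum>i<n. cnj (q $ i) * V $$ (i, j)) = 0" if j: "j < d" for j
    proof -
      have "(\<Sum>i<n. cnj (q $ i) * V $$ (i, j)) = cnj (\<Sum>i<n. cnj (V $$ (i, j)) * q $ i)"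
        by (simp add: mult.commute)
      then show ?thesis using Vq[OF j] by simp
    qed
    have qq: "(\<Sum>i<n. cnj (q $ i) * q $ i) = 1"
    proof -
      have "cnj (q $ i) * q $ i = of_real ((cmod (r $ i))\<^sup>2 / s)" if "i < n" for i
      proof -
        have "cnj (q $ i) * q $ i = of_real ((cmod (q $ i))\<^sup>2)"
          by (simp only: complex_norm_square mult.commute)
        also have "(cmod (q $ i))\<^sup>2 = (cmod (r $ i))\<^sup>2 / s"
          using that rc s0 by (simp add: q_def norm_mult norm_divide power_divide)
        finally show ?thesis .
      qed
      then have "(\<Sum>i<n. cnj (q $ i) * q $ i) = (\<Sum>i<n. of_real ((cmod (r $ i))\<^sup>2 / s))"
        by (intro sum.cong) auto
      also have "\<dots> = of_real (s / s)"
        by (simp only: s_def of_real_sum sum_divide_distrib)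
      finally show ?thesis using s0 by simp
    qed
    define V' where "V' = mat n (Suc d) (\<lambda>(i, j). if j < d then V $$ (i, j) else q $ i)"
    have V'c: "V' \<in> carrier_mat n (Suc d)" by (simp add: V'_def)
    have VVij: "(\<Sum>k<n. cnj (V $$ (k, i)) * V $$ (k, j)) = (if i = j then 1 else 0)"
      if "i < d" "j < d" for i j
    proof -
      have "(mat_adjoint V * V) $$ (i, j) = (\<Sum>k<n. cnj (V $$ (k, i)) * V $$ (k, j))"
        using Vc that by (simp add: scalar_prod_def atLeast0LessThan)
      then show ?thesis using VV that by simp
    qed
    have "mat_adjoint V' * V' = 1\<^sub>m (Suc d)"
    proof (rule eq_matI)
      fix i j assume "i < dim_row (1\<^sub>m (Suc d) :: complex mat)" "j < dim_col (1\<^sub>m (Suc d) :: complex mat)"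
      then have ij: "i < Suc d" "j < Suc d" by auto
      have "(mat_adjoint V' * V') $$ (i, j) = (\<Sum>k<n. cnj (V' $$ (k, i)) * V' $$ (k, j))"
        using V'c ij by (simp add: scalar_prod_def atLeast0LessThan)
      also have "\<dots> = (if i = j then 1 else 0)"
        using ij VVij Vq qV qq
        by (cases "i < d"; cases "j < d") (auto simp: V'_def less_Suc_eq)
      finally show "(mat_adjoint V' * V') $$ (i, j) = 1\<^sub>m (Suc d) $$ (i, j)" using ij by simp
    qed (use V'c in auto)
    moreover have "V' *\<^sub>v u \<in> W" if "u \<in> carrier_vec (Suc d)" for u
      unfolding V'_def mult_mat_vec_snoc_col[OF Vc qc that]
      using VW qW by (intro Wadd Wsm) auto
    ultimately have "P (Suc d)" using V'c by (auto simp: P_def isometry_mat_def)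
    from d_max[OF this] show False by simp
  qed
  with VW have "W = (\<lambda>u. V *\<^sub>v u) ` carrier_vec d" by auto
  with V that show ?thesis by blast
qed

lemma eq_mat_vecI:
  fixes A B :: "complex mat"
  assumes A: "A \<in> carrier_mat m n" and B: "B \<in> carrier_mat m n"
    and eq: "\<And>v. v \<in> carrier_vec n \<Longrightarrow> A *\<^sub>v v = B *\<^sub>v v"
  shows "A = B"
proof (rule eq_matI)
  fix i j assume "i < dim_row B" "j < dim_col B"
  then have ij: "i < m" "j < n" using B by auto
  have "M $$ (i, j) = (M *\<^sub>v unit_vec n j) $ i" if "M \<in> carrier_mat m n" for M :: "complex mat"
    using that ij by (simp add: scalar_prod_right_unit)
  then show "A $$ (i, j) = B $$ (i, j)" using A B eq[of "unit_vec n j"] by simp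
qed (use A B in auto)

text \<open>\<open>V V\<^sup>*\<close> is the orthogonal projection onto the range of \<open>V\<close>.\<close>

lemma isometry_mult_adjoint_onto:
  assumes V: "isometry_mat n d V" and A: "A \<in> carrier_mat n e"
    and range: "\<And>v. v \<in> carrier_vec e \<Longrightarrow> A *\<^sub>v v \<in> (\<lambda>u. V *\<^sub>v u) ` carrier_vec d"
  shows "V * (mat_adjoint V * A) = A"
proof (rule eq_mat_vecI)
  have Vc: "V \<in> carrier_mat n d" and VV: "mat_adjoint V * V = 1\<^sub>m d"
    using V by (auto simp: isometry_mat_def)
  note Ac = mat_adjoint_carrier[OF Vc]
  show "V * (mat_adjoint V * A) \<in> carrier_mat n e"
    by (rule mult_carrier_mat[OF Vc mult_carrier_mat[OF Ac A]])
  fix v :: "complex vec" assume v: "v \<in> carrier_vec e"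
  obtain u where u: "u \<in> carrier_vec d" "A *\<^sub>v v = V *\<^sub>v u" using range[OF v] by auto
  have "V * (mat_adjoint V * A) *\<^sub>v v = V *\<^sub>v (mat_adjoint V *\<^sub>v (V *\<^sub>v u))"
    using assoc_mult_mat_vec[OF Vc mult_carrier_mat[OF Ac A] v] assoc_mult_mat_vec[OF Ac A v] u(2)
    by simp
  also have "mat_adjoint V *\<^sub>v (V *\<^sub>v u) = u"
    using assoc_mult_mat_vec[OF Ac Vc u(1)] VV u(1) by simp
  finally show "V * (mat_adjoint V * A) *\<^sub>v v = A *\<^sub>v v" using u by simp
qed (rule A)

lemma smult_mat_mult_vec_one:
  "w \<in> carrier_vec n \<Longrightarrow> (c \<cdot>\<^sub>m 1\<^sub>m n) *\<^sub>v w = c \<cdot>\<^sub>v (w :: complex vec)"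
  by (intro eq_vecI) auto

lemma mult_smult_one_mat:
  fixes A :: "complex mat"
  assumes "A \<in> carrier_mat m n"
  shows "A * (c \<cdot>\<^sub>m 1\<^sub>m n) = c \<cdot>\<^sub>m A" "(c \<cdot>\<^sub>m 1\<^sub>m m) * A = c \<cdot>\<^sub>m A"
  using mult_smult_distrib[OF assms one_carrier_mat] mult_smult_assoc_mat[OF one_carrier_mat assms]
    right_mult_one_mat[OF assms] left_mult_one_mat[OF assms] by simp_all

lemma mat_trace_smult_one: "mat_trace (c \<cdot>\<^sub>m 1\<^sub>m n) = c * of_nat n"
  by (simp add: mat_trace_smult[of _ n] mat_trace_one)

definition matrix_unit :: "nat \<Rightarrow> nat \<Rightarrow> nat \<Rightarrow> nat \<Rightarrow> complex mat" where
  "matrix_unit m n k l = mat m n (\<lambda>(i, j). if i = k \<and> j = l then 1 else 0)"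

lemma matrix_unit_carrier [simp]: "matrix_unit m n k l \<in> carrier_mat m n"
  by (simp add: matrix_unit_def)

lemma mult_matrix_unit_mult_index:
  assumes A: "A \<in> carrier_mat p m" and B: "B \<in> carrier_mat n q"
    and "k < m" "l < n" "i < p" "j < q"
  shows "(A * matrix_unit m n k l * B) $$ (i, j) = A $$ (i, k) * B $$ (l, j)"
proof -
  have AE: "(A * matrix_unit m n k l) $$ (i, b) = (if b = l then A $$ (i, k) else 0)" if "b < n" for b
    using assms that by (simp add: scalar_prod_def matrix_unit_def if_distrib cong: if_cong)
  define M where "M = A * matrix_unit m n k l"
  have M: "M \<in> carrier_mat p n" unfolding M_def using A by (meson matrix_unit_carrier mult_carrier_mat)
  have "(A * matrix_unit m n k l * B) $$ (i, j) = (\<Sum>b = 0..<n. M $$ (i, b) * B $$ (b, j))"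
    using M B assms unfolding M_def[symmetric] by (auto simp: scalar_prod_def intro!: sum.cong)
  also have "\<dots> = (\<Sum>b = 0..<n. if b = l then A $$ (i, k) * B $$ (l, j) else 0)"
    by (intro sum.cong) (auto simp: M_def AE)
  finally show ?thesis using assms by simp
qed

lemma isometry_left_cancel:
  assumes V: "isometry_mat n d V" and A: "A \<in> carrier_mat d e" and B: "B \<in> carrier_mat d e"
    and eq: "V * A = V * B"
  shows "A = B"
proof -
  have Vc: "V \<in> carrier_mat n d" and VV: "mat_adjoint V * V = 1\<^sub>m d"
    using V by (auto simp: isometry_mat_def)
  have "M = mat_adjoint V * (V * M)" if "M \<in> carrier_mat d e" for M
    using assoc_mult_mat[OF mat_adjoint_carrier[OF Vc] Vc that] left_mult_one_mat[OF that] VV by simp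
  from this[OF A] this[OF B] eq show ?thesis by simp
qed

lemma mult_mat_vec_dim_0:
  assumes "A \<in> carrier_mat n 0" "u \<in> carrier_vec 0"
  shows "A *\<^sub>v u = (0\<^sub>v n :: complex vec)"
  using assms by (intro eq_vecI) (auto simp: scalar_prod_def)

lemma map_cnj_mult_mat:
  "A \<in> carrier_mat m n \<Longrightarrow> B \<in> carrier_mat n p \<Longrightarrow> map_mat cnj (A * B) = map_mat cnj A * map_mat cnj B"
  by (intro eq_matI) (auto simp: scalar_prod_def)

lemma conjugate_map_cnj_mult_vec:
  "A \<in> carrier_mat m n \<Longrightarrow> v \<in> carrier_vec n \<Longrightarrow>
    A *\<^sub>v conjugate v = conjugate (map_mat cnj A *\<^sub>v v)"
  by (intro eq_vecI) (auto simp: scalar_prod_def)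

lemma the_elem_image_constant:
  assumes "a \<in> A" "\<And>b. b \<in> A \<Longrightarrow> f b = f a"
  shows "the_elem (f ` A) = f a"
proof -
  have "f ` A = (\<lambda>_. f a) ` A" by (rule image_cong[OF refl assms(2)])
  also have "\<dots> = {f a}" using assms(1) by auto
  finally have "f ` A = {f a}" .
  then show ?thesis by simp
qed

section \<open>Unitary representations\<close>

locale finite_group = group +
  assumes fin: "finite (carrier G)"

context finite_group
begin

context
  fixes n :: nat and \<rho> :: "'a \<Rightarrow> complex mat"
  assumes \<rho>: "unitary_rep G n \<rho>"
begin

lemma unitary_rep_in_unitary_group:
  "g \<in> carrier G \<Longrightarrow> \<rho> g \<in> carrier (unitary_group n)"
  using \<rho> by (auto simp: unitary_rep_def hom_def)

lemma unitary_rep_carrier: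
  "g \<in> carrier G \<Longrightarrow> \<rho> g \<in> carrier_mat n n"
  using unitary_rep_in_unitary_group by (auto simp: unitary_group_def)

lemma unitary_rep_unitary:
  assumes "g \<in> carrier G"
  shows "\<rho> g * mat_adjoint (\<rho> g) = 1\<^sub>m n" "mat_adjoint (\<rho> g) * \<rho> g = 1\<^sub>m n"
  using unitary_rep_in_unitary_group[OF assms] by (auto simp: unitary_group_def)

lemma unitary_rep_mult:
  "g \<in> carrier G \<Longrightarrow> h \<in> carrier G \<Longrightarrow> \<rho> (g \<otimes> h) = \<rho> g * \<rho> h"
  using \<rho> by (auto simp: unitary_rep_def hom_def unitary_group_def)

lemma unitary_rep_one: "\<rho> \<one> = 1\<^sub>m n"
proof -
  note c = unitary_rep_carrier[OF one_closed]
  have "\<rho> \<one> = \<rho> \<one> * (\<rho> \<one> * mat_adjoint (\<rho> \<one>))"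
    using c unitary_rep_unitary(1)[OF one_closed] by simp
  also have "\<dots> = \<rho> \<one> * \<rho> \<one> * mat_adjoint (\<rho> \<one>)"
    by (rule assoc_mult_mat[symmetric, OF c c mat_adjoint_carrier[OF c]])
  also have "\<dots> = 1\<^sub>m n"
    using unitary_rep_mult[OF one_closed one_closed] unitary_rep_unitary(1)[OF one_closed] by simp
  finally show ?thesis .
qed

lemma unitary_rep_inv:
  assumes g: "g \<in> carrier G"
  shows "\<rho> (inv g) = mat_adjoint (\<rho> g)"
proof -
  note c = unitary_rep_carrier[OF g] and c' = unitary_rep_carrier[OF inv_closed[OF g]]
  have "\<rho> (inv g) = \<rho> (inv g) * (\<rho> g * mat_adjoint (\<rho> g))"
    using c' unitary_rep_unitary(1)[OF g] by simp
  also have "\<dots> = \<rho> (inv g) * \<rho> g * mat_adjoint (\<rho> g)"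
    by (rule assoc_mult_mat[symmetric, OF c' c mat_adjoint_carrier[OF c]])
  also have "\<rho> (inv g) * \<rho> g = 1\<^sub>m n"
    using g unitary_rep_mult[of "inv g" g] unitary_rep_one by simp
  finally show ?thesis using c by simp
qed

lemma unitary_rep_trace_one: "mat_trace (\<rho> \<one>) = of_nat n"
  by (simp add: unitary_rep_one mat_trace_one)

lemma unitary_rep_trace_conj:
  assumes "g \<in> carrier G" "x \<in> carrier G"
  shows "mat_trace (\<rho> (g \<otimes> x \<otimes> inv g)) = mat_trace (\<rho> x)"
proof -
  note c = unitary_rep_carrier[OF assms(1)] unitary_rep_carrier[OF assms(2)]
  have "mat_trace (\<rho> (g \<otimes> x \<otimes> inv g)) = mat_trace (\<rho> g * \<rho> x * mat_adjoint (\<rho> g))"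
    using assms by (simp add: unitary_rep_mult unitary_rep_inv)
  also have "\<dots> = mat_trace (mat_adjoint (\<rho> g) * (\<rho> g * \<rho> x))"
    using c by (intro mat_trace_mult_comm[where m=n and n=n]) auto
  also have "mat_adjoint (\<rho> g) * (\<rho> g * \<rho> x) = mat_adjoint (\<rho> g) * \<rho> g * \<rho> x"
    by (rule assoc_mult_mat[symmetric, OF mat_adjoint_carrier[OF c(1)] c(1) c(2)])
  finally show ?thesis using c unitary_rep_unitary(2)[OF assms(1)] by simp
qed

lemma unitary_rep_trace_bound:
  assumes g: "g \<in> carrier G"
  shows "cmod (mat_trace (\<rho> g)) \<le> n"
proof -
  note c = unitary_rep_carrier[OF g]
  have "cmod (\<rho> g $$ (i, i)) \<le> 1" if i: "i < n" for i
  proof -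
    have "(\<Sum>k<n. of_real ((cmod (\<rho> g $$ (k, i)))\<^sup>2)) = (mat_adjoint (\<rho> g) * \<rho> g) $$ (i, i)"
      using c i by (simp add: scalar_prod_def atLeast0LessThan complex_norm_square mult.commute
          del: of_real_power)
    also have "\<dots> = 1" using i by (simp add: unitary_rep_unitary(2)[OF g])
    finally have "complex_of_real (\<Sum>k<n. (cmod (\<rho> g $$ (k, i)))\<^sup>2) = of_real 1" by simp
    then have "(\<Sum>k<n. (cmod (\<rho> g $$ (k, i)))\<^sup>2) = 1" by (simp only: of_real_eq_iff)
    moreover have "(cmod (\<rho> g $$ (i, i)))\<^sup>2 \<le> (\<Sum>k<n. (cmod (\<rho> g $$ (k, i)))\<^sup>2)"
      using i by (intro member_le_sum) auto
    ultimately show ?thesis by (simp add: power_le_one_iff abs_square_le_1)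
  qed
  then have "(\<Sum>i<n. cmod (\<rho> g $$ (i, i))) \<le> (\<Sum>i<n. 1)" by (intro sum_mono) auto
  moreover have "cmod (mat_trace (\<rho> g)) \<le> (\<Sum>i<n. cmod (\<rho> g $$ (i, i)))"
    using c by (simp add: mat_trace_def norm_sum)
  ultimately show ?thesis by simp
qed

end

text \<open>Schur's lemma: an eigenspace of \<open>T\<close> is an invariant subspace.\<close>

lemma irreducible_rep_commutant:
  assumes irr: "irreducible_rep G n \<rho>" and T: "T \<in> carrier_mat n n"
    and comm: "\<And>g. g \<in> carrier G \<Longrightarrow> T * \<rho> g = \<rho> g * T"
  shows "\<exists>c. T = c \<cdot>\<^sub>m 1\<^sub>m n"
proof -
  have \<rho>: "unitary_rep G n \<rho>" and n: "n > 0" using irr by (auto simp: irreducible_rep_def)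
  note \<rho>c = unitary_rep_carrier[OF \<rho>]
  from spectrum_non_empty[OF T n] obtain c v where v: "eigenvector T v c"
    by (auto simp: spectrum_def eigenvalue_def)
  then have v: "v \<in> carrier_vec n" "v \<noteq> 0\<^sub>v n" "T *\<^sub>v v = c \<cdot>\<^sub>v v"
    using T by (auto simp: eigenvector_def)
  define W where "W = {v \<in> carrier_vec n. T *\<^sub>v v = c \<cdot>\<^sub>v v}"
  have "vec_subspace n W"
    unfolding vec_subspace_iff
  proof (intro conjI ballI allI)
    show "0\<^sub>v n \<in> W" using T by (auto simp: W_def)
    show "x + y \<in> W" if "x \<in> W" "y \<in> W" for x y
      using that T by (auto simp: W_def mult_add_distrib_mat_vec[OF T] smult_add_distrib_vec[where n=n])
    show "a \<cdot>\<^sub>v x \<in> W" if "x \<in> W" for a x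
      using that T by (auto simp: W_def mult_mat_vec[OF T] smult_smult_assoc mult.commute)
  qed (auto simp: W_def)
  moreover have "\<rho> g *\<^sub>v w \<in> W" if g: "g \<in> carrier G" and w: "w \<in> W" for g w
  proof -
    have wc: "w \<in> carrier_vec n" and wT: "T *\<^sub>v w = c \<cdot>\<^sub>v w" using w by (auto simp: W_def)
    have "T *\<^sub>v (\<rho> g *\<^sub>v w) = (\<rho> g * T) *\<^sub>v w"
      by (simp add: comm[OF g, symmetric] assoc_mult_mat_vec[OF T \<rho>c[OF g] wc])
    also have "\<dots> = c \<cdot>\<^sub>v (\<rho> g *\<^sub>v w)"
      by (simp add: assoc_mult_mat_vec[OF \<rho>c[OF g] T wc] wT mult_mat_vec[OF \<rho>c[OF g] wc])
    finally show ?thesis using mult_mat_vec_carrier[OF \<rho>c[OF g] wc] by (simp add: W_def)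
  qed
  ultimately have "W = {0\<^sub>v n} \<or> W = carrier_vec n"
    using irr by (auto simp: irreducible_rep_def)
  moreover have "v \<in> W" using v by (simp add: W_def)
  ultimately have W: "W = carrier_vec n" using v by auto
  have "T = c \<cdot>\<^sub>m 1\<^sub>m n"
  proof (rule eq_mat_vecI[OF T])
    fix w :: "complex vec" assume w: "w \<in> carrier_vec n"
    then have "T *\<^sub>v w = c \<cdot>\<^sub>v w" using W by (auto simp: W_def)
    then show "T *\<^sub>v w = (c \<cdot>\<^sub>m 1\<^sub>m n) *\<^sub>v w"
      using w by (simp add: smult_mat_mult_vec_one)
  qed simp
  then show ?thesis ..
qed

end

section \<open>Schur orthogonality\<close>

text \<open>Averaging over the group turns any matrix into an intertwiner.\<close>

definition rep_average ::
    "('a, 'b) monoid_scheme \<Rightarrow> nat \<Rightarrow> nat \<Rightarrow> ('a \<Rightarrow> complex mat) \<Rightarrow> ('a \<Rightarrow> complex mat) \<Rightarrow>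
     complex mat \<Rightarrow> complex mat" where
  "rep_average G m n \<sigma> \<rho> X =
     mat_sum m n (carrier G) (\<lambda>g. \<sigma> g * X * mat_adjoint (\<rho> g))"

context finite_group
begin

text \<open>Take adjoints in the relation for \<open>g\<^sup>-\<^sup>1\<close>; \<open>\<rho> (g\<^sup>-\<^sup>1)\<close> is the adjoint of \<open>\<rho> g\<close>.\<close>

lemma adjoint_intertwiner:
  assumes \<rho>: "unitary_rep G n \<rho>" and \<sigma>: "unitary_rep G m \<sigma>" and T: "T \<in> carrier_mat m n"
    and comm: "\<And>g. g \<in> carrier G \<Longrightarrow> T * \<rho> g = \<sigma> g * T" and g: "g \<in> carrier G"
  shows "mat_adjoint T * \<sigma> g = \<rho> g * mat_adjoint T"
proof -
  have g': "inv g \<in> carrier G" using g by simp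
  note \<rho>c = unitary_rep_carrier[OF \<rho> g'] and \<sigma>c = unitary_rep_carrier[OF \<sigma> g']
  have "mat_adjoint (T * \<rho> (inv g)) = mat_adjoint (\<sigma> (inv g) * T)"
    using comm[OF g'] by simp
  then have "mat_adjoint (\<rho> (inv g)) * mat_adjoint T = mat_adjoint T * mat_adjoint (\<sigma> (inv g))"
    by (simp only: mat_adjoint_mult[OF T \<rho>c] mat_adjoint_mult[OF \<sigma>c T])
  then show ?thesis
    by (simp add: unitary_rep_inv[OF \<rho> g] unitary_rep_inv[OF \<sigma> g])
qed

text \<open>The scalars by which \<open>T\<^sup>* T\<close> and \<open>T T\<^sup>*\<close> act agree and have the traces of these two
  products, so both representations have the same degree and a multiple of \<open>T\<close> is unitary.\<close>

lemma inequivalent_intertwiner_zero: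
  assumes irr: "irreducible_rep G n \<rho>" "irreducible_rep G m \<sigma>"
    and T: "T \<in> carrier_mat m n"
    and comm: "\<And>g. g \<in> carrier G \<Longrightarrow> T * \<rho> g = \<sigma> g * T"
    and ineq: "(\<rho>, \<sigma>) \<notin> rep_equiv G"
  shows "T = 0\<^sub>m m n"
proof (rule ccontr)
  assume T0: "T \<noteq> 0\<^sub>m m n"
  have \<rho>: "unitary_rep G n \<rho>" and \<sigma>: "unitary_rep G m \<sigma>"
    using irr by (auto simp: irreducible_rep_def)
  note \<rho>c = unitary_rep_carrier[OF \<rho>] and \<sigma>c = unitary_rep_carrier[OF \<sigma>]
  let ?S = "mat_adjoint T"
  note S = mat_adjoint_carrier[OF T]
  have comm': "?S * \<sigma> g = \<rho> g * ?S" if "g \<in> carrier G" for g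
    by (rule adjoint_intertwiner[OF \<rho> \<sigma> T comm that])
  have "?S * T * \<rho> g = \<rho> g * (?S * T)" if g: "g \<in> carrier G" for g
    by (simp add: assoc_mult_mat[OF S T \<rho>c[OF g]] comm[OF g] comm'[OF g]
        assoc_mult_mat[OF S \<sigma>c[OF g] T, symmetric] assoc_mult_mat[OF \<rho>c[OF g] S T])
  then obtain c where c: "?S * T = c \<cdot>\<^sub>m 1\<^sub>m n"
    using irreducible_rep_commutant[OF irr(1) mult_carrier_mat[OF S T]] by blast
  have "T * ?S * \<sigma> g = \<sigma> g * (T * ?S)" if g: "g \<in> carrier G" for g
    by (simp add: assoc_mult_mat[OF T S \<sigma>c[OF g]] comm[OF g] comm'[OF g]
        assoc_mult_mat[OF T \<rho>c[OF g] S, symmetric] assoc_mult_mat[OF \<sigma>c[OF g] T S])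
  then obtain c' where c': "T * ?S = c' \<cdot>\<^sub>m 1\<^sub>m m"
    using irreducible_rep_commutant[OF irr(2) mult_carrier_mat[OF T S]] by blast
  have "c \<cdot>\<^sub>m T = T * (?S * T)"
    by (simp add: c mult_smult_one_mat(1)[OF T])
  also have "\<dots> = T * ?S * T" by (rule assoc_mult_mat[symmetric, OF T S T])
  also have "\<dots> = c' \<cdot>\<^sub>m T" by (simp add: c' mult_smult_one_mat(2)[OF T])
  finally have cc': "c \<cdot>\<^sub>m T = c' \<cdot>\<^sub>m T" .
  \<comment> \<open>Comparing \<open>T (T\<^sup>* T)\<close> with \<open>(T T\<^sup>*) T\<close> at a non-zero entry of \<open>T\<close>.\<close>
  obtain i j where ij: "i < m" "j < n" "T $$ (i, j) \<noteq> 0"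
    using T0 T by (metis carrier_matD(1) carrier_matD(2) eq_matI index_zero_mat(1-3))
  have "c = c'" using arg_cong[OF cc', of "\<lambda>M. M $$ (i, j)"] ij T by simp
  have trc: "mat_trace (?S * T) = c * of_nat n"
    by (simp add: c mat_trace_smult_one)
  have "mat_trace (?S * T) \<noteq> 0" using mat_adjoint_mult_eq_0[OF T] T0 by blast
  with trc have "c \<noteq> 0" by auto
  have "mat_trace (T * ?S) = c' * of_nat m"
    by (simp add: c' mat_trace_smult_one)
  with mat_trace_mult_comm[OF T S] trc \<open>c = c'\<close> \<open>c \<noteq> 0\<close> have mn: "m = n" by simp
  define s where "s = (\<Sum>j<n. \<Sum>i<m. (cmod (T $$ (i, j)))\<^sup>2)"
  have "c * of_nat n = of_real s"
    using trc mat_trace_adjoint_mult[OF T] by (simp add: s_def)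
  moreover have "s \<ge> 0" by (simp add: s_def sum_nonneg)
  moreover have "n > 0" using irr by (simp add: irreducible_rep_def)
  ultimately have "c = of_real (s / n)" "s / n \<ge> 0" by (simp_all add: field_simps)
  with \<open>c \<noteq> 0\<close> obtain t where t: "t > 0" "c = of_real t"
    by (metis less_eq_real_def of_real_0)
  \<comment> \<open>\<open>T\<^sup>* T\<close> is \<open>t\<close> times the identity, with \<open>t > 0\<close>.\<close>
  define a where "a = complex_of_real (1 / sqrt t)"
  have a: "a * cnj a * c = 1" "cnj a * a * c = 1"
  proof -
    have "1 / sqrt t * (1 / sqrt t) * t = 1" using t by (simp add: real_sqrt_mult_self)
    then have "complex_of_real (1 / sqrt t * (1 / sqrt t) * t) = 1" by simp
    then show "a * cnj a * c = 1" "cnj a * a * c = 1"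
      by (simp_all only: a_def t(2) of_real_mult complex_cnj_complex_of_real)
  qed
  define U where "U = a \<cdot>\<^sub>m T"
  have U: "U \<in> carrier_mat n n" using T mn by (simp add: U_def)
  have adjU: "mat_adjoint U = cnj a \<cdot>\<^sub>m ?S"
    using T by (intro eq_matI) (auto simp: U_def)
  have "U * mat_adjoint U = (a * cnj a) \<cdot>\<^sub>m (T * ?S)"
    using T S unfolding adjU U_def
    by (intro eq_matI) (auto simp: scalar_prod_def sum_distrib_left mult_ac)
  then have UU: "U * mat_adjoint U = 1\<^sub>m n"
    using a(1) \<open>c = c'\<close> mn by (intro eq_matI) (auto simp: c' mult.assoc)
  have "mat_adjoint U * U = (cnj a * a) \<cdot>\<^sub>m (?S * T)"
    using T S unfolding adjU U_def
    by (intro eq_matI) (auto simp: scalar_prod_def sum_distrib_left mult_ac)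
  then have "mat_adjoint U * U = 1\<^sub>m n"
    using a(2) by (intro eq_matI) (auto simp: c mult.assoc)
  with UU U have "U \<in> carrier (unitary_group n)" by (simp add: unitary_group_def)
  moreover have "U * \<rho> g = \<sigma> g * U" if g: "g \<in> carrier G" for g
    using comm[OF g] \<rho>c[OF g] \<sigma>c[OF g] T
    by (simp add: U_def mult_smult_distrib[of _ m m] mult_smult_assoc_mat[of _ m n])
  ultimately have "(\<rho>, \<sigma>) \<in> rep_equiv G"
    using \<rho> \<sigma> irr mn by (auto simp: rep_equiv_def irreps_def)
  with ineq show False ..
qed

lemma bij_betw_left_mult:
  assumes "h \<in> carrier G"
  shows "bij_betw (\<lambda>g. h \<otimes> g) (carrier G) (carrier G)"
proof -
  show ?thesis
    by (rule bij_betwI[where g="\<lambda>g. inv h \<otimes> g"])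
      (use assms in \<open>auto simp: m_assoc[symmetric]\<close>)
qed

lemma bij_betw_conjugation:
  assumes "h \<in> carrier G"
  shows "bij_betw (\<lambda>g. h \<otimes> g \<otimes> inv h) (carrier G) (carrier G)"
  using conjugation_is_bij[OF assms] by (simp cong: bij_betw_cong)

lemma rep_average_intertwines:
  assumes \<rho>: "unitary_rep G n \<rho>" and \<sigma>: "unitary_rep G m \<sigma>"
    and X: "X \<in> carrier_mat m n" and h: "h \<in> carrier G"
  shows "rep_average G m n \<sigma> \<rho> X * \<rho> h = \<sigma> h * rep_average G m n \<sigma> \<rho> X"
proof -
  note \<rho>c = unitary_rep_carrier[OF \<rho>] and \<sigma>c = unitary_rep_carrier[OF \<sigma>]
  have tc: "\<sigma> g * X * mat_adjoint (\<rho> g) \<in> carrier_mat m n" if "g \<in> carrier G" for g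
    using \<sigma>c[OF that] X \<rho>c[OF that] by (meson mult_carrier_mat mat_adjoint_carrier)
  have "rep_average G m n \<sigma> \<rho> X * \<rho> h =
      mat_sum m n (carrier G) (\<lambda>g. \<sigma> g * X * mat_adjoint (\<rho> g) * \<rho> h)"
    unfolding rep_average_def using tc by (intro mat_sum_mult[OF \<rho>c[OF h]]) auto
  also have "\<dots> = mat_sum m n (carrier G)
      (\<lambda>g. \<sigma> (h \<otimes> g) * X * mat_adjoint (\<rho> (h \<otimes> g)) * \<rho> h)"
    by (rule mat_sum_reindex[OF bij_betw_left_mult[OF h]])
  also have "\<dots> = mat_sum m n (carrier G) (\<lambda>g. \<sigma> h * (\<sigma> g * X * mat_adjoint (\<rho> g)))"
  proof (rule mat_sum_cong)
    fix g assume g: "g \<in> carrier G"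
    let ?a = "mat_adjoint (\<rho> g)" and ?b = "mat_adjoint (\<rho> h)"
    note ac = mat_adjoint_carrier[OF \<rho>c[OF g]] and bc = mat_adjoint_carrier[OF \<rho>c[OF h]]
    have sX: "\<sigma> (h \<otimes> g) * X \<in> carrier_mat m n"
      using \<sigma>c[of "h \<otimes> g"] g h X by (meson mult_carrier_mat m_closed)
    have "mat_adjoint (\<rho> (h \<otimes> g)) * \<rho> h = ?a * (?b * \<rho> h)"
      using assoc_mult_mat[OF ac bc \<rho>c[OF h]]
      by (simp add: unitary_rep_mult[OF \<rho> h g] mat_adjoint_mult[OF \<rho>c[OF h] \<rho>c[OF g]])
    also have "\<dots> = ?a" using unitary_rep_unitary(2)[OF \<rho> h] right_mult_one_mat[OF ac] by simp
    finally have 1: "mat_adjoint (\<rho> (h \<otimes> g)) * \<rho> h = ?a" .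
    have 2: "\<sigma> (h \<otimes> g) * X = \<sigma> h * (\<sigma> g * X)"
      using assoc_mult_mat[OF \<sigma>c[OF h] \<sigma>c[OF g] X] by (simp add: unitary_rep_mult[OF \<sigma> h g])
    have "\<sigma> (h \<otimes> g) * X * mat_adjoint (\<rho> (h \<otimes> g)) * \<rho> h = \<sigma> (h \<otimes> g) * X * ?a"
      using assoc_mult_mat[OF sX mat_adjoint_carrier[OF \<rho>c[OF m_closed[OF h g]]] \<rho>c[OF h]] 1 by simp
    also have "\<dots> = \<sigma> h * (\<sigma> g * X * ?a)"
      unfolding 2 by (rule assoc_mult_mat[OF \<sigma>c[OF h] mult_carrier_mat[OF \<sigma>c[OF g] X] ac])
    finally show "\<sigma> (h \<otimes> g) * X * mat_adjoint (\<rho> (h \<otimes> g)) * \<rho> h =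
      \<sigma> h * (\<sigma> g * X * mat_adjoint (\<rho> g))" .
  qed
  also have "\<dots> = \<sigma> h * rep_average G m n \<sigma> \<rho> X"
    unfolding rep_average_def using tc by (intro mult_mat_sum[OF \<sigma>c[OF h], symmetric]) auto
  finally show ?thesis .
qed

lemma rep_average_matrix_unit_index:
  assumes \<rho>: "unitary_rep G n \<rho>" and \<sigma>: "unitary_rep G m \<sigma>"
    and "i < m" "j < n"
  shows "rep_average G m n \<sigma> \<rho> (matrix_unit m n i j) $$ (i, j) =
    (\<Sum>g\<in>carrier G. \<sigma> g $$ (i, i) * cnj (\<rho> g $$ (j, j)))"
proof -
  note \<rho>c = unitary_rep_carrier[OF \<rho>] and \<sigma>c = unitary_rep_carrier[OF \<sigma>]
  have "(\<sigma> g * matrix_unit m n i j * mat_adjoint (\<rho> g)) $$ (i, j) = \<sigma> g $$ (i, i) * cnj (\<rho> g $$ (j, j))"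
    if g: "g \<in> carrier G" for g
    using mult_matrix_unit_mult_index[OF \<sigma>c[OF g] mat_adjoint_carrier[OF \<rho>c[OF g]], of i j i j]
      assms \<rho>c[OF g] by simp
  then show ?thesis using assms by (simp add: rep_average_def)
qed

text \<open>The sum over the group of \<open>\<sigma>\<^sub>i\<^sub>i\<close> times the conjugate of \<open>\<rho>\<^sub>j\<^sub>j\<close> is the entry \<open>(i, j)\<close> of the average
  of the matrix unit at \<open>(i, j)\<close>. This lets Schur's lemma evaluate inner products of characters.\<close>

lemma sum_trace_mult_cnj_trace:
  assumes \<rho>: "unitary_rep G n \<rho>" and \<sigma>: "unitary_rep G m \<sigma>"
  shows "(\<Sum>g\<in>carrier G. mat_trace (\<sigma> g) * cnj (mat_trace (\<rho> g))) =
    (\<Sum>i<m. \<Sum>j<n. rep_average G m n \<sigma> \<rho> (matrix_unit m n i j) $$ (i, j))"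
proof -
  note \<rho>c = unitary_rep_carrier[OF \<rho>] and \<sigma>c = unitary_rep_carrier[OF \<sigma>]
  have "(\<Sum>g\<in>carrier G. mat_trace (\<sigma> g) * cnj (mat_trace (\<rho> g))) =
      (\<Sum>g\<in>carrier G. \<Sum>i<m. \<Sum>j<n. \<sigma> g $$ (i, i) * cnj (\<rho> g $$ (j, j)))"
    using \<rho>c \<sigma>c by (intro sum.cong refl) (force simp: mat_trace_def sum_product)
  also have "\<dots> = (\<Sum>i<m. \<Sum>g\<in>carrier G. \<Sum>j<n. \<sigma> g $$ (i, i) * cnj (\<rho> g $$ (j, j)))"
    by (rule sum.swap)
  also have "\<dots> = (\<Sum>i<m. \<Sum>j<n. \<Sum>g\<in>carrier G. \<sigma> g $$ (i, i) * cnj (\<rho> g $$ (j, j)))"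
    by (intro sum.cong refl sum.swap)
  finally show ?thesis
    using assms by (simp add: rep_average_matrix_unit_index)
qed

lemma trace_orthogonality_inequivalent:
  assumes irr: "irreducible_rep G n \<rho>" "irreducible_rep G m \<sigma>"
    and ineq: "(\<rho>, \<sigma>) \<notin> rep_equiv G"
  shows "(\<Sum>g\<in>carrier G. mat_trace (\<sigma> g) * cnj (mat_trace (\<rho> g))) = 0"
proof -
  have \<rho>: "unitary_rep G n \<rho>" and \<sigma>: "unitary_rep G m \<sigma>"
    using irr by (auto simp: irreducible_rep_def)
  have "rep_average G m n \<sigma> \<rho> (matrix_unit m n i j) = 0\<^sub>m m n" for i j
    using inequivalent_intertwiner_zero[OF irr _ _ ineq]
      rep_average_intertwines[OF \<rho> \<sigma> matrix_unit_carrier]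
    by (simp add: rep_average_def)
  then show ?thesis by (simp add: sum_trace_mult_cnj_trace[OF \<rho> \<sigma>])
qed

text \<open>Averages are now scalar matrices, and the average of the matrix unit at \<open>(i, j)\<close> has trace \<open>|G|\<close>
  if \<open>i = j\<close> and \<open>0\<close> otherwise, which determines the scalar.\<close>

lemma trace_orthogonality_same:
  assumes irr: "irreducible_rep G n \<rho>"
  shows "(\<Sum>g\<in>carrier G. mat_trace (\<rho> g) * cnj (mat_trace (\<rho> g))) = of_nat (card (carrier G))"
proof -
  have \<rho>: "unitary_rep G n \<rho>" and n: "n > 0" using irr by (auto simp: irreducible_rep_def)
  note \<rho>c = unitary_rep_carrier[OF \<rho>]
  have avg: "rep_average G n n \<rho> \<rho> (matrix_unit n n i j) $$ (i, j) =
      (if j = i then of_nat (card (carrier G)) / of_nat n else 0)" if ij: "i < n" "j < n" for i j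
  proof -
    let ?E = "matrix_unit n n i j" and ?A = "rep_average G n n \<rho> \<rho> (matrix_unit n n i j)"
    have tc: "\<rho> g * ?E * mat_adjoint (\<rho> g) \<in> carrier_mat n n" if "g \<in> carrier G" for g
      using \<rho>c[OF that] by (meson mult_carrier_mat mat_adjoint_carrier matrix_unit_carrier)
    obtain c where c: "?A = c \<cdot>\<^sub>m 1\<^sub>m n"
      using irreducible_rep_commutant[OF irr, of ?A]
        rep_average_intertwines[OF \<rho> \<rho> matrix_unit_carrier]
      by (auto simp: rep_average_def)
    have "mat_trace (\<rho> g * ?E * mat_adjoint (\<rho> g)) = (if i = j then 1 else 0)" if g: "g \<in> carrier G" for g
    proof -
      have "mat_trace (\<rho> g * ?E * mat_adjoint (\<rho> g)) = mat_trace (mat_adjoint (\<rho> g) * (\<rho> g * ?E))"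
        using \<rho>c[OF g] by (intro mat_trace_mult_comm[where m=n and n=n]) auto
      also have "mat_adjoint (\<rho> g) * (\<rho> g * ?E) = mat_adjoint (\<rho> g) * \<rho> g * ?E"
        using \<rho>c[OF g] by (intro assoc_mult_mat[symmetric, where ?n\<^sub>1=n and ?n\<^sub>2=n and ?n\<^sub>3=n and ?n\<^sub>4=n]) auto
      also have "\<dots> = ?E"
        by (simp add: unitary_rep_unitary(2)[OF \<rho> g] left_mult_one_mat[OF matrix_unit_carrier])
      also have "mat_trace ?E = (\<Sum>k<n. if k = i then (if i = j then 1 else 0) else 0)"
        unfolding mat_trace_def by (intro sum.cong) (auto simp: matrix_unit_def)
      finally show ?thesis using ij by simp
    qed
    then have "mat_trace ?A = (\<Sum>g\<in>carrier G. if i = j then 1 else 0)"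
      unfolding rep_average_def using tc by (subst mat_trace_mat_sum) auto
    then have "c * of_nat n = (if i = j then of_nat (card (carrier G)) else 0)"
      by (auto simp: c mat_trace_smult_one)
    then have "c = (if i = j then of_nat (card (carrier G)) / of_nat n else 0)"
      using n by (auto simp: field_simps split: if_splits)
    then show ?thesis using ij by (simp add: c)
  qed
  have "(\<Sum>g\<in>carrier G. mat_trace (\<rho> g) * cnj (mat_trace (\<rho> g))) =
      (\<Sum>i<n. \<Sum>j<n. if j = i then of_nat (card (carrier G)) / of_nat n else 0)"
    unfolding sum_trace_mult_cnj_trace[OF \<rho> \<rho>] by (intro sum.cong refl avg) auto
  also have "\<dots> = of_nat (card (carrier G))" using n by simp
  finally show ?thesis .
qed

end

section \<open>Completeness of the irreducible characters\<close>

text \<open>The image of \<open>f\<close>, as an element of the group algebra, under the representation.\<close>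

definition rep_transform ::
    "('a, 'b) monoid_scheme \<Rightarrow> nat \<Rightarrow> ('a \<Rightarrow> complex) \<Rightarrow> ('a \<Rightarrow> complex mat) \<Rightarrow> complex mat" where
  "rep_transform G n f \<rho> = mat_sum n n (carrier G) (\<lambda>g. f g \<cdot>\<^sub>m \<rho> g)"

context finite_group
begin

lemma unitary_rep_of_hom_adjoint:
  assumes c: "\<And>g. g \<in> carrier G \<Longrightarrow> \<sigma> g \<in> carrier_mat d d"
    and ext: "\<sigma> \<in> extensional (carrier G)"
    and mult: "\<And>g h. g \<in> carrier G \<Longrightarrow> h \<in> carrier G \<Longrightarrow> \<sigma> (g \<otimes> h) = \<sigma> g * \<sigma> h"
    and one: "\<sigma> \<one> = 1\<^sub>m d"
    and adj: "\<And>g. g \<in> carrier G \<Longrightarrow> \<sigma> (inv g) = mat_adjoint (\<sigma> g)"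
  shows "unitary_rep G d \<sigma>"
proof -
  have "\<sigma> g * mat_adjoint (\<sigma> g) = 1\<^sub>m d \<and> mat_adjoint (\<sigma> g) * \<sigma> g = 1\<^sub>m d" if g: "g \<in> carrier G" for g
    using mult[of g "inv g"] mult[of "inv g" g] adj[OF g] g one by simp
  then show ?thesis using c ext mult by (auto simp: unitary_rep_def hom_def unitary_group_def)
qed

text \<open>The isometry has least positive size among those with invariant range inside \<open>E\<close>: a proper
  non-zero invariant subspace of the representation on its domain would give a smaller one.\<close>

lemma exists_irreducible_subrep:
  assumes \<rho>: "unitary_rep G n \<rho>" and E: "vec_subspace n E"
    and inv: "\<And>g w. g \<in> carrier G \<Longrightarrow> w \<in> E \<Longrightarrow> \<rho> g *\<^sub>v w \<in> E"
    and E0: "E \<noteq> {0\<^sub>v n}"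
  obtains d V \<sigma> where "isometry_mat n d V" "\<And>u. u \<in> carrier_vec d \<Longrightarrow> V *\<^sub>v u \<in> E"
    "irreducible_rep G d \<sigma>" "\<And>g. g \<in> carrier G \<Longrightarrow> \<rho> g * V = V * \<sigma> g"
proof -
  note \<rho>c = unitary_rep_carrier[OF \<rho>]
  define P where "P d \<longleftrightarrow> d > 0 \<and> (\<exists>V. isometry_mat n d V \<and> (\<forall>u\<in>carrier_vec d. V *\<^sub>v u \<in> E) \<and>
    (\<forall>g\<in>carrier G. V * (mat_adjoint V * (\<rho> g * V)) = \<rho> g * V))" for d
  have "\<exists>d. P d"
  proof -
    obtain d V where V: "isometry_mat n d V" and EV: "E = (\<lambda>u. V *\<^sub>v u) ` carrier_vec d"
      using subspace_isometry[OF E] by metis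
    have Vc: "V \<in> carrier_mat n d" using V by (simp add: isometry_mat_def)
    have "d > 0"
    proof (rule ccontr)
      assume "\<not> d > 0"
      then have "E = (\<lambda>u :: complex vec. 0\<^sub>v n) ` carrier_vec d"
        unfolding EV using Vc mult_mat_vec_dim_0[of V n] by (simp cong: image_cong)
      with E0 show False by (metis image_constant_conv zero_carrier_vec empty_iff)
    qed
    moreover have "V * (mat_adjoint V * (\<rho> g * V)) = \<rho> g * V" if g: "g \<in> carrier G" for g
    proof (rule isometry_mult_adjoint_onto[OF V mult_carrier_mat[OF \<rho>c[OF g] Vc]])
      fix v :: "complex vec" assume v: "v \<in> carrier_vec d"
      then have "\<rho> g *\<^sub>v (V *\<^sub>v v) \<in> E" by (intro inv g) (auto simp: EV)
      then show "\<rho> g * V *\<^sub>v v \<in> (\<lambda>u. V *\<^sub>v u) ` carrier_vec d"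
        using assoc_mult_mat_vec[OF \<rho>c[OF g] Vc v] by (simp add: EV)
    qed
    ultimately have "P d" using V EV by (auto simp: P_def)
    then show ?thesis ..
  qed
  define d where "d = (LEAST d. P d)"
  have "P d" unfolding d_def using \<open>\<exists>d. P d\<close> by (rule LeastI_ex)
  have d_le: "d \<le> e" if "P e" for e unfolding d_def using that by (rule Least_le)
  from \<open>P d\<close> obtain V where d: "d > 0" and V: "isometry_mat n d V"
    and VE: "\<And>u. u \<in> carrier_vec d \<Longrightarrow> V *\<^sub>v u \<in> E"
    and Vinv: "\<And>g. g \<in> carrier G \<Longrightarrow> V * (mat_adjoint V * (\<rho> g * V)) = \<rho> g * V"
    by (auto simp: P_def)
  have Vc: "V \<in> carrier_mat n d" and VV: "mat_adjoint V * V = 1\<^sub>m d"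
    using V by (auto simp: isometry_mat_def)
  note Ac = mat_adjoint_carrier[OF Vc]
  define \<sigma> where "\<sigma> = (\<lambda>g\<in>carrier G. mat_adjoint V * (\<rho> g * V))"
  have \<sigma>c: "\<sigma> g \<in> carrier_mat d d" if "g \<in> carrier G" for g
    using mult_carrier_mat[OF Ac mult_carrier_mat[OF \<rho>c[OF that] Vc]] that by (simp add: \<sigma>_def)
  have \<rho>V: "\<rho> g * V = V * \<sigma> g" if "g \<in> carrier G" for g
    using Vinv[OF that] that by (simp add: \<sigma>_def)
  have \<sigma>: "unitary_rep G d \<sigma>"
  proof (rule unitary_rep_of_hom_adjoint)
    show "\<sigma> \<one> = 1\<^sub>m d"
      using Vc VV left_mult_one_mat[OF Vc] by (simp add: \<sigma>_def unitary_rep_one[OF \<rho>])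
    fix g assume g: "g \<in> carrier G"
    show "\<sigma> (inv g) = mat_adjoint (\<sigma> g)"
      using g assoc_mult_mat[OF Ac mat_adjoint_carrier[OF \<rho>c[OF g]] Vc]
      by (simp add: \<sigma>_def unitary_rep_inv[OF \<rho>] mat_adjoint_mult[OF \<rho>c[OF g] Vc]
          mat_adjoint_mult[OF Ac mult_carrier_mat[OF \<rho>c[OF g] Vc]])
    fix h assume h: "h \<in> carrier G"
    have "V * \<sigma> (g \<otimes> h) = \<rho> g * (\<rho> h * V)"
      using g h by (simp add: \<rho>V[symmetric] unitary_rep_mult[OF \<rho>] assoc_mult_mat[OF \<rho>c[OF g] \<rho>c[OF h] Vc])
    also have "\<dots> = \<rho> g * V * \<sigma> h"
      unfolding \<rho>V[OF h] by (rule assoc_mult_mat[symmetric, OF \<rho>c[OF g] Vc \<sigma>c[OF h]])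
    also have "\<dots> = V * (\<sigma> g * \<sigma> h)"
      unfolding \<rho>V[OF g] by (rule assoc_mult_mat[OF Vc \<sigma>c[OF g] \<sigma>c[OF h]])
    finally show "\<sigma> (g \<otimes> h) = \<sigma> g * \<sigma> h"
      using isometry_left_cancel[OF V \<sigma>c mult_carrier_mat[OF \<sigma>c \<sigma>c]] g h by simp
  qed (use \<sigma>c in \<open>auto simp: \<sigma>_def\<close>)
  have "W = {0\<^sub>v d} \<or> W = carrier_vec d"
    if W: "vec_subspace d W" and Winv: "\<forall>g\<in>carrier G. \<forall>w\<in>W. \<sigma> g *\<^sub>v w \<in> W" for W
  proof -
    obtain e U where U: "isometry_mat d e U" and WU: "W = (\<lambda>u. U *\<^sub>v u) ` carrier_vec e"
      using subspace_isometry[OF W] by metis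
    have Uc: "U \<in> carrier_mat d e" and UU: "mat_adjoint U * U = 1\<^sub>m e"
      using U by (auto simp: isometry_mat_def)
    show ?thesis
    proof (cases "e = 0")
      case True
      then have "W = (\<lambda>u :: complex vec. 0\<^sub>v d) ` carrier_vec e"
        unfolding WU using Uc mult_mat_vec_dim_0[of U d] by (simp cong: image_cong)
      then show ?thesis by (metis image_constant_conv zero_carrier_vec empty_iff)
    next
      case False
      have VUv: "V * U *\<^sub>v v = V *\<^sub>v (U *\<^sub>v v)" if "v \<in> carrier_vec e" for v
        by (rule assoc_mult_mat_vec[OF Vc Uc that])
      have "V * U * (mat_adjoint (V * U) * (\<rho> g * (V * U))) = \<rho> g * (V * U)"
        if g: "g \<in> carrier G" for g
      proof (rule isometry_mult_adjoint_onto[OF isometry_mat_mult[OF V U]])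
        show "\<rho> g * (V * U) \<in> carrier_mat n e"
          by (rule mult_carrier_mat[OF \<rho>c[OF g] mult_carrier_mat[OF Vc Uc]])
        fix v :: "complex vec" assume v: "v \<in> carrier_vec e"
        note Uv = mult_mat_vec_carrier[OF Uc v]
        have "\<rho> g * (V * U) *\<^sub>v v = \<rho> g *\<^sub>v (V *\<^sub>v (U *\<^sub>v v))"
          using assoc_mult_mat_vec[OF \<rho>c[OF g] mult_carrier_mat[OF Vc Uc] v] VUv[OF v] by simp
        also have "\<dots> = (V * \<sigma> g) *\<^sub>v (U *\<^sub>v v)"
          using assoc_mult_mat_vec[OF \<rho>c[OF g] Vc Uv] \<rho>V[OF g] by simp
        also have "\<dots> = V *\<^sub>v (\<sigma> g *\<^sub>v (U *\<^sub>v v))"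
          by (rule assoc_mult_mat_vec[OF Vc \<sigma>c[OF g] Uv])
        finally have *: "\<rho> g * (V * U) *\<^sub>v v = V *\<^sub>v (\<sigma> g *\<^sub>v (U *\<^sub>v v))" .
        have "\<sigma> g *\<^sub>v (U *\<^sub>v v) \<in> W" using Winv g v by (auto simp: WU)
        then obtain u where "u \<in> carrier_vec e" "\<sigma> g *\<^sub>v (U *\<^sub>v v) = U *\<^sub>v u" by (auto simp: WU)
        with * VUv show "\<rho> g * (V * U) *\<^sub>v v \<in> (\<lambda>u. V * U *\<^sub>v u) ` carrier_vec e" by auto
      qed
      moreover have "V * U *\<^sub>v u \<in> E" if "u \<in> carrier_vec e" for u
        using VE[OF mult_mat_vec_carrier[OF Uc that]] VUv[OF that] by simp
      ultimately have "P e"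
        using False isometry_mat_mult[OF V U] by (auto simp: P_def)
      \<comment> \<open>By minimality \<open>U\<close> is square, hence unitary, hence onto.\<close>
      with isometry_mat_dim_le[OF U] d_le have "e = d" by fastforce
      with mat_mult_left_right_inverse[of "mat_adjoint U" d U] Uc UU
      have "U * mat_adjoint U = 1\<^sub>m d" by simp
      have "w \<in> W" if w: "w \<in> carrier_vec d" for w
      proof -
        have "w = U *\<^sub>v (mat_adjoint U *\<^sub>v w)"
          using assoc_mult_mat_vec[OF Uc mat_adjoint_carrier[OF Uc] w] w \<open>U * mat_adjoint U = 1\<^sub>m d\<close>
          by simp
        then show ?thesis using mult_mat_vec_carrier[OF mat_adjoint_carrier[OF Uc] w] by (auto simp: WU)
      qed
      then show ?thesis using W by (auto simp: vec_subspace_iff)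
    qed
  qed
  then have "irreducible_rep G d \<sigma>"
    using \<sigma> d by (auto simp: irreducible_rep_def)
  with V VE \<rho>V that show ?thesis by blast
qed

lemma rep_transform_carrier [simp]: "rep_transform G n f \<rho> \<in> carrier_mat n n"
  by (simp add: rep_transform_def)

text \<open>Class functions are the central elements of the group algebra.\<close>

lemma rep_transform_commutes:
  assumes \<rho>: "unitary_rep G n \<rho>" and f: "f \<in> class_functions G"
    and h: "h \<in> carrier G"
  shows "rep_transform G n f \<rho> * \<rho> h = \<rho> h * rep_transform G n f \<rho>"
proof -
  note \<rho>c = unitary_rep_carrier[OF \<rho>]
  have "rep_transform G n f \<rho> * \<rho> h = mat_sum n n (carrier G) (\<lambda>g. f g \<cdot>\<^sub>m \<rho> g * \<rho> h)"
    unfolding rep_transform_def using \<rho>c h by (intro mat_sum_mult) auto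
  also have "\<dots> = mat_sum n n (carrier G) (\<lambda>g. f (h \<otimes> g \<otimes> inv h) \<cdot>\<^sub>m
      \<rho> (h \<otimes> g \<otimes> inv h) * \<rho> h)"
    by (rule mat_sum_reindex[OF bij_betw_conjugation[OF h]])
  also have "\<dots> = mat_sum n n (carrier G) (\<lambda>g. \<rho> h * (f g \<cdot>\<^sub>m \<rho> g))"
  proof (rule mat_sum_cong)
    fix g assume g: "g \<in> carrier G"
    let ?k = "h \<otimes> g \<otimes> inv h"
    have k: "?k \<in> carrier G" and kh: "?k \<otimes> h = h \<otimes> g" using g h by (simp_all add: m_assoc)
    have "f ?k \<cdot>\<^sub>m \<rho> ?k * \<rho> h = f g \<cdot>\<^sub>m (\<rho> ?k * \<rho> h)"
      using f g h mult_smult_assoc_mat[OF \<rho>c[OF k] \<rho>c[OF h]] by (simp add: class_functions_def)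
    also have "\<rho> ?k * \<rho> h = \<rho> h * \<rho> g"
      using unitary_rep_mult[OF \<rho> k h] unitary_rep_mult[OF \<rho> h g] kh by simp
    also have "f g \<cdot>\<^sub>m (\<rho> h * \<rho> g) = \<rho> h * (f g \<cdot>\<^sub>m \<rho> g)"
      by (rule mult_smult_distrib[symmetric, OF \<rho>c[OF h] \<rho>c[OF g]])
    finally show "f ?k \<cdot>\<^sub>m \<rho> ?k * \<rho> h = \<rho> h * (f g \<cdot>\<^sub>m \<rho> g)" .
  qed
  also have "\<dots> = \<rho> h * rep_transform G n f \<rho>"
    unfolding rep_transform_def using \<rho>c h by (intro mult_mat_sum[symmetric]) auto
  finally show ?thesis .
qed

lemma rep_transform_intertwiner:
  assumes \<rho>: "unitary_rep G n \<rho>" and \<sigma>: "unitary_rep G d \<sigma>"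
    and V: "V \<in> carrier_mat n d" and int: "\<And>g. g \<in> carrier G \<Longrightarrow> \<rho> g * V = V * \<sigma> g"
  shows "rep_transform G n f \<rho> * V = V * rep_transform G d f \<sigma>"
proof -
  note \<rho>c = unitary_rep_carrier[OF \<rho>] and \<sigma>c = unitary_rep_carrier[OF \<sigma>]
  have "rep_transform G n f \<rho> * V = mat_sum n d (carrier G) (\<lambda>g. f g \<cdot>\<^sub>m \<rho> g * V)"
    unfolding rep_transform_def using \<rho>c V by (intro mat_sum_mult) auto
  also have "\<dots> = mat_sum n d (carrier G) (\<lambda>g. V * (f g \<cdot>\<^sub>m \<sigma> g))"
    using int by (intro mat_sum_cong) (simp add: mult_smult_assoc_mat[OF \<rho>c V] mult_smult_distrib[OF V \<sigma>c])
  also have "\<dots> = V * rep_transform G d f \<sigma>"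
    unfolding rep_transform_def using \<sigma>c V by (intro mult_mat_sum[symmetric]) auto
  finally show ?thesis .
qed

text \<open>By Schur's lemma the transform is scalar, and its trace is the sum in the hypothesis.\<close>

lemma irreducible_rep_transform_zero:
  assumes irr: "irreducible_rep G n \<rho>" and f: "f \<in> class_functions G"
    and orth: "(\<Sum>g\<in>carrier G. f g * mat_trace (\<rho> g)) = 0"
  shows "rep_transform G n f \<rho> = 0\<^sub>m n n"
proof -
  have \<rho>: "unitary_rep G n \<rho>" and n: "n > 0" using irr by (auto simp: irreducible_rep_def)
  note \<rho>c = unitary_rep_carrier[OF \<rho>]
  obtain c where c: "rep_transform G n f \<rho> = c \<cdot>\<^sub>m 1\<^sub>m n"
    using irreducible_rep_commutant[OF irr rep_transform_carrier] rep_transform_commutes[OF \<rho> f]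
    by blast
  have "mat_trace (rep_transform G n f \<rho>) = 0"
    unfolding rep_transform_def using \<rho>c orth by (simp add: mat_trace_mat_sum mat_trace_smult[OF \<rho>c])
  with n have "c = 0" by (simp add: c mat_trace_smult_one)
  then show ?thesis unfolding c by (intro eq_matI) auto
qed

text \<open>The regular representation: the column of the transform that belongs to the identity lists the
  values of \<open>f\<close>.\<close>

lemma exists_faithful_rep_transform:
  obtains N \<rho> where "unitary_rep G N \<rho>"
    "\<And>f x. rep_transform G N f \<rho> = 0\<^sub>m N N \<Longrightarrow> x \<in> carrier G \<Longrightarrow> f x = 0"
proof -
  define N where "N = card (carrier G)"
  obtain e where e: "bij_betw e {..<N} (carrier G)"
    unfolding N_def using ex_bij_betw_nat_finite[OF fin] by (auto simp: atLeast0LessThan)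
  have ec: "e i \<in> carrier G" if "i < N" for i using e that by (auto simp: bij_betw_def)
  have e_inj: "e i = e j \<longleftrightarrow> i = j" if "i < N" "j < N" for i j
    using e that by (auto simp: bij_betw_def inj_on_def)
  have e_ex: "\<exists>i<N. e i = x" if "x \<in> carrier G" for x
    using e that by (auto simp: bij_betw_def image_iff) (metis imageE lessThan_iff)
  define \<rho> where "\<rho> = (\<lambda>g\<in>carrier G. mat N N (\<lambda>(i, j). if e i = g \<otimes> e j then 1 else (0::complex)))"
  have ix: "\<rho> g $$ (i, j) = (if e i = g \<otimes> e j then 1 else 0)"
    if "g \<in> carrier G" "i < N" "j < N" for g i j
    using that by (simp add: \<rho>_def)
  have "unitary_rep G N \<rho>"
  proof (rule unitary_rep_of_hom_adjoint)
    show c: "\<rho> g \<in> carrier_mat N N" if "g \<in> carrier G" for g using that by (simp add: \<rho>_def)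
    show "\<rho> \<one> = 1\<^sub>m N"
      by (intro eq_matI) (use c[of "\<one>"] in \<open>auto simp: ix ec e_inj\<close>)
    fix g assume g: "g \<in> carrier G"
    have "e i = inv g \<otimes> e j \<longleftrightarrow> e j = g \<otimes> e i" if "i < N" "j < N" for i j
      using ec[OF that(1)] ec[OF that(2)] g by (metis inv_solve_left inv_closed)
    then show "\<rho> (inv g) = mat_adjoint (\<rho> g)"
      by (intro eq_matI) (use g c[OF g] c[of "inv g"] in \<open>auto simp: ix\<close>)
    fix h assume h: "h \<in> carrier G"
    show "\<rho> (g \<otimes> h) = \<rho> g * \<rho> h"
    proof (rule eq_matI)
      fix i j assume "i < dim_row (\<rho> g * \<rho> h)" "j < dim_col (\<rho> g * \<rho> h)"
      then have ij: "i < N" "j < N" using c[OF g] c[OF h] by auto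
      obtain k where k: "k < N" "e k = h \<otimes> e j" using e_ex[of "h \<otimes> e j"] h ec ij by auto
      have "(\<rho> g * \<rho> h) $$ (i, j) = (\<Sum>l<N. \<rho> g $$ (i, l) * \<rho> h $$ (l, j))"
        using c[OF g] c[OF h] ij by (simp add: scalar_prod_def atLeast0LessThan)
      also have "\<dots> = (\<Sum>l<N. if l = k then \<rho> g $$ (i, k) else 0)"
        using h ij k e_inj by (intro sum.cong) (auto simp: ix, metis)
      also have "\<dots> = \<rho> g $$ (i, k)" using k by simp
      also have "\<dots> = \<rho> (g \<otimes> h) $$ (i, j)"
        using g h ij k ec by (simp add: ix m_assoc)
      finally show "\<rho> (g \<otimes> h) $$ (i, j) = (\<rho> g * \<rho> h) $$ (i, j)" ..
    qed (use c[OF g] c[OF h] c[of "g \<otimes> h"] g h in auto)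
  qed (auto simp: \<rho>_def)
  moreover have "f x = 0" if z: "rep_transform G N f \<rho> = 0\<^sub>m N N" and x: "x \<in> carrier G" for f x
  proof -
    obtain i where i: "i < N" "e i = x" using e_ex[OF x] by auto
    obtain j where j: "j < N" "e j = \<one>" using e_ex[OF one_closed] by auto
    have "rep_transform G N f \<rho> $$ (i, j) = (\<Sum>g\<in>carrier G. (f g \<cdot>\<^sub>m \<rho> g) $$ (i, j))"
      using i j by (simp add: rep_transform_def)
    also have "\<dots> = (\<Sum>g\<in>carrier G. if g = x then f x else 0)"
    proof (rule sum.cong)
      fix g assume "g \<in> carrier G"
      then show "(f g \<cdot>\<^sub>m \<rho> g) $$ (i, j) = (if g = x then f x else 0)"
        using i j by (auto simp: \<rho>_def)
    qed simp
    also have "\<dots> = f x" using x fin by simp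
    finally show ?thesis using z i j by simp
  qed
  ultimately show ?thesis using that by blast
qed

text \<open>If \<open>f\<close> is not zero, its transform \<open>T\<close> on the regular representation is not zero either. The range
  of \<open>T\<^sup>*\<close> is invariant, as \<open>f\<close> is central, and contains an irreducible subrepresentation; \<open>T\<close>
  vanishes there, because it does so on all irreducible representations. But the kernel of \<open>T\<close> is
  orthogonal to the range of \<open>T\<^sup>*\<close>.\<close>

lemma class_function_eq_0:
  assumes f: "f \<in> class_functions G"
    and orth: "\<And>n \<sigma>. irreducible_rep G n \<sigma> \<Longrightarrow> (\<Sum>g\<in>carrier G. f g * mat_trace (\<sigma> g)) = 0"
    and x: "x \<in> carrier G"
  shows "f x = 0"
proof -
  obtain N \<rho> where \<rho>: "unitary_rep G N \<rho>"
    and faithful: "\<And>f x. rep_transform G N f \<rho> = 0\<^sub>m N N \<Longrightarrow> x \<in> carrier G \<Longrightarrow> f x = 0"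
    using exists_faithful_rep_transform by metis
  note \<rho>c = unitary_rep_carrier[OF \<rho>]
  define T where "T = rep_transform G N f \<rho>"
  have T: "T \<in> carrier_mat N N" by (simp add: T_def)
  note S = mat_adjoint_carrier[OF T]
  have comm: "\<rho> g * mat_adjoint T = mat_adjoint T * \<rho> g" if g: "g \<in> carrier G" for g
    using adjoint_intertwiner[OF \<rho> \<rho> T _ g] rep_transform_commutes[OF \<rho> f] by (simp add: T_def)
  define E where "E = (\<lambda>u. mat_adjoint T *\<^sub>v u) ` carrier_vec N"
  have "E = {0\<^sub>v N}"
  proof (rule ccontr)
    assume E0: "E \<noteq> {0\<^sub>v N}"
    have "vec_subspace N E"
      unfolding vec_subspace_iff
    proof (intro conjI ballI allI)
      show "E \<subseteq> carrier_vec N" using mult_mat_vec_carrier[OF S] by (auto simp: E_def)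
      have "mat_adjoint T *\<^sub>v 0\<^sub>v N = 0\<^sub>v N" using T by (intro eq_vecI) auto
      then show "0\<^sub>v N \<in> E" unfolding E_def by (metis imageI zero_carrier_vec)
      show "v + w \<in> E" if vw: "v \<in> E" "w \<in> E" for v w
      proof -
        obtain a b where "a \<in> carrier_vec N" "b \<in> carrier_vec N" "v = mat_adjoint T *\<^sub>v a" "w = mat_adjoint T *\<^sub>v b"
          using vw by (auto simp: E_def)
        then show ?thesis
          unfolding E_def by (intro image_eqI[of _ _ "a + b"]) (simp_all add: mult_add_distrib_mat_vec[OF S])
      qed
      show "c \<cdot>\<^sub>v v \<in> E" if v: "v \<in> E" for c v
      proof -
        obtain a where "a \<in> carrier_vec N" "v = mat_adjoint T *\<^sub>v a" using v by (auto simp: E_def)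
        then show ?thesis
          unfolding E_def by (intro image_eqI[of _ _ "c \<cdot>\<^sub>v a"]) (simp_all add: mult_mat_vec[OF S])
      qed
    qed
    moreover have "\<rho> g *\<^sub>v w \<in> E" if g: "g \<in> carrier G" and w: "w \<in> E" for g w
    proof -
      obtain a where a: "a \<in> carrier_vec N" "w = mat_adjoint T *\<^sub>v a" using w by (auto simp: E_def)
      have "\<rho> g *\<^sub>v w = mat_adjoint T *\<^sub>v (\<rho> g *\<^sub>v a)"
        using assoc_mult_mat_vec[OF \<rho>c[OF g] S a(1)] assoc_mult_mat_vec[OF S \<rho>c[OF g] a(1)] comm[OF g] a(2)
        by simp
      then show ?thesis using mult_mat_vec_carrier[OF \<rho>c[OF g] a(1)] by (auto simp: E_def)
    qed
    ultimately obtain d V \<sigma> where V: "isometry_mat N d V" and VE: "\<And>u. u \<in> carrier_vec d \<Longrightarrow> V *\<^sub>v u \<in> E"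
      and \<sigma>: "irreducible_rep G d \<sigma>" and int: "\<And>g. g \<in> carrier G \<Longrightarrow> \<rho> g * V = V * \<sigma> g"
      using exists_irreducible_subrep[OF \<rho> _ _ E0] by metis
    have \<sigma>': "unitary_rep G d \<sigma>" and d: "d > 0" using \<sigma> by (auto simp: irreducible_rep_def)
    have Vc: "V \<in> carrier_mat N d" and VV: "mat_adjoint V * V = 1\<^sub>m d"
      using V by (auto simp: isometry_mat_def)
    have TV: "T * V = 0\<^sub>m N d"
      using rep_transform_intertwiner[OF \<rho> \<sigma>' Vc int, of f]
        irreducible_rep_transform_zero[OF \<sigma> f orth[OF \<sigma>]] Vc by (simp add: T_def)
    \<comment> \<open>The first column of \<open>V\<close> is a unit vector in the range of \<open>T\<^sup>*\<close> and in the kernel of \<open>T\<close>.\<close>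
    obtain u where u: "u \<in> carrier_vec N" "V *\<^sub>v unit_vec d 0 = mat_adjoint T *\<^sub>v u"
      using VE[of "unit_vec d 0"] by (auto simp: E_def)
    have Vu: "V $$ (i, 0) = (\<Sum>j<N. cnj (T $$ (j, i)) * u $ j)" if i: "i < N" for i
    proof -
      have "V $$ (i, 0) = (V *\<^sub>v unit_vec d 0) $ i"
        using Vc i d by (simp add: scalar_prod_right_unit)
      also have "\<dots> = (\<Sum>j<N. cnj (T $$ (j, i)) * u $ j)"
        unfolding u(2) using T u(1) i by (simp add: scalar_prod_def atLeast0LessThan)
      finally show ?thesis .
    qed
    have TV0: "(\<Sum>i<N. T $$ (j, i) * V $$ (i, 0)) = 0" if j: "j < N" for j
    proof -
      have "(T * V) $$ (j, 0) = (\<Sum>i<N. T $$ (j, i) * V $$ (i, 0))"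
        using T Vc j d by (simp add: scalar_prod_def atLeast0LessThan)
      then show ?thesis using TV j d by simp
    qed
    have "1 = (mat_adjoint V * V) $$ (0, 0)" using d VV by simp
    also have "\<dots> = (\<Sum>i<N. cnj (V $$ (i, 0)) * V $$ (i, 0))"
      using Vc d by (simp add: scalar_prod_def atLeast0LessThan)
    also have "\<dots> = (\<Sum>i<N. \<Sum>j<N. T $$ (j, i) * cnj (u $ j) * V $$ (i, 0))"
      by (intro sum.cong refl) (simp add: Vu sum_distrib_right)
    also have "\<dots> = (\<Sum>j<N. \<Sum>i<N. T $$ (j, i) * cnj (u $ j) * V $$ (i, 0))"
      by (rule sum.swap)
    also have "\<dots> = (\<Sum>j<N. cnj (u $ j) * (\<Sum>i<N. T $$ (j, i) * V $$ (i, 0)))"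
      by (simp add: sum_distrib_left mult_ac)
    also have "\<dots> = 0" by (simp add: TV0)
    finally show False by simp
  qed
  then have "mat_adjoint T *\<^sub>v v = 0\<^sub>m N N *\<^sub>v v" if "v \<in> carrier_vec N" for v
  proof -
    have "mat_adjoint T *\<^sub>v v \<in> E" using that by (simp add: E_def)
    then show ?thesis using \<open>E = {0\<^sub>v N}\<close> that by (auto intro!: eq_vecI)
  qed
  then have "mat_adjoint T = 0\<^sub>m N N" by (intro eq_mat_vecI[OF S]) auto
  then have "mat_adjoint (mat_adjoint T) = 0\<^sub>m N N" by (simp only:) (auto intro!: eq_matI)
  then show ?thesis using faithful x by (simp add: T_def)
qed

end

section \<open>The dual and its characters\<close>

text \<open>The diagonal of the algebra is \<open>\<Sum>C. 1\<^sub>C \<otimes> 1\<^sub>C\<close>, with no conjugate in the second factor, whereas the inner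
  product of characters has one; passing to the conjugate representation reconciles the two.\<close>

definition conj_rep :: "('a, 'b) monoid_scheme \<Rightarrow> ('a \<Rightarrow> complex mat) \<Rightarrow> 'a \<Rightarrow> complex mat" where
  "conj_rep G \<rho> = (\<lambda>g\<in>carrier G. map_mat cnj (\<rho> g))"

definition char_coeff ::
    "('a, 'b) monoid_scheme \<Rightarrow> ('a \<Rightarrow> complex) \<Rightarrow> ('a \<Rightarrow> complex mat) set \<Rightarrow> complex" where
  "char_coeff G f \<pi> = (\<Sum>x\<in>carrier G. f x * cnj (char_of \<pi> x)) / of_nat (card (carrier G))"

context finite_group
begin

lemma mat_trace_conj_rep:
  assumes "g \<in> carrier G" "\<rho> g \<in> carrier_mat n n"
  shows "mat_trace (conj_rep G \<rho> g) = cnj (mat_trace (\<rho> g))"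
  using assms by (simp add: conj_rep_def mat_trace_def)

lemma irreducible_conj_rep:
  assumes irr: "irreducible_rep G n \<rho>"
  shows "irreducible_rep G n (conj_rep G \<rho>)"
proof -
  have \<rho>: "unitary_rep G n \<rho>" and n: "n > 0" using irr by (auto simp: irreducible_rep_def)
  note \<rho>c = unitary_rep_carrier[OF \<rho>]
  have "unitary_rep G n (conj_rep G \<rho>)"
  proof (rule unitary_rep_of_hom_adjoint)
    show "conj_rep G \<rho> \<one> = 1\<^sub>m n"
      by (intro eq_matI) (auto simp: conj_rep_def unitary_rep_one[OF \<rho>])
    fix g assume g: "g \<in> carrier G"
    show "conj_rep G \<rho> g \<in> carrier_mat n n" using g \<rho>c[OF g] by (simp add: conj_rep_def)
    show "conj_rep G \<rho> (inv g) = mat_adjoint (conj_rep G \<rho> g)"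
      using g \<rho>c[OF g] by (intro eq_matI) (auto simp: conj_rep_def unitary_rep_inv[OF \<rho> g])
    fix h assume h: "h \<in> carrier G"
    show "conj_rep G \<rho> (g \<otimes> h) = conj_rep G \<rho> g * conj_rep G \<rho> h"
      using g h by (simp add: conj_rep_def unitary_rep_mult[OF \<rho>] map_cnj_mult_mat[OF \<rho>c \<rho>c])
  qed (auto simp: conj_rep_def)
  moreover have "W = {0\<^sub>v n} \<or> W = carrier_vec n"
    if W: "vec_subspace n W" and inv: "\<forall>g\<in>carrier G. \<forall>w\<in>W. conj_rep G \<rho> g *\<^sub>v w \<in> W" for W
  proof -
    have Wc: "W \<subseteq> carrier_vec n" and W0: "0\<^sub>v n \<in> W"
      and Wadd: "\<And>v w. v \<in> W \<Longrightarrow> w \<in> W \<Longrightarrow> v + w \<in> W"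
      and Wsm: "\<And>c v. v \<in> W \<Longrightarrow> c \<cdot>\<^sub>v v \<in> W"
      using W by (auto simp: vec_subspace_iff)
    have "vec_subspace n (conjugate ` W)"
      unfolding vec_subspace_iff
    proof (intro conjI ballI allI)
      show "conjugate ` W \<subseteq> carrier_vec n" using Wc by auto
      show "0\<^sub>v n \<in> conjugate ` W" using W0 by (metis conjugate_zero_vec image_eqI)
      show "v + w \<in> conjugate ` W" if vw: "v \<in> conjugate ` W" "w \<in> conjugate ` W" for v w
      proof -
        obtain a b where ab: "a \<in> W" "b \<in> W" "v = conjugate a" "w = conjugate b" using vw by auto
        then have "v + w = conjugate (a + b)"
          using Wc by (auto intro!: conjugate_add_vec[symmetric, where n=n])
        then show ?thesis using Wadd[OF ab(1,2)] by blast
      qed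
      show "c \<cdot>\<^sub>v v \<in> conjugate ` W" if v: "v \<in> conjugate ` W" for c v
      proof -
        obtain a where a: "a \<in> W" "v = conjugate a" using v by auto
        then have "c \<cdot>\<^sub>v v = conjugate (cnj c \<cdot>\<^sub>v a)" by (simp add: conjugate_smult_vec)
        then show ?thesis using Wsm[OF a(1)] by blast
      qed
    qed
    moreover have "\<rho> g *\<^sub>v w \<in> conjugate ` W" if g: "g \<in> carrier G" and w: "w \<in> conjugate ` W" for g w
    proof -
      obtain a where a: "a \<in> W" "w = conjugate a" using w by auto
      then have "\<rho> g *\<^sub>v w = conjugate (conj_rep G \<rho> g *\<^sub>v a)"
        using conjugate_map_cnj_mult_vec[OF \<rho>c[OF g]] Wc g by (auto simp: conj_rep_def)
      then show ?thesis using inv g a by blast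
    qed
    ultimately have "conjugate ` W = {0\<^sub>v n} \<or> conjugate ` W = carrier_vec n"
      using irr by (auto simp: irreducible_rep_def)
    moreover have "W = conjugate ` conjugate ` W" by (simp add: image_image)
    moreover have "conjugate ` carrier_vec n = (carrier_vec n :: complex vec set)"
    proof -
      have "v \<in> conjugate ` carrier_vec n" if "v \<in> carrier_vec n" for v :: "complex vec"
        using that by (intro image_eqI[of _ _ "conjugate v"]) auto
      then show ?thesis by auto
    qed
    ultimately show ?thesis by (metis conjugate_zero_vec image_empty image_insert)
  qed
  ultimately show ?thesis using n by (auto simp: irreducible_rep_def)
qed

lemma irreducible_rep_degree_unique:
  assumes "irreducible_rep G n \<rho>"
  shows "dim_row (\<rho> \<one>) = n"
proof -
  have "unitary_rep G n \<rho>" using assms by (simp add: irreducible_rep_def)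
  from unitary_rep_one[OF this] show ?thesis by simp
qed

lemma rep_equiv_trace:
  assumes eq: "(\<rho>, \<sigma>) \<in> rep_equiv G" and g: "g \<in> carrier G"
  shows "mat_trace (\<sigma> g) = mat_trace (\<rho> g)"
proof -
  obtain n U where u: "unitary_rep G n \<rho>" "unitary_rep G n \<sigma>"
    and U: "U \<in> carrier (unitary_group n)" and int: "\<And>g. g \<in> carrier G \<Longrightarrow> U * \<rho> g = \<sigma> g * U"
    using eq by (auto simp: rep_equiv_def)
  have Uc: "U \<in> carrier_mat n n" and UU: "U * mat_adjoint U = 1\<^sub>m n" "mat_adjoint U * U = 1\<^sub>m n"
    using U by (auto simp: unitary_group_def)
  note \<rho>c = unitary_rep_carrier[OF u(1) g] and \<sigma>c = unitary_rep_carrier[OF u(2) g]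
    and Sc = mat_adjoint_carrier[OF Uc]
  have "U * \<rho> g * mat_adjoint U = \<sigma> g * (U * mat_adjoint U)"
    unfolding int[OF g] by (rule assoc_mult_mat[OF \<sigma>c Uc Sc])
  also have "\<dots> = \<sigma> g"
    unfolding UU(1) by (rule right_mult_one_mat[OF \<sigma>c])
  finally have eq: "U * \<rho> g * mat_adjoint U = \<sigma> g" .
  have "mat_trace (\<sigma> g) = mat_trace (U * \<rho> g * mat_adjoint U)" unfolding eq ..
  also have "\<dots> = mat_trace (mat_adjoint U * (U * \<rho> g))"
    by (rule mat_trace_mult_comm[OF mult_carrier_mat[OF Uc \<rho>c] Sc])
  also have "mat_adjoint U * (U * \<rho> g) = mat_adjoint U * U * \<rho> g"
    by (rule assoc_mult_mat[symmetric, OF Sc Uc \<rho>c])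
  also have "\<dots> = \<rho> g"
    unfolding UU(2) by (rule left_mult_one_mat[OF \<rho>c])
  finally show ?thesis .
qed

text \<open>Irreducible representations with equal characters cannot be inequivalent, since their characters
  would have to be orthogonal. That equivalence is an equivalence relation is then immediate.\<close>

lemma rep_equiv_iff_trace:
  "(\<rho>, \<sigma>) \<in> rep_equiv G \<longleftrightarrow>
    \<rho> \<in> irreps G \<and> \<sigma> \<in> irreps G \<and> (\<forall>g\<in>carrier G. mat_trace (\<rho> g) = mat_trace (\<sigma> g))"
proof
  assume eq: "(\<rho>, \<sigma>) \<in> rep_equiv G"
  then have "\<rho> \<in> irreps G" "\<sigma> \<in> irreps G" by (simp_all add: rep_equiv_def)
  with rep_equiv_trace[OF eq] show "\<rho> \<in> irreps G \<and> \<sigma> \<in> irreps G \<and>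
    (\<forall>g\<in>carrier G. mat_trace (\<rho> g) = mat_trace (\<sigma> g))" by metis
next
  assume eq: "\<rho> \<in> irreps G \<and> \<sigma> \<in> irreps G \<and> (\<forall>g\<in>carrier G. mat_trace (\<rho> g) = mat_trace (\<sigma> g))"
  then obtain n m where irr: "irreducible_rep G n \<rho>" "irreducible_rep G m \<sigma>"
    by (auto simp: irreps_def)
  have "(\<Sum>g\<in>carrier G. mat_trace (\<sigma> g) * cnj (mat_trace (\<rho> g))) = of_nat (card (carrier G))"
    using trace_orthogonality_same[OF irr(1)] eq by simp
  moreover have "card (carrier G) \<noteq> 0" using fin one_closed by (auto simp: card_eq_0_iff)
  ultimately show "(\<rho>, \<sigma>) \<in> rep_equiv G"
    using trace_orthogonality_inequivalent[OF irr] by fastforce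
qed

lemma equiv_rep_equiv: "equiv (irreps G) (rep_equiv G)"
proof (rule equivI)
  show "rep_equiv G \<subseteq> irreps G \<times> irreps G" by (auto simp: rep_equiv_def)
  show "refl_on (irreps G) (rep_equiv G)" by (simp add: refl_on_def rep_equiv_iff_trace)
  show "sym (rep_equiv G)" by (simp add: sym_def rep_equiv_iff_trace)
  show "trans (rep_equiv G)" by (simp add: trans_def rep_equiv_iff_trace)
qed

lemma dual_class_of:
  assumes irr: "irreducible_rep G n \<rho>"
  shows "rep_equiv G `` {\<rho>} \<in> dual G" "degree_of G (rep_equiv G `` {\<rho>}) = n"
    "\<And>g. g \<in> carrier G \<Longrightarrow> char_of (rep_equiv G `` {\<rho>}) g = mat_trace (\<rho> g)"
proof -
  have \<rho>: "\<rho> \<in> irreps G" unfolding irreps_def mem_Collect_eq by (rule exI) (rule irr)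
  have mem: "\<rho> \<in> rep_equiv G `` {\<rho>}" by (rule equiv_class_self[OF equiv_rep_equiv \<rho>])
  show "rep_equiv G `` {\<rho>} \<in> dual G" unfolding dual_def by (rule quotientI[OF \<rho>])
  have const: "dim_row (\<sigma> \<one>) = dim_row (\<rho> \<one>)" if "\<sigma> \<in> rep_equiv G `` {\<rho>}" for \<sigma>
  proof -
    have "(\<rho>, \<sigma>) \<in> rep_equiv G" using that by simp
    then obtain m where "unitary_rep G m \<rho>" "unitary_rep G m \<sigma>" by (auto simp: rep_equiv_def)
    then show ?thesis by (simp add: unitary_rep_one)
  qed
  show "degree_of G (rep_equiv G `` {\<rho>}) = n"
  proof -
    have "the_elem ((\<lambda>\<rho>. dim_row (\<rho> \<one>)) ` (rep_equiv G `` {\<rho>})) = dim_row (\<rho> \<one>)"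
      by (rule the_elem_image_constant[where f = "\<lambda>\<rho>. dim_row (\<rho> \<one>)", OF mem]) (rule const)
    then show ?thesis
      unfolding degree_of_def irreducible_rep_degree_unique[OF irr] .
  qed
  fix g assume g: "g \<in> carrier G"
  show "char_of (rep_equiv G `` {\<rho>}) g = mat_trace (\<rho> g)"
    unfolding char_of_def
  proof (rule the_elem_image_constant[where f = "\<lambda>\<rho>. mat_trace (\<rho> g)", OF mem])
    fix \<sigma> assume "\<sigma> \<in> rep_equiv G `` {\<rho>}"
    then have "(\<rho>, \<sigma>) \<in> rep_equiv G" by simp
    then show "mat_trace (\<sigma> g) = mat_trace (\<rho> g)" by (rule rep_equiv_trace[OF _ g])
  qed
qed

lemma dual_obtain_rep:
  assumes \<pi>: "\<pi> \<in> dual G"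
  obtains \<rho> where "irreducible_rep G (degree_of G \<pi>) \<rho>" "\<pi> = rep_equiv G `` {\<rho>}"
    "\<And>g. g \<in> carrier G \<Longrightarrow> char_of \<pi> g = mat_trace (\<rho> g)"
proof -
  obtain \<rho> where \<rho>: "\<rho> \<in> irreps G" "\<pi> = rep_equiv G `` {\<rho>}"
    using \<pi> unfolding dual_def by (rule quotientE)
  from \<rho>(1) have "\<exists>n. irreducible_rep G n \<rho>" unfolding irreps_def mem_Collect_eq .
  then obtain n where n: "irreducible_rep G n \<rho>" ..
  show ?thesis
  proof (rule that[of \<rho>])
    show "irreducible_rep G (degree_of G \<pi>) \<rho>"
      unfolding \<rho>(2) dual_class_of(2)[OF n] by (rule n)
    fix g assume "g \<in> carrier G"
    then show "char_of \<pi> g = mat_trace (\<rho> g)"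
      unfolding \<rho>(2) by (rule dual_class_of(3)[OF n])
  qed (rule \<rho>(2))
qed

lemma degree_pos: "\<pi> \<in> dual G \<Longrightarrow> degree_of G \<pi> > 0"
  by (erule dual_obtain_rep) (simp add: irreducible_rep_def)

lemma char_of_one: "\<pi> \<in> dual G \<Longrightarrow> char_of \<pi> \<one> = of_nat (degree_of G \<pi>)"
  by (erule dual_obtain_rep) (simp add: irreducible_rep_def unitary_rep_trace_one)

lemma char_of_conj:
  assumes "\<pi> \<in> dual G" "g \<in> carrier G" "x \<in> carrier G"
  shows "char_of \<pi> (g \<otimes> x \<otimes> inv g) = char_of \<pi> x"
proof -
  obtain \<rho> where irr: "irreducible_rep G (degree_of G \<pi>) \<rho>"
    and ch: "\<And>g. g \<in> carrier G \<Longrightarrow> char_of \<pi> g = mat_trace (\<rho> g)"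
    using dual_obtain_rep[OF assms(1)] by metis
  have u: "unitary_rep G (degree_of G \<pi>) \<rho>" using irr by (simp add: irreducible_rep_def)
  show ?thesis using unitary_rep_trace_conj[OF u assms(2,3)] assms by (simp add: ch)
qed

lemma char_of_bound:
  "\<pi> \<in> dual G \<Longrightarrow> x \<in> carrier G \<Longrightarrow> cmod (char_of \<pi> x) \<le> degree_of G \<pi>"
  by (erule dual_obtain_rep) (simp add: irreducible_rep_def unitary_rep_trace_bound)

lemma char_of_orthogonality:
  assumes \<pi>: "\<pi> \<in> dual G" and \<pi>': "\<pi>' \<in> dual G"
  shows "(\<Sum>g\<in>carrier G. char_of \<pi> g * cnj (char_of \<pi>' g)) =
    (if \<pi> = \<pi>' then of_nat (card (carrier G)) else 0)"
proof -
  obtain \<sigma> where \<sigma>: "irreducible_rep G (degree_of G \<pi>) \<sigma>" "\<pi> = rep_equiv G `` {\<sigma>}"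
    "\<And>g. g \<in> carrier G \<Longrightarrow> char_of \<pi> g = mat_trace (\<sigma> g)"
    using dual_obtain_rep[OF \<pi>] by metis
  obtain \<rho> where \<rho>: "irreducible_rep G (degree_of G \<pi>') \<rho>" "\<pi>' = rep_equiv G `` {\<rho>}"
    "\<And>g. g \<in> carrier G \<Longrightarrow> char_of \<pi>' g = mat_trace (\<rho> g)"
    using dual_obtain_rep[OF \<pi>'] by metis
  show ?thesis
  proof (cases "\<pi> = \<pi>'")
    case True
    then show ?thesis using trace_orthogonality_same[OF \<sigma>(1)] \<sigma>(3) by simp
  next
    case False
    then have "(\<rho>, \<sigma>) \<notin> rep_equiv G"
      using equiv_class_eq[OF equiv_rep_equiv] \<rho>(2) \<sigma>(2) by metis
    from trace_orthogonality_inequivalent[OF \<rho>(1) \<sigma>(1) this] False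
    show ?thesis using \<rho>(3) \<sigma>(3) by simp
  qed
qed

lemma dual_obtain_conj:
  assumes \<pi>: "\<pi> \<in> dual G"
  obtains \<pi>' where "\<pi>' \<in> dual G" "degree_of G \<pi>' = degree_of G \<pi>"
    "\<And>g. g \<in> carrier G \<Longrightarrow> char_of \<pi>' g = cnj (char_of \<pi> g)"
proof -
  obtain \<rho> where \<rho>: "irreducible_rep G (degree_of G \<pi>) \<rho>" "\<pi> = rep_equiv G `` {\<rho>}"
    "\<And>g. g \<in> carrier G \<Longrightarrow> char_of \<pi> g = mat_trace (\<rho> g)"
    using dual_obtain_rep[OF \<pi>] by metis
  have u: "unitary_rep G (degree_of G \<pi>) \<rho>" using \<rho>(1) by (simp add: irreducible_rep_def)
  note c = dual_class_of[OF irreducible_conj_rep[OF \<rho>(1)]]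
  show ?thesis
  proof (rule that[OF c(1,2)])
    fix g assume g: "g \<in> carrier G"
    show "char_of (rep_equiv G `` {conj_rep G \<rho>}) g = cnj (char_of \<pi> g)"
      unfolding c(3)[OF g] \<rho>(3)[OF g] by (rule mat_trace_conj_rep[of g \<rho>, OF g unitary_rep_carrier[OF u g]])
  qed
qed

text \<open>Bessel's inequality for the function that is \<open>1\<close> at the identity and \<open>0\<close> elsewhere bounds
  the number of elements of the dual by the order of the group.\<close>

lemma finite_dual:
  shows "finite (dual G)"
proof (rule ccontr)
  define N where "N = card (carrier G)"
  have N: "N > 0" using fin by (auto simp: N_def card_gt_0_iff)
  assume "infinite (dual G)"
  then obtain S where S: "finite S" "card S = Suc N" "S \<subseteq> dual G"
    using infinite_arbitrarily_large by blast
  define d where "d \<pi> = complex_of_real (real (degree_of G \<pi>))" for \<pi>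
  define t where "t x = (\<Sum>\<pi>\<in>S. d \<pi> * char_of \<pi> x)" for x
  define D where "D = (\<Sum>\<pi>\<in>S. (real (degree_of G \<pi>))\<^sup>2)"
  \<comment> \<open>With the factor \<open>N\<close> the character coefficients of \<open>\<delta>\<close> are the degrees, so \<open>t\<close> is its projection.\<close>
  define \<delta> where "\<delta> x = (if x = \<one> then of_nat N else (0::complex))" for x
  have dS: "(\<Sum>\<pi>\<in>S. d \<pi> * d \<pi>) = of_real D"
    by (simp add: D_def d_def power2_eq_square)
  have t1: "t \<one> = of_real D"
    unfolding dS[symmetric] t_def using S(3) by (intro sum.cong) (auto simp: d_def char_of_one)
  have tt: "(\<Sum>x\<in>carrier G. t x * cnj (t x)) = of_nat N * of_real D"
  proof -
    have "(\<Sum>x\<in>carrier G. t x * cnj (t x)) =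
        (\<Sum>x\<in>carrier G. \<Sum>\<pi>\<in>S. \<Sum>\<pi>'\<in>S. d \<pi> * d \<pi>' * (char_of \<pi> x * cnj (char_of \<pi>' x)))"
      by (simp add: t_def sum_product d_def mult_ac)
    also have "\<dots> = (\<Sum>\<pi>\<in>S. \<Sum>x\<in>carrier G. \<Sum>\<pi>'\<in>S. d \<pi> * d \<pi>' * (char_of \<pi> x * cnj (char_of \<pi>' x)))"
      by (rule sum.swap)
    also have "\<dots> = (\<Sum>\<pi>\<in>S. \<Sum>\<pi>'\<in>S. \<Sum>x\<in>carrier G. d \<pi> * d \<pi>' * (char_of \<pi> x * cnj (char_of \<pi>' x)))"
      by (intro sum.cong refl sum.swap)
    also have "\<dots> = (\<Sum>\<pi>\<in>S. \<Sum>\<pi>'\<in>S. if \<pi> = \<pi>' then d \<pi> * d \<pi>' * of_nat N else 0)"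
      using S(3) by (intro sum.cong refl)
        (auto simp: N_def char_of_orthogonality subset_iff simp flip: sum_distrib_left)
    also have "\<dots> = (\<Sum>\<pi>\<in>S. d \<pi> * d \<pi> * of_nat N)" using S(1) by simp
    also have "\<dots> = of_nat N * of_real D" by (simp add: mult.commute sum_distrib_left flip: dS)
    finally show ?thesis .
  qed
  have \<delta>sum: "(\<Sum>x\<in>carrier G. \<delta> x * f x) = of_nat N * f \<one>" for f :: "'a \<Rightarrow> complex"
    using fin by (simp add: \<delta>_def if_distrib[of "\<lambda>a. a * _"] cong: if_cong)
  have "(\<Sum>x\<in>carrier G. of_real ((cmod (\<delta> x - t x))\<^sup>2)) =
      (\<Sum>x\<in>carrier G. \<delta> x * cnj (\<delta> x) - \<delta> x * cnj (t x) - cnj (\<delta> x) * t x + t x * cnj (t x))"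
    by (simp only: complex_norm_square) (simp add: algebra_simps)
  also have "\<dots> = (\<Sum>x\<in>carrier G. \<delta> x * \<delta> x) - (\<Sum>x\<in>carrier G. \<delta> x * cnj (t x))
      - (\<Sum>x\<in>carrier G. \<delta> x * t x) + (\<Sum>x\<in>carrier G. t x * cnj (t x))"
  proof -
    have "cnj (\<delta> x) = \<delta> x" for x by (simp add: \<delta>_def)
    then show ?thesis by (simp add: sum.distrib sum_subtractf)
  qed
  also have "\<dots> = of_real (real N * (real N - D))"
    by (simp add: \<delta>sum tt t1 \<delta>_def[of "\<one>"] algebra_simps)
  finally have "complex_of_real (\<Sum>x\<in>carrier G. (cmod (\<delta> x - t x))\<^sup>2) = of_real (real N * (real N - D))"
    by simp
  then have "real N * (real N - D) = (\<Sum>x\<in>carrier G. (cmod (\<delta> x - t x))\<^sup>2)"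
    by (simp only: of_real_eq_iff)
  also have "\<dots> \<ge> 0" by (intro sum_nonneg) auto
  finally have "D \<le> real N" using N by (simp add: zero_le_mult_iff)
  moreover have "(\<Sum>\<pi>\<in>S. 1) \<le> D"
    unfolding D_def
  proof (intro sum_mono)
    fix \<pi> assume "\<pi> \<in> S"
    then have "1 \<le> real (degree_of G \<pi>)" using degree_pos[of \<pi>] S(3) by fastforce
    then show "1 \<le> (real (degree_of G \<pi>))\<^sup>2" by (rule one_le_power)
  qed
  ultimately show False using S(2) by simp
qed

lemma card_carrier_pos: "card (carrier G) > 0"
  using fin by (auto simp: card_gt_0_iff)

lemma char_coeff_combination:
  assumes f: "\<And>x. x \<in> carrier G \<Longrightarrow> f x = (\<Sum>\<pi>\<in>dual G. \<alpha> \<pi> * char_of \<pi> x)" and \<pi>: "\<pi> \<in> dual G"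
  shows "char_coeff G f \<pi> = \<alpha> \<pi>"
proof -
  have "(\<Sum>x\<in>carrier G. f x * cnj (char_of \<pi> x)) =
      (\<Sum>x\<in>carrier G. \<Sum>\<pi>'\<in>dual G. \<alpha> \<pi>' * (char_of \<pi>' x * cnj (char_of \<pi> x)))"
    by (simp add: f sum_distrib_right mult.assoc)
  also have "\<dots> = (\<Sum>\<pi>'\<in>dual G. \<Sum>x\<in>carrier G. \<alpha> \<pi>' * (char_of \<pi>' x * cnj (char_of \<pi> x)))"
    by (rule sum.swap)
  also have "\<dots> = (\<Sum>\<pi>'\<in>dual G. if \<pi>' = \<pi> then \<alpha> \<pi> * of_nat (card (carrier G)) else 0)"
    using \<pi> by (intro sum.cong refl) (auto simp: char_of_orthogonality simp flip: sum_distrib_left)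
  also have "\<dots> = \<alpha> \<pi> * of_nat (card (carrier G))"
    using \<pi> finite_dual by simp
  finally show ?thesis using card_carrier_pos by (simp add: char_coeff_def)
qed

text \<open>The difference of the two sides is orthogonal to all irreducible characters.\<close>

lemma class_function_expansion:
  assumes f: "f \<in> class_functions G" and x: "x \<in> carrier G"
  shows "f x = (\<Sum>\<pi>\<in>dual G. char_coeff G f \<pi> * char_of \<pi> x)"
proof -
  define r where "r = (\<lambda>x\<in>carrier G. f x - (\<Sum>\<pi>\<in>dual G. char_coeff G f \<pi> * char_of \<pi> x))"
  have r: "r \<in> class_functions G"
    using f by (auto simp: class_functions_def r_def char_of_conj intro!: sum.cong)
  have orth: "(\<Sum>g\<in>carrier G. r g * mat_trace (\<sigma> g)) = 0" if \<sigma>: "irreducible_rep G n \<sigma>" for n \<sigma>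
  proof -
    note c = dual_class_of[OF \<sigma>]
    \<comment> \<open>The coefficients conjugate the character, the sum above does not.\<close>
    obtain \<pi> where \<pi>: "\<pi> \<in> dual G"
      and ch: "\<And>g. g \<in> carrier G \<Longrightarrow> char_of \<pi> g = cnj (mat_trace (\<sigma> g))"
      using dual_obtain_conj[OF c(1)] c(3) by metis
    have "char_coeff G (\<lambda>x. \<Sum>\<pi>\<in>dual G. char_coeff G f \<pi> * char_of \<pi> x) \<pi> = char_coeff G f \<pi>"
      using \<pi> by (intro char_coeff_combination) auto
    then have "(\<Sum>g\<in>carrier G. f g * cnj (char_of \<pi> g)) =
        (\<Sum>g\<in>carrier G. (\<Sum>\<pi>\<in>dual G. char_coeff G f \<pi> * char_of \<pi> g) * cnj (char_of \<pi> g))"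
      using card_carrier_pos unfolding char_coeff_def[of G _ \<pi>] by simp
    then have "(\<Sum>g\<in>carrier G. r g * cnj (char_of \<pi> g)) = 0"
      by (simp add: r_def left_diff_distrib sum_subtractf)
    then show ?thesis by (simp add: ch)
  qed
  from class_function_eq_0[OF r orth x] show ?thesis using x by (simp add: r_def)
qed

lemma ZA_norm_eq:
  assumes f: "f \<in> class_functions G"
  shows "ZA_norm G f = (\<Sum>\<pi>\<in>dual G. real (degree_of G \<pi>) * cmod (char_coeff G f \<pi>))"
  unfolding ZA_norm_def
proof (rule the_equality)
  show "\<exists>\<alpha>. (\<forall>x\<in>carrier G. f x = (\<Sum>\<pi>\<in>dual G. \<alpha> \<pi> * char_of \<pi> x)) \<and>
    (\<Sum>\<pi>\<in>dual G. real (degree_of G \<pi>) * cmod (char_coeff G f \<pi>)) =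
    (\<Sum>\<pi>\<in>dual G. real (degree_of G \<pi>) * cmod (\<alpha> \<pi>))"
    using class_function_expansion[OF f] by blast
next
  fix r assume "\<exists>\<alpha>. (\<forall>x\<in>carrier G. f x = (\<Sum>\<pi>\<in>dual G. \<alpha> \<pi> * char_of \<pi> x)) \<and>
    r = (\<Sum>\<pi>\<in>dual G. real (degree_of G \<pi>) * cmod (\<alpha> \<pi>))"
  then obtain \<alpha> where \<alpha>: "\<And>x. x \<in> carrier G \<Longrightarrow> f x = (\<Sum>\<pi>\<in>dual G. \<alpha> \<pi> * char_of \<pi> x)"
    and r: "r = (\<Sum>\<pi>\<in>dual G. real (degree_of G \<pi>) * cmod (\<alpha> \<pi>))" by auto
  show "r = (\<Sum>\<pi>\<in>dual G. real (degree_of G \<pi>) * cmod (char_coeff G f \<pi>))"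
    unfolding r using char_coeff_combination[OF \<alpha>] by (intro sum.cong) simp_all
qed

end

section \<open>The projective tensor norm\<close>

lemma tensor_series_summable_form:
  assumes u: "tensor_series A a b u" and F: "F \<in> bounded_bilinear_forms A"
  shows "summable (\<lambda>n. F (a n) (b n))"
proof -
  have ab: "a n \<in> carrier A" "b n \<in> carrier A" for n using u by (auto simp: tensor_series_def)
  obtain K where K: "\<And>x y. x \<in> carrier A \<Longrightarrow> y \<in> carrier A \<Longrightarrow> cmod (F x y) \<le> K * nrm A x * nrm A y"
    using F unfolding bounded_bilinear_forms_def mem_Collect_eq by blast
  have "summable (\<lambda>n. K * (nrm A (a n) * nrm A (b n)))"
    using u by (intro summable_mult) (simp add: tensor_series_def)
  then show ?thesis
    by (rule summable_comparison_test'[where N=0]) (use K ab in \<open>simp add: mult.assoc\<close>)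
qed

lemma tensor_series_form_le:
  assumes u: "tensor_series A a b u" and F: "F \<in> bounded_bilinear_forms A"
    and le: "\<And>x y. x \<in> carrier A \<Longrightarrow> y \<in> carrier A \<Longrightarrow> cmod (F x y) \<le> nrm A x * nrm A y"
  shows "cmod (u F) \<le> (\<Sum>n. nrm A (a n) * nrm A (b n))"
proof -
  have "u F = (\<Sum>n. F (a n) (b n))" using u F by (simp add: tensor_series_def)
  moreover have "cmod (\<Sum>n. F (a n) (b n)) \<le> (\<Sum>n. nrm A (a n) * nrm A (b n))"
    using u le by (intro norm_suminf_le) (auto simp: tensor_series_def image_subset_iff)
  ultimately show ?thesis by simp
qed

text \<open>Bilinear forms of norm at most \<open>1\<close> give lower bounds for the projective norm.\<close>

lemma proj_norm_ge_form:
  assumes u: "u \<in> proj_tensor A" and F: "F \<in> bounded_bilinear_forms A"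
    and le: "\<And>x y. x \<in> carrier A \<Longrightarrow> y \<in> carrier A \<Longrightarrow> cmod (F x y) \<le> nrm A x * nrm A y"
  shows "cmod (u F) \<le> proj_norm A u"
  unfolding proj_norm_def
proof (rule cInf_greatest)
  show "{\<Sum>n. nrm A (a n) * nrm A (b n) | a b. tensor_series A a b u} \<noteq> {}"
    using u by (auto simp: proj_tensor_def)
  fix r assume "r \<in> {\<Sum>n. nrm A (a n) * nrm A (b n) | a b. tensor_series A a b u}"
  then obtain a b where "r = (\<Sum>n. nrm A (a n) * nrm A (b n))" "tensor_series A a b u" by auto
  then show "cmod (u F) \<le> r" using tensor_series_form_le[OF _ F le] by simp
qed

text \<open>Tensors act linearly on forms, and see the values of a form on the algebra only.\<close>

lemma proj_tensor_combination:
  assumes u: "u \<in> proj_tensor A" and S: "finite S"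
    and F: "F \<in> bounded_bilinear_forms A" and Fi: "\<And>i. i \<in> S \<Longrightarrow> Fi i \<in> bounded_bilinear_forms A"
    and eq: "\<And>x y. x \<in> carrier A \<Longrightarrow> y \<in> carrier A \<Longrightarrow> F x y = (\<Sum>i\<in>S. c i * Fi i x y)"
  shows "u F = (\<Sum>i\<in>S. c i * u (Fi i))"
proof -
  obtain a b where u: "tensor_series A a b u" using u by (auto simp: proj_tensor_def)
  then have ab: "a n \<in> carrier A" "b n \<in> carrier A" for n by (auto simp: tensor_series_def)
  have ev: "u H = (\<Sum>n. H (a n) (b n))" if "H \<in> bounded_bilinear_forms A" for H
    using u that by (simp add: tensor_series_def)
  have sm: "summable (\<lambda>n. Fi i (a n) (b n))" if "i \<in> S" for i
    by (rule tensor_series_summable_form[OF u Fi[OF that]])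
  have "u F = (\<Sum>n. \<Sum>i\<in>S. c i * Fi i (a n) (b n))"
    by (simp add: ev[OF F] eq ab)
  also have "\<dots> = (\<Sum>i\<in>S. \<Sum>n. c i * Fi i (a n) (b n))"
    using sm by (intro suminf_sum summable_mult)
  also have "\<dots> = (\<Sum>i\<in>S. c i * u (Fi i))"
    using sm by (intro sum.cong refl) (simp add: ev[OF Fi] suminf_mult)
  finally show ?thesis .
qed

text \<open>A finite sum becomes a series by appending elementary tensors \<open>z \<otimes> z\<close> with \<open>z\<close> of norm \<open>0\<close>.\<close>

lemma finite_tensor:
  assumes S: "finite S" and p: "\<And>s. s \<in> S \<Longrightarrow> p s \<in> carrier A" and q: "\<And>s. s \<in> S \<Longrightarrow> q s \<in> carrier A"
    and z: "z \<in> carrier A" "nrm A z = 0" and nonneg: "\<And>x. x \<in> carrier A \<Longrightarrow> 0 \<le> nrm A x"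
  defines "u \<equiv> (\<lambda>F\<in>bounded_bilinear_forms A. \<Sum>s\<in>S. F (p s) (q s))"
  shows "u \<in> proj_tensor A" "proj_norm A u \<le> (\<Sum>s\<in>S. nrm A (p s) * nrm A (q s))"
proof -
  define N where "N = card S"
  obtain e where e: "bij_betw e {..<N} S"
    unfolding N_def using ex_bij_betw_nat_finite[OF S] by (auto simp: atLeast0LessThan)
  have eS: "e n \<in> S" if "n < N" for n using e that by (auto simp: bij_betw_def)
  define a where "a n = (if n < N then p (e n) else z)" for n
  define b where "b n = (if n < N then q (e n) else z)" for n
  have ab: "a n \<in> carrier A" "b n \<in> carrier A" for n
    using eS p q z by (simp_all add: a_def b_def)
  have fin: "finite {..<N}" by simp
  have nrm0: "nrm A (a n) * nrm A (b n) = 0" if "n \<notin> {..<N}" for n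
    using that z by (simp add: a_def)
  have F0: "F z z = 0" if F: "F \<in> bounded_bilinear_forms A" for F
  proof -
    obtain K where "\<And>x y. x \<in> carrier A \<Longrightarrow> y \<in> carrier A \<Longrightarrow> cmod (F x y) \<le> K * nrm A x * nrm A y"
      using F unfolding bounded_bilinear_forms_def mem_Collect_eq by blast
    from this[OF z(1) z(1)] show ?thesis by (simp add: z)
  qed
  have sumF: "(\<Sum>n. F (a n) (b n)) = (\<Sum>s\<in>S. F (p s) (q s))" if F: "F \<in> bounded_bilinear_forms A" for F
  proof -
    have "(\<Sum>n. F (a n) (b n)) = (\<Sum>n<N. F (a n) (b n))"
      using F0[OF F] by (intro suminf_finite fin) (simp add: a_def b_def)
    also have "\<dots> = (\<Sum>n<N. F (p (e n)) (q (e n)))" by (simp add: a_def b_def)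
    also have "\<dots> = (\<Sum>s\<in>S. F (p s) (q s))" by (rule sum.reindex_bij_betw[OF e])
    finally show ?thesis .
  qed
  have ts: "tensor_series A a b u"
    unfolding tensor_series_def
  proof (intro conjI)
    show "summable (\<lambda>n. nrm A (a n) * nrm A (b n))"
      using nrm0 by (intro summable_finite[OF fin])
    show "u = (\<lambda>F\<in>bounded_bilinear_forms A. \<Sum>n. F (a n) (b n))"
      unfolding u_def by (intro restrict_ext) (simp add: sumF)
  qed (use ab in auto)
  then show "u \<in> proj_tensor A" by (auto simp: proj_tensor_def)
  have "(\<Sum>n. nrm A (a n) * nrm A (b n)) = (\<Sum>n<N. nrm A (a n) * nrm A (b n))"
    using nrm0 by (intro suminf_finite fin)
  also have "\<dots> = (\<Sum>n<N. nrm A (p (e n)) * nrm A (q (e n)))" by (simp add: a_def b_def)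
  also have "\<dots> = (\<Sum>s\<in>S. nrm A (p s) * nrm A (q s))" by (rule sum.reindex_bij_betw[OF e])
  finally have sum: "(\<Sum>n. nrm A (a n) * nrm A (b n)) = (\<Sum>s\<in>S. nrm A (p s) * nrm A (q s))" .
  show "proj_norm A u \<le> (\<Sum>s\<in>S. nrm A (p s) * nrm A (q s))"
    unfolding proj_norm_def
  proof (rule cInf_lower)
    show "(\<Sum>s\<in>S. nrm A (p s) * nrm A (q s)) \<in>
      {\<Sum>n. nrm A (a n) * nrm A (b n) | a b. tensor_series A a b u}"
      using ts sum[symmetric] by blast
    show "bdd_below {\<Sum>n. nrm A (a n) * nrm A (b n) | a b. tensor_series A a b u}"
    proof (rule bdd_belowI[of _ 0])
      fix r assume "r \<in> {\<Sum>n. nrm A (a n) * nrm A (b n) | a b. tensor_series A a b u}"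
      then obtain a b where r: "r = (\<Sum>n. nrm A (a n) * nrm A (b n))" and ts: "tensor_series A a b u"
        by auto
      have "a n \<in> carrier A" "b n \<in> carrier A" for n using ts by (auto simp: tensor_series_def)
      then show "0 \<le> r"
        unfolding r using ts nonneg by (intro suminf_nonneg mult_nonneg_nonneg) (auto simp: tensor_series_def)
    qed
  qed
qed

lemma zero_form_bounded_bilinear: "(\<lambda>x y. 0) \<in> bounded_bilinear_forms A"
  by (auto simp: bounded_bilinear_forms_def intro: exI[of _ 0])

lemma proj_norm_zero:
  assumes "z \<in> carrier A" "nrm A z = 0" "\<And>x. x \<in> carrier A \<Longrightarrow> 0 \<le> nrm A x"
  shows "proj_norm A (\<lambda>F\<in>bounded_bilinear_forms A. 0) = 0"
proof -
  note ft = finite_tensor[of "{}" _ A _ z, OF _ _ _ assms, simplified]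
  have "0 \<le> proj_norm A (\<lambda>F\<in>bounded_bilinear_forms A. 0)"
    using proj_norm_ge_form[OF ft(1) zero_form_bounded_bilinear] assms(3) zero_form_bounded_bilinear[of A]
    by simp
  with ft(2) show ?thesis by simp
qed

text \<open>Directedness turns finitely many null nets into one index at which all are small.\<close>

lemma net_null_common_index:
  assumes dir: "directed_set I rel" and S: "finite S"
    and null: "\<And>s. s \<in> S \<Longrightarrow> net_null I rel (f s)" and \<epsilon>: "\<epsilon> > 0"
  shows "\<exists>i\<in>I. \<forall>s\<in>S. \<bar>f s i\<bar> < \<epsilon>"
proof -
  have refl: "\<And>i. i \<in> I \<Longrightarrow> rel i i"
    and trans: "\<And>i j k. i \<in> I \<Longrightarrow> j \<in> I \<Longrightarrow> k \<in> I \<Longrightarrow> rel i j \<Longrightarrow> rel j k \<Longrightarrow> rel i k"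
    and ub: "\<And>i j. i \<in> I \<Longrightarrow> j \<in> I \<Longrightarrow> \<exists>k\<in>I. rel i k \<and> rel j k" and ne: "I \<noteq> {}"
    using dir unfolding directed_set_def by blast+
  have "\<exists>i\<in>I. \<forall>j\<in>I. rel i j \<longrightarrow> (\<forall>s\<in>S. \<bar>f s j\<bar> < \<epsilon>)"
    using S null
  proof (induction S)
    case empty
    then show ?case using ne by auto
  next
    case (insert s S)
    have "\<exists>i\<in>I. \<forall>j\<in>I. rel i j \<longrightarrow> (\<forall>s\<in>S. \<bar>f s j\<bar> < \<epsilon>)"
      by (rule insert.IH) (rule insert.prems, simp)
    then obtain i where i: "i \<in> I" "\<And>j s. j \<in> I \<Longrightarrow> rel i j \<Longrightarrow> s \<in> S \<Longrightarrow> \<bar>f s j\<bar> < \<epsilon>"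
      by blast
    have "net_null I rel (f s)" by (rule insert.prems) simp
    then obtain k where k: "k \<in> I" "\<And>j. j \<in> I \<Longrightarrow> rel k j \<Longrightarrow> \<bar>f s j\<bar> < \<epsilon>"
      using \<epsilon> unfolding net_null_def by blast
    obtain l where l: "l \<in> I" "rel i l" "rel k l" using ub[OF i(1) k(1)] by blast
    have "\<bar>f t j\<bar> < \<epsilon>" if j: "j \<in> I" "rel l j" and t: "t \<in> insert s S" for j t
    proof (cases "t = s")
      case True
      then show ?thesis using k(2)[OF j(1) trans[OF k(1) l(1) j(1) l(3) j(2)]] by simp
    next
      case False
      then show ?thesis using t i(2)[OF j(1) trans[OF i(1) l(1) j(1) l(2) j(2)]] by simp
    qed
    then show ?case using l(1) by blast
  qed
  then show ?thesis using refl by blast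
qed

section \<open>The central Fourier algebra\<close>

lemma ZA_simps [simp]:
  "carrier (ZA G) = class_functions G"
  "f \<otimes>\<^bsub>ZA G\<^esub> g = (\<lambda>x\<in>carrier G. f x * g x)"
  "\<one>\<^bsub>ZA G\<^esub> = (\<lambda>x\<in>carrier G. 1)"
  "\<zero>\<^bsub>ZA G\<^esub> = (\<lambda>x\<in>carrier G. 0)"
  "f \<oplus>\<^bsub>ZA G\<^esub> g = (\<lambda>x\<in>carrier G. f x + g x)"
  "c \<odot>\<^bsub>ZA G\<^esub> f = (\<lambda>x\<in>carrier G. c * f x)"
  "nrm (ZA G) = ZA_norm G"
  by (simp_all add: ZA_def)

definition irr_char :: "('a, 'b) monoid_scheme \<Rightarrow> ('a \<Rightarrow> complex mat) set \<Rightarrow> 'a \<Rightarrow> complex" where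
  "irr_char G \<pi> = (\<lambda>x\<in>carrier G. char_of \<pi> x)"

text \<open>The algebraic part of the definition of bounded bilinear forms; in finite dimension it implies
  boundedness (\<open>bounded_bilinear_forms_ZA\<close>).\<close>

definition bilinear_on_ZA ::
    "('a, 'b) monoid_scheme \<Rightarrow> (('a \<Rightarrow> complex) \<Rightarrow> ('a \<Rightarrow> complex) \<Rightarrow> complex) \<Rightarrow> bool" where
  "bilinear_on_ZA G F \<longleftrightarrow>
     (\<forall>x\<in>class_functions G. \<forall>y\<in>class_functions G. \<forall>z\<in>class_functions G.
        F (\<lambda>v\<in>carrier G. x v + y v) z = F x z + F y z \<and> F z (\<lambda>v\<in>carrier G. x v + y v) = F z x + F z y) \<and>
     (\<forall>c. \<forall>x\<in>class_functions G. \<forall>y\<in>class_functions G.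
        F (\<lambda>v\<in>carrier G. c * x v) y = c * F x y \<and> F x (\<lambda>v\<in>carrier G. c * y v) = c * F x y)"

definition point_form :: "'a \<Rightarrow> 'a \<Rightarrow> ('a \<Rightarrow> complex) \<Rightarrow> ('a \<Rightarrow> complex) \<Rightarrow> complex" where
  "point_form x y = (\<lambda>f h. f x * h y)"

context finite_group
begin

lemma class_function_restrictI:
  "(\<And>g x. g \<in> carrier G \<Longrightarrow> x \<in> carrier G \<Longrightarrow> f (g \<otimes> x \<otimes> inv g) = f x) \<Longrightarrow>
    (\<lambda>x\<in>carrier G. f x) \<in> class_functions G"
  by (simp add: class_functions_def)

lemma class_function_conj:
  "f \<in> class_functions G \<Longrightarrow> g \<in> carrier G \<Longrightarrow> x \<in> carrier G \<Longrightarrow>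
    f (g \<otimes> x \<otimes> inv g) = f x"
  by (simp add: class_functions_def)

lemma class_function_combination:
  assumes "\<And>s. s \<in> S \<Longrightarrow> h s \<in> class_functions G"
  shows "(\<lambda>x\<in>carrier G. \<Sum>s\<in>S. c s * h s x) \<in> class_functions G"
  using assms by (intro class_function_restrictI sum.cong refl) (simp add: class_function_conj)

lemma class_function_mult:
  "f \<in> class_functions G \<Longrightarrow> h \<in> class_functions G \<Longrightarrow>
    (\<lambda>x\<in>carrier G. f x * h x) \<in> class_functions G"
  by (intro class_function_restrictI) (simp add: class_function_conj)

lemma class_function_add:
  "f \<in> class_functions G \<Longrightarrow> h \<in> class_functions G \<Longrightarrow>
    (\<lambda>x\<in>carrier G. f x + h x) \<in> class_functions G"
  by (intro class_function_restrictI) (simp add: class_function_conj)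

lemma class_function_smult:
  "f \<in> class_functions G \<Longrightarrow> (\<lambda>x\<in>carrier G. c * f x) \<in> class_functions G"
  by (intro class_function_restrictI) (simp add: class_function_conj)

lemma class_function_const: "(\<lambda>x\<in>carrier G. c) \<in> class_functions G"
  by (intro class_function_restrictI) simp

lemma class_function_eqI:
  "f \<in> class_functions G \<Longrightarrow> h \<in> class_functions G \<Longrightarrow>
    (\<And>x. x \<in> carrier G \<Longrightarrow> f x = h x) \<Longrightarrow> f = h"
  by (auto simp: class_functions_def intro: extensionalityI)

lemma abelian_group_ZA: "abelian_group (ZA G)"
proof (rule abelian_groupI)
  fix f assume f: "f \<in> carrier (ZA G)"
  show "\<exists>h\<in>carrier (ZA G). h \<oplus>\<^bsub>ZA G\<^esub> f = \<zero>\<^bsub>ZA G\<^esub>"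
    using f class_function_smult[of f "-1"]
    by (intro bexI[of _ "\<lambda>x\<in>carrier G. -1 * f x"]) (auto intro!: restrict_ext)
  show "\<zero>\<^bsub>ZA G\<^esub> \<oplus>\<^bsub>ZA G\<^esub> f = f"
  proof -
    have f': "f \<in> class_functions G" using f by simp
    have "(\<lambda>x\<in>carrier G. (\<lambda>x\<in>carrier G. 0) x + f x) = f"
      by (rule class_function_eqI[OF class_function_add[OF class_function_const f'] f']) simp
    then show ?thesis by (simp only: ZA_simps)
  qed
qed (auto intro!: class_function_add class_function_const restrict_ext)

lemma ZA_minus:
  assumes f: "f \<in> class_functions G" and h: "h \<in> class_functions G"
  shows "f \<ominus>\<^bsub>ZA G\<^esub> h = (\<lambda>x\<in>carrier G. f x - h x)"
proof -
  interpret A: abelian_group "ZA G" by (rule abelian_group_ZA)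
  have "(\<lambda>x\<in>carrier G. - h x) \<in> class_functions G"
    using class_function_smult[OF h, of "-1"] by simp
  then have "\<ominus>\<^bsub>ZA G\<^esub> h = (\<lambda>x\<in>carrier G. - h x)"
    by (intro A.minus_equality) (use h in \<open>auto intro!: restrict_ext\<close>)
  then show ?thesis by (auto simp: A.minus_eq intro!: restrict_ext)
qed

lemma ZA_finsum:
  fixes f :: "nat \<Rightarrow> 'a \<Rightarrow> complex"
  assumes f: "\<And>n. f n \<in> class_functions G"
  shows "(\<Oplus>\<^bsub>ZA G\<^esub>n\<in>{..<N}. f n) = (\<lambda>x\<in>carrier G. \<Sum>n<N. f n x)"
proof -
  interpret A: abelian_group "ZA G" by (rule abelian_group_ZA)
  show ?thesis
  proof (induction N)
    case 0
    show ?case by (simp only: lessThan_0 A.finsum_empty ZA_simps sum.empty)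
  next
    case (Suc N)
    have "(\<Oplus>\<^bsub>ZA G\<^esub>n\<in>{..<Suc N}. f n) = f N \<oplus>\<^bsub>ZA G\<^esub> (\<Oplus>\<^bsub>ZA G\<^esub>n\<in>{..<N}. f n)"
      unfolding lessThan_Suc using f by (intro A.finsum_insert) auto
    then show ?case unfolding Suc by (auto simp: add.commute intro!: restrict_ext)
  qed
qed

lemma ZA_norm_nonneg: "f \<in> class_functions G \<Longrightarrow> 0 \<le> ZA_norm G f"
  by (simp add: ZA_norm_eq sum_nonneg)

text \<open>All degrees are at least \<open>1\<close>.\<close>

lemma cmod_char_coeff_le:
  assumes f: "f \<in> class_functions G" and \<pi>: "\<pi> \<in> dual G"
  shows "cmod (char_coeff G f \<pi>) \<le> ZA_norm G f"
proof -
  have "1 * cmod (char_coeff G f \<pi>) \<le> real (degree_of G \<pi>) * cmod (char_coeff G f \<pi>)"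
    using degree_pos[OF \<pi>] by (intro mult_right_mono) auto
  also have "\<dots> \<le> ZA_norm G f"
    unfolding ZA_norm_eq[OF f] using \<pi> finite_dual by (intro member_le_sum) auto
  finally show ?thesis by simp
qed

text \<open>Point evaluations are contractive, because \<open>|\<chi>\<^sub>\<pi>(x)| \<le> d\<^sub>\<pi>\<close>.\<close>

lemma cmod_le_ZA_norm:
  assumes f: "f \<in> class_functions G" and x: "x \<in> carrier G"
  shows "cmod (f x) \<le> ZA_norm G f"
proof -
  have "cmod (f x) \<le> (\<Sum>\<pi>\<in>dual G. cmod (char_coeff G f \<pi> * char_of \<pi> x))"
    unfolding class_function_expansion[OF f x] by (rule norm_sum)
  also have "\<dots> \<le> (\<Sum>\<pi>\<in>dual G. real (degree_of G \<pi>) * cmod (char_coeff G f \<pi>))"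
  proof (rule sum_mono)
    fix \<pi> assume "\<pi> \<in> dual G"
    then have "cmod (char_coeff G f \<pi>) * cmod (char_of \<pi> x) \<le>
        cmod (char_coeff G f \<pi>) * real (degree_of G \<pi>)"
      using char_of_bound[OF _ x] by (intro mult_left_mono) auto
    then show "cmod (char_coeff G f \<pi> * char_of \<pi> x) \<le> real (degree_of G \<pi>) * cmod (char_coeff G f \<pi>)"
      by (simp add: norm_mult mult.commute)
  qed
  finally show ?thesis by (simp add: ZA_norm_eq[OF f])
qed

lemma irr_char_class_function: "\<pi> \<in> dual G \<Longrightarrow> irr_char G \<pi> \<in> class_functions G"
  unfolding irr_char_def by (intro class_function_restrictI char_of_conj)

lemma ZA_norm_smult_irr_char:
  assumes \<pi>: "\<pi> \<in> dual G"
  shows "ZA_norm G (\<lambda>x\<in>carrier G. c * irr_char G \<pi> x) = cmod c * real (degree_of G \<pi>)"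
proof -
  let ?f = "\<lambda>x\<in>carrier G. c * irr_char G \<pi> x"
  have "char_coeff G ?f \<rho> = (if \<rho> = \<pi> then c else 0)" if "\<rho> \<in> dual G" for \<rho>
  proof (rule char_coeff_combination[OF _ that])
    fix x assume x: "x \<in> carrier G"
    have "(\<Sum>\<rho>\<in>dual G. (if \<rho> = \<pi> then c else 0) * char_of \<rho> x) =
        (\<Sum>\<rho>\<in>dual G. if \<rho> = \<pi> then c * char_of \<pi> x else 0)"
      by (intro sum.cong) auto
    then show "?f x = (\<Sum>\<rho>\<in>dual G. (if \<rho> = \<pi> then c else 0) * char_of \<rho> x)"
      using x \<pi> finite_dual by (simp add: irr_char_def)
  qed
  then have "ZA_norm G ?f = (\<Sum>\<rho>\<in>dual G. real (degree_of G \<rho>) * cmod (if \<rho> = \<pi> then c else 0))"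
    unfolding ZA_norm_eq[OF class_function_smult[OF irr_char_class_function[OF \<pi>]]]
    by (intro sum.cong) auto
  also have "\<dots> = (\<Sum>\<rho>\<in>dual G. if \<rho> = \<pi> then cmod c * real (degree_of G \<pi>) else 0)"
    by (intro sum.cong) auto
  finally show ?thesis using \<pi> finite_dual by simp
qed

lemma ZA_norm_irr_char:
  assumes \<pi>: "\<pi> \<in> dual G"
  shows "ZA_norm G (irr_char G \<pi>) = real (degree_of G \<pi>)"
proof -
  have "(\<lambda>x\<in>carrier G. 1 * irr_char G \<pi> x) = irr_char G \<pi>"
    by (simp add: irr_char_def cong: restrict_cong)
  then show ?thesis using ZA_norm_smult_irr_char[OF \<pi>, of 1] by simp
qed

lemma ZA_norm_zero: "ZA_norm G (\<lambda>x\<in>carrier G. 0) = 0"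
proof -
  have "char_coeff G (\<lambda>x\<in>carrier G. 0) \<pi> = 0" for \<pi> by (simp add: char_coeff_def)
  then show ?thesis by (simp add: ZA_norm_eq[OF class_function_const])
qed

lemma char_coeff_add:
  "char_coeff G (\<lambda>x\<in>carrier G. f x + h x) \<pi> = char_coeff G f \<pi> + char_coeff G h \<pi>"
  by (simp add: char_coeff_def sum.distrib distrib_right add_divide_distrib)

lemma char_coeff_smult:
  "char_coeff G (\<lambda>x\<in>carrier G. c * f x) \<pi> = c * char_coeff G f \<pi>"
  by (simp add: char_coeff_def sum_distrib_left mult.assoc)

lemma linear_combination:
  fixes L :: "('a \<Rightarrow> complex) \<Rightarrow> complex"
  assumes add: "\<And>f h. f \<in> class_functions G \<Longrightarrow> h \<in> class_functions G \<Longrightarrow>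
      L (\<lambda>x\<in>carrier G. f x + h x) = L f + L h"
    and smult: "\<And>c f. f \<in> class_functions G \<Longrightarrow> L (\<lambda>x\<in>carrier G. c * f x) = c * L f"
    and S: "finite S" and h: "\<And>s. s \<in> S \<Longrightarrow> h s \<in> class_functions G"
  shows "L (\<lambda>x\<in>carrier G. \<Sum>s\<in>S. c s * h s x) = (\<Sum>s\<in>S. c s * L (h s))"
  using S h
proof (induction S)
  case empty
  have eq: "(\<lambda>x\<in>carrier G. \<Sum>s\<in>{}. c s * h s x) = (\<lambda>x\<in>carrier G. 0 * (\<lambda>x\<in>carrier G. 0) x)"
    by (intro restrict_ext) simp
  show ?case unfolding eq smult[OF class_function_const] by simp
next
  case (insert s S)
  have eq: "(\<lambda>x\<in>carrier G. \<Sum>s\<in>insert s S. c s * h s x) =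
    (\<lambda>x\<in>carrier G. (\<lambda>x\<in>carrier G. c s * h s x) x + (\<lambda>x\<in>carrier G. \<Sum>s\<in>S. c s * h s x) x)"
    using insert.hyps by (intro restrict_ext) simp
  have hs: "h s \<in> class_functions G" using insert.prems by simp
  have "L (\<lambda>x\<in>carrier G. \<Sum>s\<in>insert s S. c s * h s x) =
      L (\<lambda>x\<in>carrier G. c s * h s x) + L (\<lambda>x\<in>carrier G. \<Sum>s\<in>S. c s * h s x)"
    unfolding eq using insert.prems
    by (intro add class_function_smult[OF hs] class_function_combination) simp
  also have "\<dots> = c s * L (h s) + (\<Sum>s\<in>S. c s * L (h s))"
    by (simp only: smult[OF hs] insert.IH[OF insert.prems[OF insertI2]])
  also have "\<dots> = (\<Sum>s\<in>insert s S. c s * L (h s))"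
    using insert.hyps by simp
  finally show ?case .
qed

lemma bilinear_on_ZA_add:
  assumes "bilinear_on_ZA G F" "f \<in> class_functions G" "h \<in> class_functions G" "k \<in> class_functions G"
  shows "F (\<lambda>v\<in>carrier G. f v + h v) k = F f k + F h k"
    "F k (\<lambda>v\<in>carrier G. f v + h v) = F k f + F k h"
  using assms unfolding bilinear_on_ZA_def by blast+

lemma bilinear_on_ZA_smult:
  assumes "bilinear_on_ZA G F" "f \<in> class_functions G" "k \<in> class_functions G"
  shows "F (\<lambda>v\<in>carrier G. c * f v) k = c * F f k" "F k (\<lambda>v\<in>carrier G. c * f v) = c * F k f"
  using assms unfolding bilinear_on_ZA_def by blast+

lemma bilinear_combination:
  assumes F: "bilinear_on_ZA G F" and S: "finite S" "\<And>s. s \<in> S \<Longrightarrow> h s \<in> class_functions G"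
    and T: "finite T" "\<And>t. t \<in> T \<Longrightarrow> k t \<in> class_functions G"
  shows "F (\<lambda>x\<in>carrier G. \<Sum>s\<in>S. c s * h s x) (\<lambda>x\<in>carrier G. \<Sum>t\<in>T. e t * k t x) =
    (\<Sum>s\<in>S. \<Sum>t\<in>T. c s * e t * F (h s) (k t))"
proof -
  let ?k = "\<lambda>x\<in>carrier G. \<Sum>t\<in>T. e t * k t x"
  have k: "?k \<in> class_functions G" by (rule class_function_combination[OF T(2)])
  have "F (\<lambda>x\<in>carrier G. \<Sum>s\<in>S. c s * h s x) ?k = (\<Sum>s\<in>S. c s * F (h s) ?k)"
    using S by (intro linear_combination[where L = "\<lambda>x. F x ?k"] bilinear_on_ZA_add(1)[OF F _ _ k]
        bilinear_on_ZA_smult(1)[OF F _ k])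
  also have "\<dots> = (\<Sum>s\<in>S. c s * (\<Sum>t\<in>T. e t * F (h s) (k t)))"
  proof (intro sum.cong refl arg_cong[where f = "(*) _"])
    fix s assume "s \<in> S"
    from S(2)[OF this] show "F (h s) ?k = (\<Sum>t\<in>T. e t * F (h s) (k t))"
      using T by (intro linear_combination[where L = "F (h s)"] bilinear_on_ZA_add(2)[OF F]
          bilinear_on_ZA_smult(2)[OF F])
  qed
  also have "\<dots> = (\<Sum>s\<in>S. \<Sum>t\<in>T. c s * e t * F (h s) (k t))"
    by (simp add: sum_distrib_left mult.assoc)
  finally show ?thesis .
qed

lemma class_function_eq_combination:
  "f \<in> class_functions G \<Longrightarrow>
    f = (\<lambda>x\<in>carrier G. \<Sum>\<pi>\<in>dual G. char_coeff G f \<pi> * irr_char G \<pi> x)"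
  by (intro class_function_eqI class_function_combination irr_char_class_function)
    (simp_all add: irr_char_def class_function_expansion)

lemma bilinear_eq_char_combination:
  assumes F: "bilinear_on_ZA G F" and f: "f \<in> class_functions G" and h: "h \<in> class_functions G"
  shows "F f h = (\<Sum>\<pi>\<in>dual G. \<Sum>\<pi>'\<in>dual G.
    char_coeff G f \<pi> * char_coeff G h \<pi>' * F (irr_char G \<pi>) (irr_char G \<pi>'))"
proof -
  note fd = finite_dual
  have "F (\<lambda>x\<in>carrier G. \<Sum>\<pi>\<in>dual G. char_coeff G f \<pi> * irr_char G \<pi> x)
      (\<lambda>x\<in>carrier G. \<Sum>\<pi>\<in>dual G. char_coeff G h \<pi> * irr_char G \<pi> x) =
    (\<Sum>\<pi>\<in>dual G. \<Sum>\<pi>'\<in>dual G.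
      char_coeff G f \<pi> * char_coeff G h \<pi>' * F (irr_char G \<pi>) (irr_char G \<pi>'))"
    by (rule bilinear_combination[OF F fd irr_char_class_function fd irr_char_class_function])
  then show ?thesis
    by (simp only: class_function_eq_combination[OF f, symmetric] class_function_eq_combination[OF h, symmetric])
qed

text \<open>A form is a finite combination of products of coefficient functionals, which are contractive.\<close>

lemma bounded_bilinear_forms_ZA: "F \<in> bounded_bilinear_forms (ZA G) \<longleftrightarrow> bilinear_on_ZA G F"
proof
  assume F: "bilinear_on_ZA G F"
  let ?K = "\<Sum>\<pi>\<in>dual G. \<Sum>\<pi>'\<in>dual G. cmod (F (irr_char G \<pi>) (irr_char G \<pi>'))"
  have "cmod (F f h) \<le> ?K * ZA_norm G f * ZA_norm G h"
    if f: "f \<in> class_functions G" and h: "h \<in> class_functions G" for f h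
  proof -
    have "cmod (F f h) \<le> (\<Sum>\<pi>\<in>dual G. \<Sum>\<pi>'\<in>dual G.
        cmod (char_coeff G f \<pi> * char_coeff G h \<pi>' * F (irr_char G \<pi>) (irr_char G \<pi>')))"
      unfolding bilinear_eq_char_combination[OF F f h]
      by (intro order_trans[OF norm_sum] sum_mono norm_sum)
    also have "\<dots> \<le> (\<Sum>\<pi>\<in>dual G. \<Sum>\<pi>'\<in>dual G.
        ZA_norm G f * ZA_norm G h * cmod (F (irr_char G \<pi>) (irr_char G \<pi>')))"
      unfolding norm_mult using f h
      by (intro sum_mono mult_right_mono mult_mono cmod_char_coeff_le norm_ge_zero ZA_norm_nonneg)
    also have "\<dots> = ?K * ZA_norm G f * ZA_norm G h"
      by (simp add: mult_ac flip: sum_distrib_left)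
    finally show ?thesis .
  qed
  with F show "F \<in> bounded_bilinear_forms (ZA G)"
    unfolding bounded_bilinear_forms_def bilinear_on_ZA_def mem_Collect_eq ZA_simps by blast
next
  assume "F \<in> bounded_bilinear_forms (ZA G)"
  then show "bilinear_on_ZA G F"
    unfolding bounded_bilinear_forms_def bilinear_on_ZA_def mem_Collect_eq ZA_simps by blast
qed

lemma bilinear_on_ZA_mult:
  assumes F: "bilinear_on_ZA G F" and c: "c \<in> class_functions G"
  shows "bilinear_on_ZA G (\<lambda>x y. F (\<lambda>v\<in>carrier G. c v * x v) y)"
    "bilinear_on_ZA G (\<lambda>x y. F x (\<lambda>v\<in>carrier G. y v * c v))"
proof -
  have eqs: "(\<lambda>v\<in>carrier G. c v * (\<lambda>v\<in>carrier G. x v + y v) v) =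
      (\<lambda>v\<in>carrier G. (\<lambda>v\<in>carrier G. c v * x v) v + (\<lambda>v\<in>carrier G. c v * y v) v)"
    "(\<lambda>v\<in>carrier G. c v * (\<lambda>v\<in>carrier G. a * x v) v) =
      (\<lambda>v\<in>carrier G. a * (\<lambda>v\<in>carrier G. c v * x v) v)" for a x y
    by (auto simp: algebra_simps intro!: restrict_ext)
  have comm: "(\<lambda>v\<in>carrier G. y v * c v) = (\<lambda>v\<in>carrier G. c v * y v)" for y
    by (simp add: mult.commute)
  show "bilinear_on_ZA G (\<lambda>x y. F (\<lambda>v\<in>carrier G. c v * x v) y)"
    unfolding bilinear_on_ZA_def eqs
    by (intro conjI ballI allI bilinear_on_ZA_add[OF F] bilinear_on_ZA_smult[OF F] class_function_mult[OF c])
  show "bilinear_on_ZA G (\<lambda>x y. F x (\<lambda>v\<in>carrier G. y v * c v))"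
    unfolding comm bilinear_on_ZA_def eqs
    by (intro conjI ballI allI bilinear_on_ZA_add[OF F] bilinear_on_ZA_smult[OF F] class_function_mult[OF c])
qed

lemma point_form_bilinear:
  "x \<in> carrier G \<Longrightarrow> y \<in> carrier G \<Longrightarrow> bilinear_on_ZA G (point_form x y)"
  by (auto simp: bilinear_on_ZA_def point_form_def algebra_simps)

lemma point_form_le:
  assumes "x \<in> carrier G" "y \<in> carrier G" "f \<in> class_functions G" "h \<in> class_functions G"
  shows "cmod (point_form x y f h) \<le> ZA_norm G f * ZA_norm G h"
  unfolding point_form_def norm_mult
  using assms by (intro mult_mono cmod_le_ZA_norm ZA_norm_nonneg) auto

lemma ZA_norm_tendsto_0_iff:
  assumes e: "\<And>N :: nat. e N \<in> class_functions G"
  shows "(\<lambda>N. ZA_norm G (e N)) \<longlonglongrightarrow> 0 \<longleftrightarrow> (\<forall>x\<in>carrier G. (\<lambda>N. e N x) \<longlonglongrightarrow> 0)"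
proof
  assume lim: "(\<lambda>N. ZA_norm G (e N)) \<longlonglongrightarrow> 0"
  show "\<forall>x\<in>carrier G. (\<lambda>N. e N x) \<longlonglongrightarrow> 0"
  proof
    fix x assume x: "x \<in> carrier G"
    show "(\<lambda>N. e N x) \<longlonglongrightarrow> 0"
      by (rule tendsto_norm_zero_cancel, rule tendsto_sandwich[OF _ _ tendsto_const lim])
        (intro always_eventually allI norm_ge_zero cmod_le_ZA_norm[OF e x])+
  qed
next
  assume lim: "\<forall>x\<in>carrier G. (\<lambda>N. e N x) \<longlonglongrightarrow> 0"
  have "(\<lambda>N. char_coeff G (e N) \<pi>) \<longlonglongrightarrow>
      (\<Sum>x\<in>carrier G. 0 * cnj (char_of \<pi> x)) / of_nat (card (carrier G))" for \<pi>
    unfolding char_coeff_def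
    by (intro tendsto_intros lim[rule_format]) (use card_carrier_pos in auto)
  then have "(\<lambda>N. \<Sum>\<pi>\<in>dual G. real (degree_of G \<pi>) * cmod (char_coeff G (e N) \<pi>)) \<longlonglongrightarrow>
      (\<Sum>\<pi>\<in>dual G. real (degree_of G \<pi>) * 0)"
    by (intro tendsto_intros tendsto_norm_zero) simp
  then show "(\<lambda>N. ZA_norm G (e N)) \<longlonglongrightarrow> 0" by (simp add: ZA_norm_eq[OF e])
qed

text \<open>Evaluating the product \<open>\<Sum>n. a\<^sub>n b\<^sub>n\<close> at \<open>x\<close> is evaluating the tensor at the form \<open>(f, h) \<mapsto> f x * h x\<close>.
  So the product does not depend on the series, and norm convergence reduces to pointwise
  convergence.\<close>

lemma tensor_mult_ZA:
  assumes u: "u \<in> proj_tensor (ZA G)"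
  shows "tensor_mult (ZA G) u = (\<lambda>x\<in>carrier G. u (point_form x x))"
proof -
  define c where "c = (\<lambda>x\<in>carrier G. u (point_form x x))"
  have form: "point_form x x \<in> bounded_bilinear_forms (ZA G)" if "x \<in> carrier G" for x
    using point_form_bilinear[OF that that] by (simp add: bounded_bilinear_forms_ZA)
  have sums: "(\<lambda>n. a n x * b n x) sums c x"
    if ts: "tensor_series (ZA G) a b u" and x: "x \<in> carrier G" for a b x
  proof -
    have "u (point_form x x) = (\<Sum>n. a n x * b n x)"
      using ts form[OF x] by (simp add: tensor_series_def point_form_def)
    moreover have "summable (\<lambda>n. a n x * b n x)"
      using tensor_series_summable_form[OF ts form[OF x]] by (simp add: point_form_def)
    ultimately show ?thesis using x by (simp add: c_def sums_iff)
  qed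
  have cf: "a n \<in> class_functions G" "b n \<in> class_functions G"
    if "tensor_series (ZA G) a b u" for a b n
    using that by (auto simp: tensor_series_def)
  have c: "c \<in> class_functions G"
  proof -
    obtain a b where ts: "tensor_series (ZA G) a b u" using u by (auto simp: proj_tensor_def)
    show ?thesis
      unfolding c_def
    proof (rule class_function_restrictI)
      fix g x assume gx: "g \<in> carrier G" "x \<in> carrier G"
      let ?y = "g \<otimes> x \<otimes> inv g"
      have y: "?y \<in> carrier G" using gx by simp
      have "(\<lambda>n. a n ?y * b n ?y) = (\<lambda>n. a n x * b n x)"
        using cf[OF ts] gx by (simp add: class_function_conj)
      with sums[OF ts gx(2)] sums[OF ts y] have "c ?y = c x" by (metis sums_unique2)
      then show "u (point_form ?y ?y) = u (point_form x x)" using gx y by (simp add: c_def)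
    qed
  qed
  have diff: "(\<Oplus>\<^bsub>ZA G\<^esub>n\<in>{..<N}. a n \<otimes>\<^bsub>ZA G\<^esub> b n) \<ominus>\<^bsub>ZA G\<^esub> d =
      (\<lambda>x\<in>carrier G. (\<Sum>n<N. a n x * b n x) - d x)"
    if ts: "tensor_series (ZA G) a b u" and d: "d \<in> class_functions G" for a b d N
  proof -
    have m: "a n \<otimes>\<^bsub>ZA G\<^esub> b n \<in> class_functions G" for n
      using class_function_mult[OF cf[OF ts]] by simp
    have "(\<Oplus>\<^bsub>ZA G\<^esub>n\<in>{..<N}. a n \<otimes>\<^bsub>ZA G\<^esub> b n) = (\<lambda>x\<in>carrier G. \<Sum>n<N. 1 * (a n \<otimes>\<^bsub>ZA G\<^esub> b n) x)"
      using ZA_finsum[of "\<lambda>n. a n \<otimes>\<^bsub>ZA G\<^esub> b n", OF m] by simp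
    moreover have "\<dots> \<in> class_functions G" by (rule class_function_combination[OF m])
    ultimately show ?thesis using ZA_minus[OF _ d] by (auto intro!: restrict_ext)
  qed
  have lim_iff: "(\<lambda>N. nrm (ZA G) ((\<Oplus>\<^bsub>ZA G\<^esub>n\<in>{..<N}. a n \<otimes>\<^bsub>ZA G\<^esub> b n) \<ominus>\<^bsub>ZA G\<^esub> d)) \<longlonglongrightarrow> 0 \<longleftrightarrow> d = c"
    if ts: "tensor_series (ZA G) a b u" and d: "d \<in> class_functions G" for a b d
  proof -
    let ?e = "\<lambda>N. \<lambda>x\<in>carrier G. (\<Sum>n<N. a n x * b n x) - d x"
    have e_cf: "?e N \<in> class_functions G" for N
      using d cf[OF ts] by (intro class_function_restrictI) (simp add: class_function_conj)
    have "(\<lambda>N. ?e N x) \<longlonglongrightarrow> 0 \<longleftrightarrow> d x = c x" if x: "x \<in> carrier G" for x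
      using x sums[OF ts x] LIM_zero_iff[of "\<lambda>N. \<Sum>n<N. a n x * b n x" "d x" sequentially]
      unfolding sums_def by (auto dest: LIMSEQ_unique)
    then have "(\<lambda>N. ZA_norm G (?e N)) \<longlonglongrightarrow> 0 \<longleftrightarrow> (\<forall>x\<in>carrier G. d x = c x)"
      unfolding ZA_norm_tendsto_0_iff[OF e_cf] by (intro ball_cong refl)
    also have "\<dots> \<longleftrightarrow> d = c" using class_function_eqI[OF d c] by auto
    finally show ?thesis unfolding diff[OF ts d] by simp
  qed
  have "(THE d. d \<in> carrier (ZA G) \<and> (\<exists>a b. tensor_series (ZA G) a b u \<and>
     (\<lambda>N. nrm (ZA G) ((\<Oplus>\<^bsub>ZA G\<^esub>n\<in>{..<N}. a n \<otimes>\<^bsub>ZA G\<^esub> b n) \<ominus>\<^bsub>ZA G\<^esub> d)) \<longlonglongrightarrow> 0)) = c"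
  proof (rule the_equality)
    obtain a b where ts: "tensor_series (ZA G) a b u" using u by (auto simp: proj_tensor_def)
    show "c \<in> carrier (ZA G) \<and> (\<exists>a b. tensor_series (ZA G) a b u \<and>
       (\<lambda>N. nrm (ZA G) ((\<Oplus>\<^bsub>ZA G\<^esub>n\<in>{..<N}. a n \<otimes>\<^bsub>ZA G\<^esub> b n) \<ominus>\<^bsub>ZA G\<^esub> c)) \<longlonglongrightarrow> 0)"
      unfolding ZA_simps(1) using c ts lim_iff[OF ts c] by blast
  qed (use lim_iff in \<open>unfold ZA_simps(1), blast\<close>)
  then show ?thesis by (simp only: tensor_mult_def c_def)
qed

end

section \<open>Conjugacy classes\<close>

definition class_rep :: "'a set \<Rightarrow> 'a" where
  "class_rep C = (SOME x. x \<in> C)"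

definition class_ind :: "('a, 'b) monoid_scheme \<Rightarrow> 'a set \<Rightarrow> 'a \<Rightarrow> complex" where
  "class_ind G C = (\<lambda>x\<in>carrier G. if x \<in> C then 1 else 0)"

context finite_group
begin

interpretation conj: group_action G "carrier G" "\<lambda>g. \<lambda>h\<in>carrier G. g \<otimes> h \<otimes> inv g"
  by (rule action_by_conjugation)

lemma Union_conj_classes: "\<Union>(conj_classes G) = carrier G"
  unfolding conj_classes_def by (rule conj.orbits_coverture)

lemma conj_classes_eqI:
  "C \<in> conj_classes G \<Longrightarrow> D \<in> conj_classes G \<Longrightarrow> x \<in> C \<Longrightarrow> x \<in> D \<Longrightarrow> C = D"
  using conj.disjoint_union[of C D] unfolding conj_classes_def by blast

lemma finite_conj_classes: "finite (conj_classes G)"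
  using fin Union_conj_classes finite_UnionD by metis

lemma sum_conj_classes: "(\<Sum>C\<in>conj_classes G. \<Sum>x\<in>C. f x) = (\<Sum>x\<in>carrier G. f x)"
  unfolding conj_classes_def by (rule conj.disjoint_sum[OF fin])

lemma conj_classes_obtain:
  assumes "C \<in> conj_classes G"
  obtains x where "x \<in> carrier G" "C = (\<lambda>g. g \<otimes> x \<otimes> inv g) ` carrier G"
proof -
  obtain x where x: "x \<in> carrier G"
    "C = orbit G (\<lambda>g. \<lambda>h\<in>carrier G. g \<otimes> h \<otimes> inv g) x"
    using assms unfolding conj_classes_def orbits_def by blast
  then have "C = (\<lambda>g. g \<otimes> x \<otimes> inv g) ` carrier G"
    by (auto simp: orbit_def)
  with x(1) show ?thesis by (rule that)
qed

lemma conj_class_subset: "C \<in> conj_classes G \<Longrightarrow> C \<subseteq> carrier G"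
  using Union_conj_classes by blast

lemma conj_class_conj:
  assumes C: "C \<in> conj_classes G" and x: "x \<in> C" and g: "g \<in> carrier G"
  shows "g \<otimes> x \<otimes> inv g \<in> C"
proof -
  obtain y where y: "y \<in> carrier G" "C = (\<lambda>g. g \<otimes> y \<otimes> inv g) ` carrier G"
    using conj_classes_obtain[OF C] by metis
  obtain h where h: "h \<in> carrier G" "x = h \<otimes> y \<otimes> inv h" using x y by auto
  have "g \<otimes> x \<otimes> inv g = (g \<otimes> h) \<otimes> y \<otimes> inv (g \<otimes> h)"
    using g h y by (simp add: m_assoc inv_mult_group)
  then show ?thesis using g h(1) y(2) by blast
qed

lemma class_function_constant:
  assumes f: "f \<in> class_functions G" and C: "C \<in> conj_classes G" and x: "x \<in> C" and y: "y \<in> C"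
  shows "f x = f y"
proof -
  obtain z where z: "z \<in> carrier G" "C = (\<lambda>g. g \<otimes> z \<otimes> inv g) ` carrier G"
    using conj_classes_obtain[OF C] by metis
  have "f x = f z" "f y = f z" using f x y z by (auto simp: class_functions_def)
  then show ?thesis by simp
qed

lemma class_rep_in:
  assumes "C \<in> conj_classes G"
  shows "class_rep C \<in> C"
proof -
  obtain x where "C = (\<lambda>g. g \<otimes> x \<otimes> inv g) ` carrier G"
    using conj_classes_obtain[OF assms] by metis
  then have "\<exists>x. x \<in> C" using one_closed by blast
  then show ?thesis unfolding class_rep_def by (rule someI_ex)
qed

lemma class_rep_carrier: "C \<in> conj_classes G \<Longrightarrow> class_rep C \<in> carrier G"
  using class_rep_in conj_class_subset by blast

lemma class_rep_in_iff:
  "C \<in> conj_classes G \<Longrightarrow> D \<in> conj_classes G \<Longrightarrow> class_rep C \<in> D \<longleftrightarrow> C = D"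
  using class_rep_in conj_classes_eqI by blast

lemma class_ind_class_function:
  assumes C: "C \<in> conj_classes G"
  shows "class_ind G C \<in> class_functions G"
  unfolding class_ind_def
proof (rule class_function_restrictI)
  fix g x assume g: "g \<in> carrier G" and x: "x \<in> carrier G"
  let ?y = "g \<otimes> x \<otimes> inv g"
  have "inv g \<otimes> ?y \<otimes> inv (inv g) = (inv g \<otimes> g) \<otimes> x \<otimes> (inv g \<otimes> g)"
    using g x by (simp only: m_assoc inv_closed inv_inv m_closed)
  also have "\<dots> = x" using g x by simp
  finally have "?y \<in> C \<longleftrightarrow> x \<in> C"
    using conj_class_conj[OF C _ g, of x] conj_class_conj[OF C, of ?y "inv g"] g by auto
  then show "(if ?y \<in> C then 1 else 0) = (if x \<in> C then 1 else (0::complex))" by simp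
qed

lemma class_ind_class_rep:
  "C \<in> conj_classes G \<Longrightarrow> D \<in> conj_classes G \<Longrightarrow> class_ind G C (class_rep D) = (if D = C then 1 else 0)"
  by (simp add: class_ind_def class_rep_carrier class_rep_in_iff)

lemma sum_class_ind:
  assumes x: "x \<in> D" and D: "D \<in> conj_classes G"
  shows "(\<Sum>C\<in>conj_classes G. c C * class_ind G C x) = c D"
proof -
  have "(\<Sum>C\<in>conj_classes G. c C * class_ind G C x) = (\<Sum>C\<in>conj_classes G. if C = D then c D else 0)"
    using x conj_class_subset[OF D]
    by (intro sum.cong) (auto simp: class_ind_def dest: conj_classes_eqI[OF _ D _ x])
  then show ?thesis using D finite_conj_classes by simp
qed

lemma class_function_eq_class_ind:
  assumes f: "f \<in> class_functions G"
  shows "f = (\<lambda>x\<in>carrier G. \<Sum>C\<in>conj_classes G. f (class_rep C) * class_ind G C x)"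
proof (rule class_function_eqI[OF f])
  show "(\<lambda>x\<in>carrier G. \<Sum>C\<in>conj_classes G. f (class_rep C) * class_ind G C x) \<in> class_functions G"
    by (rule class_function_combination[OF class_ind_class_function])
  fix x assume x: "x \<in> carrier G"
  then obtain D where D: "D \<in> conj_classes G" "x \<in> D" using Union_conj_classes by blast
  show "f x = (\<lambda>x\<in>carrier G. \<Sum>C\<in>conj_classes G. f (class_rep C) * class_ind G C x) x"
    using x sum_class_ind[OF D(2,1), of "\<lambda>C. f (class_rep C)"]
      class_function_constant[OF f D(1) D(2) class_rep_in[OF D(1)]] by simp
qed

lemma class_ind_mult:
  assumes f: "f \<in> class_functions G" and C: "C \<in> conj_classes G"
  shows "(\<lambda>x\<in>carrier G. f x * class_ind G C x) = (\<lambda>x\<in>carrier G. f (class_rep C) * class_ind G C x)"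
  using class_function_constant[OF f C _ class_rep_in[OF C]]
  by (intro restrict_ext) (auto simp: class_ind_def)

lemma char_on_class_eq:
  assumes \<pi>: "\<pi> \<in> dual G" and C: "C \<in> conj_classes G"
  shows "char_on_class \<pi> C = char_of \<pi> (class_rep C)"
  unfolding char_on_class_def
proof (rule the_elem_image_constant[OF class_rep_in[OF C]])
  fix x assume x: "x \<in> C"
  have "irr_char G \<pi> x = irr_char G \<pi> (class_rep C)"
    by (rule class_function_constant[OF irr_char_class_function[OF \<pi>] C x class_rep_in[OF C]])
  then show "char_of \<pi> x = char_of \<pi> (class_rep C)"
    using x conj_class_subset[OF C] class_rep_carrier[OF C] by (auto simp: irr_char_def)
qed

lemma sum_conj_class_card:
  assumes f: "\<And>C x. C \<in> conj_classes G \<Longrightarrow> x \<in> C \<Longrightarrow> f x = f (class_rep C)"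
  shows "(\<Sum>C\<in>conj_classes G. of_nat (card C) * f (class_rep C)) = (\<Sum>x\<in>carrier G. (f x :: complex))"
  unfolding sum_conj_classes[symmetric]
proof (rule sum.cong)
  fix C assume C: "C \<in> conj_classes G"
  have "(\<Sum>x\<in>C. f x) = (\<Sum>x\<in>C. f (class_rep C))" by (rule sum.cong[OF refl f[OF C]])
  then show "of_nat (card C) * f (class_rep C) = (\<Sum>x\<in>C. f x)" by simp
qed simp

lemma char_coeff_class_ind:
  assumes \<pi>: "\<pi> \<in> dual G" and C: "C \<in> conj_classes G"
  shows "char_coeff G (class_ind G C) \<pi> =
    of_nat (card C) * cnj (char_of \<pi> (class_rep C)) / of_nat (card (carrier G))"
proof -
  have "(\<Sum>x\<in>carrier G. class_ind G C x * cnj (char_of \<pi> x)) = (\<Sum>x\<in>carrier G. if x \<in> C then cnj (char_of \<pi> x) else 0)"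
    by (intro sum.cong) (auto simp: class_ind_def)
  also have "\<dots> = (\<Sum>x\<in>carrier G \<inter> C. cnj (char_of \<pi> x))"
    by (rule sum.inter_restrict[OF fin, symmetric])
  also have "carrier G \<inter> C = C" using conj_class_subset[OF C] by blast
  also have "(\<Sum>x\<in>C. cnj (char_of \<pi> x)) = (\<Sum>x\<in>C. cnj (char_of \<pi> (class_rep C)))"
  proof (rule sum.cong)
    fix x assume x: "x \<in> C"
    have "irr_char G \<pi> x = irr_char G \<pi> (class_rep C)"
      by (rule class_function_constant[OF irr_char_class_function[OF \<pi>] C x class_rep_in[OF C]])
    then show "cnj (char_of \<pi> x) = cnj (char_of \<pi> (class_rep C))"
      using x conj_class_subset[OF C] class_rep_carrier[OF C] by (auto simp: irr_char_def)
  qed simp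
  finally show ?thesis by (simp add: char_coeff_def)
qed

text \<open>Column orthogonality: the character expansion of the indicator function of \<open>C\<close>, taken at a point
  of \<open>C\<close>.\<close>

lemma char_of_column_norm:
  assumes C: "C \<in> conj_classes G"
  shows "(\<Sum>\<pi>\<in>dual G. (cmod (char_of \<pi> (class_rep C)))\<^sup>2) * card C = card (carrier G)"
proof -
  let ?x = "class_rep C"
  note x = class_rep_carrier[OF C]
  have "1 = class_ind G C ?x" using class_ind_class_rep[OF C C] by simp
  also have "\<dots> = (\<Sum>\<pi>\<in>dual G. char_coeff G (class_ind G C) \<pi> * char_of \<pi> ?x)"
    by (rule class_function_expansion[OF class_ind_class_function[OF C] x])
  also have "\<dots> = (\<Sum>\<pi>\<in>dual G. of_real ((cmod (char_of \<pi> ?x))\<^sup>2) * (of_nat (card C) / of_nat (card (carrier G))))"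
    using C by (intro sum.cong refl) (simp add: char_coeff_class_ind complex_norm_square mult_ac del: of_real_power)
  also have "\<dots> = of_real ((\<Sum>\<pi>\<in>dual G. (cmod (char_of \<pi> ?x))\<^sup>2) * (real (card C) / real (card (carrier G))))"
    by (simp only: of_real_mult of_real_sum of_real_divide of_real_of_nat_eq sum_distrib_right)
  finally have "of_real 1 = (of_real ((\<Sum>\<pi>\<in>dual G. (cmod (char_of \<pi> ?x))\<^sup>2) *
      (real (card C) / real (card (carrier G)))) :: complex)" by simp
  then have "1 = (\<Sum>\<pi>\<in>dual G. (cmod (char_of \<pi> ?x))\<^sup>2) * (real (card C) / real (card (carrier G)))"
    by (simp only: of_real_eq_iff)
  then show ?thesis using card_carrier_pos by (simp add: field_simps)
qed

lemma conj_class_one: "{\<one>} \<in> conj_classes G"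
proof -
  have "orbit G (\<lambda>g. \<lambda>h\<in>carrier G. g \<otimes> h \<otimes> inv g) \<one> = {\<one>}"
    by (auto simp: orbit_def intro!: exI[of _ "\<one>"])
  then show ?thesis unfolding conj_classes_def orbits_def using one_closed by blast
qed

lemma sum_degree_square: "(\<Sum>\<pi>\<in>dual G. (real (degree_of G \<pi>))\<^sup>2) = card (carrier G)"
proof -
  have "class_rep {\<one>} = \<one>" using class_rep_in[OF conj_class_one] by simp
  then have "(\<Sum>\<pi>\<in>dual G. (cmod (char_of \<pi> \<one>))\<^sup>2) = card (carrier G)"
    using char_of_column_norm[OF conj_class_one] by simp
  moreover have "(\<Sum>\<pi>\<in>dual G. (cmod (char_of \<pi> \<one>))\<^sup>2) = (\<Sum>\<pi>\<in>dual G. (real (degree_of G \<pi>))\<^sup>2)"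
    by (intro sum.cong) (simp_all add: char_of_one)
  ultimately show ?thesis by simp
qed

lemma dual_conj_involution:
  obtains bar where "bij_betw bar (dual G) (dual G)"
    "\<And>\<pi>. \<pi> \<in> dual G \<Longrightarrow> degree_of G (bar \<pi>) = degree_of G \<pi>"
    "\<And>\<pi> g. \<pi> \<in> dual G \<Longrightarrow> g \<in> carrier G \<Longrightarrow> char_of (bar \<pi>) g = cnj (char_of \<pi> g)"
proof -
  have "\<forall>\<pi>\<in>dual G. \<exists>\<pi>'. \<pi>' \<in> dual G \<and> degree_of G \<pi>' = degree_of G \<pi> \<and>
      (\<forall>g\<in>carrier G. char_of \<pi>' g = cnj (char_of \<pi> g))"
    using dual_obtain_conj by metis
  then obtain bar where bar: "\<And>\<pi>. \<pi> \<in> dual G \<Longrightarrow> bar \<pi> \<in> dual G"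
    "\<And>\<pi>. \<pi> \<in> dual G \<Longrightarrow> degree_of G (bar \<pi>) = degree_of G \<pi>"
    "\<And>\<pi> g. \<pi> \<in> dual G \<Longrightarrow> g \<in> carrier G \<Longrightarrow> char_of (bar \<pi>) g = cnj (char_of \<pi> g)"
    by metis
  have "inj_on bar (dual G)"
  proof (rule inj_onI, rule ccontr)
    fix \<pi> \<pi>' assume \<pi>: "\<pi> \<in> dual G" "\<pi>' \<in> dual G" and eq: "bar \<pi> = bar \<pi>'" and ne: "\<pi> \<noteq> \<pi>'"
    have "char_of \<pi> g = char_of \<pi>' g" if "g \<in> carrier G" for g
      using bar(3)[OF \<pi>(1) that] bar(3)[OF \<pi>(2) that] eq by simp
    then have "(\<Sum>g\<in>carrier G. char_of \<pi> g * cnj (char_of \<pi>' g)) = (\<Sum>g\<in>carrier G. char_of \<pi>' g * cnj (char_of \<pi>' g))"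
      by (intro sum.cong) auto
    then show False
      using char_of_orthogonality[OF \<pi>] char_of_orthogonality[OF \<pi>(2) \<pi>(2)] ne
        card_carrier_pos by simp
  qed
  moreover have "bar ` dual G \<subseteq> dual G" using bar(1) by blast
  ultimately have "bij_betw bar (dual G) (dual G)"
    using endo_inj_surj[OF finite_dual] unfolding bij_betw_def by blast
  with bar(2,3) that show ?thesis by blast
qed

end

section \<open>The diagonal and the amenability constant\<close>

text \<open>The coefficient of \<open>\<chi>\<^sub>\<pi> \<otimes> \<chi>\<^sub>\<pi>\<^sub>'\<close> in \<open>\<Sum>C. 1\<^sub>C \<otimes> 1\<^sub>C\<close>.\<close>

definition diagonal_coeff ::
    "('a, 'b) monoid_scheme \<Rightarrow> ('a \<Rightarrow> complex mat) set \<Rightarrow> ('a \<Rightarrow> complex mat) set \<Rightarrow> complex" where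
  "diagonal_coeff G \<pi> \<pi>' =
     (\<Sum>C\<in>conj_classes G. char_coeff G (class_ind G C) \<pi> * char_coeff G (class_ind G C) \<pi>')"

definition diagonal_tensor :: "('a, 'b) monoid_scheme \<Rightarrow> ('a \<Rightarrow> complex) tensor" where
  "diagonal_tensor G = (\<lambda>F\<in>bounded_bilinear_forms (ZA G). \<Sum>C\<in>conj_classes G. F (class_ind G C) (class_ind G C))"

text \<open>The weighted \<open>\<ell>\<^sup>1\<close>-norm of the coefficients, which turns out to be the projective norm of the
  diagonal.\<close>

definition diagonal_norm :: "('a, 'b) monoid_scheme \<Rightarrow> real" where
  "diagonal_norm G = (\<Sum>\<pi>\<in>dual G. \<Sum>\<pi>'\<in>dual G.
     real (degree_of G \<pi>) * real (degree_of G \<pi>') * cmod (diagonal_coeff G \<pi> \<pi>'))"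

text \<open>In the duality of weighted \<open>\<ell>\<^sup>1\<close> and \<open>\<ell>\<^sup>\<infinity>\<close>, this form attains the norm of the diagonal: it carries the
  weights and the conjugate phases of the coefficients.\<close>

definition norming_form ::
    "('a, 'b) monoid_scheme \<Rightarrow> ('a \<Rightarrow> complex) \<Rightarrow> ('a \<Rightarrow> complex) \<Rightarrow> complex" where
  "norming_form G f h = (\<Sum>\<pi>\<in>dual G. \<Sum>\<pi>'\<in>dual G.
     real (degree_of G \<pi>) * real (degree_of G \<pi>') * cnj (sgn (diagonal_coeff G \<pi> \<pi>')) *
     char_coeff G f \<pi> * char_coeff G h \<pi>')"

context finite_group
begin

lemma cmod_diagonal_coeff:
  assumes \<pi>: "\<pi> \<in> dual G" and \<pi>': "\<pi>' \<in> dual G" and \<sigma>: "\<sigma> \<in> dual G"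
    and bar: "\<And>g. g \<in> carrier G \<Longrightarrow> char_of \<sigma> g = cnj (char_of \<pi>' g)"
  shows "cmod (diagonal_coeff G \<pi> \<sigma>) = cmod (\<Sum>C\<in>conj_classes G.
      of_nat ((card C)\<^sup>2) * char_on_class \<pi> C * cnj (char_on_class \<pi>' C)) / (real (card (carrier G)))\<^sup>2"
proof -
  let ?N = "complex_of_nat (card (carrier G))"
  have "diagonal_coeff G \<pi> \<sigma> = (\<Sum>C\<in>conj_classes G.
      cnj (of_nat ((card C)\<^sup>2) * char_on_class \<pi> C * cnj (char_on_class \<pi>' C)) / ?N\<^sup>2)"
    unfolding diagonal_coeff_def using \<pi> \<pi>' \<sigma>
    by (intro sum.cong refl) (simp add: char_coeff_class_ind char_on_class_eq
        bar class_rep_carrier power2_eq_square)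
  also have "\<dots> = cnj (\<Sum>C\<in>conj_classes G.
      of_nat ((card C)\<^sup>2) * char_on_class \<pi> C * cnj (char_on_class \<pi>' C)) / ?N\<^sup>2"
    by (simp only: cnj_sum sum_divide_distrib)
  finally show ?thesis by (simp only: norm_divide complex_mod_cnj norm_power norm_of_nat)
qed

text \<open>The second index of the coefficients runs through the conjugates of the characters in the formula.\<close>

lemma diagonal_norm_eq:
  "diagonal_norm G = 1 / (real (card (carrier G)))\<^sup>2 *
     (\<Sum>(\<pi>, \<pi>')\<in>dual G \<times> dual G.
        real (degree_of G \<pi>) * real (degree_of G \<pi>') *
        cmod (\<Sum>C\<in>conj_classes G.
                of_nat ((card C)\<^sup>2) * char_on_class \<pi> C * cnj (char_on_class \<pi>' C)))"
proof -
  obtain bar where bar: "bij_betw bar (dual G) (dual G)"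
    "\<And>\<pi>. \<pi> \<in> dual G \<Longrightarrow> degree_of G (bar \<pi>) = degree_of G \<pi>"
    "\<And>\<pi> g. \<pi> \<in> dual G \<Longrightarrow> g \<in> carrier G \<Longrightarrow> char_of (bar \<pi>) g = cnj (char_of \<pi> g)"
    using dual_conj_involution by metis
  let ?t = "\<lambda>\<pi> \<pi>'. real (degree_of G \<pi>) * real (degree_of G \<pi>') * cmod (\<Sum>C\<in>conj_classes G.
      of_nat ((card C)\<^sup>2) * char_on_class \<pi> C * cnj (char_on_class \<pi>' C))"
  have "diagonal_norm G = (\<Sum>\<pi>\<in>dual G. \<Sum>\<pi>'\<in>dual G.
      real (degree_of G \<pi>) * real (degree_of G (bar \<pi>')) * cmod (diagonal_coeff G \<pi> (bar \<pi>')))"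
    unfolding diagonal_norm_def by (intro sum.cong refl sum.reindex_bij_betw[OF bar(1), symmetric])
  also have "\<dots> = (\<Sum>\<pi>\<in>dual G. \<Sum>\<pi>'\<in>dual G. 1 / (real (card (carrier G)))\<^sup>2 * ?t \<pi> \<pi>')"
  proof (intro sum.cong refl)
    fix \<pi> \<pi>' assume \<pi>: "\<pi> \<in> dual G" "\<pi>' \<in> dual G"
    have "bar \<pi>' \<in> dual G" using bar(1) \<pi>(2) by (auto simp: bij_betw_def)
    from cmod_diagonal_coeff[OF \<pi> this bar(3)[OF \<pi>(2)]]
    show "real (degree_of G \<pi>) * real (degree_of G (bar \<pi>')) * cmod (diagonal_coeff G \<pi> (bar \<pi>')) =
      1 / (real (card (carrier G)))\<^sup>2 * ?t \<pi> \<pi>'"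
      by (simp add: bar(2)[OF \<pi>(2)])
  qed
  finally show ?thesis by (simp only: sum_distrib_left sum.cartesian_product case_prod_unfold)
qed

lemma diagonal_tensor_apply:
  assumes F: "bilinear_on_ZA G F"
  shows "diagonal_tensor G F = (\<Sum>C\<in>conj_classes G. F (class_ind G C) (class_ind G C))"
  using F bounded_bilinear_forms_ZA by (simp add: diagonal_tensor_def)

lemma diagonal_tensor_char_expansion:
  assumes F: "bilinear_on_ZA G F"
  shows "diagonal_tensor G F = (\<Sum>\<pi>\<in>dual G. \<Sum>\<pi>'\<in>dual G.
    diagonal_coeff G \<pi> \<pi>' * F (irr_char G \<pi>) (irr_char G \<pi>'))"
proof -
  let ?t = "\<lambda>C \<pi> \<pi>'. char_coeff G (class_ind G C) \<pi> * char_coeff G (class_ind G C) \<pi>' *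
    F (irr_char G \<pi>) (irr_char G \<pi>')"
  have "diagonal_tensor G F = (\<Sum>C\<in>conj_classes G. \<Sum>\<pi>\<in>dual G. \<Sum>\<pi>'\<in>dual G. ?t C \<pi> \<pi>')"
    unfolding diagonal_tensor_apply[OF F]
    by (intro sum.cong refl bilinear_eq_char_combination[OF F] class_ind_class_function)
  also have "\<dots> = (\<Sum>\<pi>\<in>dual G. \<Sum>C\<in>conj_classes G. \<Sum>\<pi>'\<in>dual G. ?t C \<pi> \<pi>')"
    by (rule sum.swap)
  also have "\<dots> = (\<Sum>\<pi>\<in>dual G. \<Sum>\<pi>'\<in>dual G. \<Sum>C\<in>conj_classes G. ?t C \<pi> \<pi>')"
    by (intro sum.cong refl sum.swap)
  finally show ?thesis by (simp only: diagonal_coeff_def sum_distrib_right)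
qed

text \<open>The scalars are absorbed into the first factors of the elementary tensors.\<close>

lemma ZA_finite_tensor:
  fixes c :: "'s \<Rightarrow> complex"
  assumes S: "finite S" and p: "\<And>s. s \<in> S \<Longrightarrow> p s \<in> class_functions G"
    and q: "\<And>s. s \<in> S \<Longrightarrow> q s \<in> class_functions G"
  defines "u \<equiv> (\<lambda>F\<in>bounded_bilinear_forms (ZA G). \<Sum>s\<in>S. c s * F (p s) (q s))"
  shows "u \<in> proj_tensor (ZA G)"
    "proj_norm (ZA G) u \<le> (\<Sum>s\<in>S. ZA_norm G (\<lambda>x\<in>carrier G. c s * p s x) * ZA_norm G (q s))"
proof -
  let ?p = "\<lambda>s. \<lambda>x\<in>carrier G. c s * p s x"
  have u: "u = (\<lambda>F\<in>bounded_bilinear_forms (ZA G). \<Sum>s\<in>S. F (?p s) (q s))"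
    unfolding u_def
  proof (intro restrict_ext sum.cong refl)
    fix F s assume "F \<in> bounded_bilinear_forms (ZA G)" "s \<in> S"
    then show "c s * F (p s) (q s) = F (?p s) (q s)"
      using bilinear_on_ZA_smult(1)[OF _ p q] by (simp only: bounded_bilinear_forms_ZA)
  qed
  have z: "(\<lambda>x\<in>carrier G. 0) \<in> carrier (ZA G)" "nrm (ZA G) (\<lambda>x\<in>carrier G. 0) = 0"
    using class_function_const ZA_norm_zero by simp_all
  have ft: "(\<lambda>F\<in>bounded_bilinear_forms (ZA G). \<Sum>s\<in>S. F (?p s) (q s)) \<in> proj_tensor (ZA G)"
    "proj_norm (ZA G) (\<lambda>F\<in>bounded_bilinear_forms (ZA G). \<Sum>s\<in>S. F (?p s) (q s)) \<le>
      (\<Sum>s\<in>S. nrm (ZA G) (?p s) * nrm (ZA G) (q s))"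
    by (rule finite_tensor[OF S _ _ z];
        use p q class_function_smult ZA_norm_nonneg in simp)+
  then show "u \<in> proj_tensor (ZA G)"
    "proj_norm (ZA G) u \<le> (\<Sum>s\<in>S. ZA_norm G (?p s) * ZA_norm G (q s))"
    unfolding u by simp_all
qed

lemma diagonal_tensor_eq_char:
  "diagonal_tensor G = (\<lambda>F\<in>bounded_bilinear_forms (ZA G). \<Sum>s\<in>dual G \<times> dual G.
    diagonal_coeff G (fst s) (snd s) * F (irr_char G (fst s)) (irr_char G (snd s)))"
proof (rule extensionalityI[of _ "bounded_bilinear_forms (ZA G)"])
  fix F assume F: "F \<in> bounded_bilinear_forms (ZA G)"
  then show "diagonal_tensor G F = (\<lambda>F\<in>bounded_bilinear_forms (ZA G). \<Sum>s\<in>dual G \<times> dual G.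
      diagonal_coeff G (fst s) (snd s) * F (irr_char G (fst s)) (irr_char G (snd s))) F"
    using diagonal_tensor_char_expansion[of F] bounded_bilinear_forms_ZA
    by (simp add: sum.cartesian_product case_prod_unfold)
qed (simp_all add: diagonal_tensor_def)

lemma diagonal_tensor_proj:
  "diagonal_tensor G \<in> proj_tensor (ZA G)" "proj_norm (ZA G) (diagonal_tensor G) \<le> diagonal_norm G"
proof -
  have fd: "finite (dual G \<times> dual G)" using finite_dual by simp
  note ft = ZA_finite_tensor[OF fd, of "\<lambda>s. irr_char G (fst s)" "\<lambda>s. irr_char G (snd s)"
      "\<lambda>s. diagonal_coeff G (fst s) (snd s)"]
  have cf: "irr_char G (fst s) \<in> class_functions G" "irr_char G (snd s) \<in> class_functions G"
    if "s \<in> dual G \<times> dual G" for s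
    using that irr_char_class_function by auto
  show "diagonal_tensor G \<in> proj_tensor (ZA G)"
    unfolding diagonal_tensor_eq_char by (rule ft(1)[OF cf])
  have "proj_norm (ZA G) (diagonal_tensor G) \<le> (\<Sum>s\<in>dual G \<times> dual G.
      ZA_norm G (\<lambda>x\<in>carrier G. diagonal_coeff G (fst s) (snd s) * irr_char G (fst s) x) *
      ZA_norm G (irr_char G (snd s)))"
    unfolding diagonal_tensor_eq_char by (rule ft(2)[OF cf])
  also have "\<dots> = (\<Sum>s\<in>dual G \<times> dual G. real (degree_of G (fst s)) * real (degree_of G (snd s)) *
      cmod (diagonal_coeff G (fst s) (snd s)))"
    by (intro sum.cong refl)
      (auto simp: ZA_norm_smult_irr_char ZA_norm_irr_char)
  also have "\<dots> = diagonal_norm G"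
    by (simp add: diagonal_norm_def sum.cartesian_product case_prod_unfold)
  finally show "proj_norm (ZA G) (diagonal_tensor G) \<le> diagonal_norm G" .
qed

lemma point_form_mem:
  "x \<in> carrier G \<Longrightarrow> y \<in> carrier G \<Longrightarrow> point_form x y \<in> bounded_bilinear_forms (ZA G)"
  by (simp add: bounded_bilinear_forms_ZA point_form_bilinear)

lemma cmod_point_form_le:
  assumes "u \<in> proj_tensor (ZA G)" "x \<in> carrier G" "y \<in> carrier G"
  shows "cmod (u (point_form x y)) \<le> proj_norm (ZA G) u"
  using assms by (intro proj_norm_ge_form point_form_mem) (auto intro: point_form_le)

lemma diagonal_tensor_point_form:
  assumes x: "x \<in> carrier G"
  shows "diagonal_tensor G (point_form x x) = 1"
proof -
  obtain D where D: "D \<in> conj_classes G" "x \<in> D" using Union_conj_classes x by blast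
  have "diagonal_tensor G (point_form x x) = (\<Sum>C\<in>conj_classes G. 1 * class_ind G C x)"
    unfolding diagonal_tensor_apply[OF point_form_bilinear[OF x x]]
    by (intro sum.cong refl) (simp add: point_form_def class_ind_def x)
  also have "\<dots> = 1" by (rule sum_class_ind[OF D(2,1)])
  finally show ?thesis .
qed

lemma one_le_diagonal_norm: "1 \<le> diagonal_norm G"
  using cmod_point_form_le[OF diagonal_tensor_proj(1) one_closed one_closed] diagonal_tensor_proj(2)
  by (simp add: diagonal_tensor_point_form)

lemma left_act_ZA:
  assumes c: "c \<in> class_functions G" and F: "bilinear_on_ZA G F"
  shows "left_act (ZA G) c u F = u (\<lambda>x y. F (\<lambda>v\<in>carrier G. c v * x v) y)"
    "right_act (ZA G) u c F = u (\<lambda>x y. F x (\<lambda>v\<in>carrier G. y v * c v))"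
  using F by (simp_all add: left_act_def right_act_def bounded_bilinear_forms_ZA)

text \<open>A function \<open>c\<close> acts on \<open>1\<^sub>C\<close> by its value on \<open>C\<close>, in both factors, so the commutators vanish; and the
  product \<open>\<Sum>C. 1\<^sub>C\<close> is the unit.\<close>

lemma bounded_approx_diagonal_diagonal_tensor:
  "bounded_approx_diagonal (ZA G) (diagonal_norm G) {i} (\<lambda>_ _. True) (\<lambda>_. diagonal_tensor G)"
proof -
  let ?\<Delta> = "diagonal_tensor G"
  have "proj_norm (ZA G) (tensor_diff (ZA G) (left_act (ZA G) c ?\<Delta>) (right_act (ZA G) ?\<Delta> c)) = 0"
    if c: "c \<in> class_functions G" for c
  proof -
    have "tensor_diff (ZA G) (left_act (ZA G) c ?\<Delta>) (right_act (ZA G) ?\<Delta> c) =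
        (\<lambda>F\<in>bounded_bilinear_forms (ZA G). 0)"
      unfolding tensor_diff_def
    proof (rule restrict_ext)
      fix F assume "F \<in> bounded_bilinear_forms (ZA G)"
      then have F: "bilinear_on_ZA G F" by (simp add: bounded_bilinear_forms_ZA)
      have "F (\<lambda>v\<in>carrier G. c v * class_ind G C v) (class_ind G C) =
          F (class_ind G C) (\<lambda>v\<in>carrier G. class_ind G C v * c v)" if C: "C \<in> conj_classes G" for C
        unfolding mult.commute[of "class_ind G C _"] class_ind_mult[OF c C]
        using class_ind_class_function[OF C] by (simp only: bilinear_on_ZA_smult[OF F])
      then have "(\<Sum>C\<in>conj_classes G. F (\<lambda>v\<in>carrier G. c v * class_ind G C v) (class_ind G C)) =
          (\<Sum>C\<in>conj_classes G. F (class_ind G C) (\<lambda>v\<in>carrier G. class_ind G C v * c v))"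
        by (rule sum.cong[OF refl])
      then show "left_act (ZA G) c ?\<Delta> F - right_act (ZA G) ?\<Delta> c F = 0"
        unfolding left_act_ZA[OF c F] diagonal_tensor_apply[OF bilinear_on_ZA_mult(1)[OF F c]]
          diagonal_tensor_apply[OF bilinear_on_ZA_mult(2)[OF F c]] by simp
    qed
    then show ?thesis
      using proj_norm_zero[of "\<lambda>x\<in>carrier G. 0" "ZA G"] class_function_const
        ZA_norm_zero ZA_norm_nonneg by simp
  qed
  moreover have "nrm (ZA G) (tensor_mult (ZA G) ?\<Delta> \<otimes>\<^bsub>ZA G\<^esub> c \<ominus>\<^bsub>ZA G\<^esub> c) = 0"
    if c: "c \<in> class_functions G" for c
  proof -
    have "tensor_mult (ZA G) ?\<Delta> \<otimes>\<^bsub>ZA G\<^esub> c = c"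
    proof (rule class_function_eqI[OF _ c])
      have eq: "tensor_mult (ZA G) ?\<Delta> = (\<lambda>x\<in>carrier G. 1)"
        unfolding tensor_mult_ZA[OF diagonal_tensor_proj(1)]
        by (intro restrict_ext diagonal_tensor_point_form)
      show "tensor_mult (ZA G) ?\<Delta> \<otimes>\<^bsub>ZA G\<^esub> c \<in> class_functions G"
        unfolding eq ZA_simps by (rule class_function_mult[OF class_function_const c])
      show "(tensor_mult (ZA G) ?\<Delta> \<otimes>\<^bsub>ZA G\<^esub> c) x = c x" if "x \<in> carrier G" for x
        unfolding eq using that by simp
    qed
    then show ?thesis
      using ZA_minus[OF c c] ZA_norm_zero by simp
  qed
  ultimately show ?thesis
    using diagonal_tensor_proj
    by (simp add: bounded_approx_diagonal_def directed_set_def net_null_def)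
qed

lemma norming_form_bilinear: "bilinear_on_ZA G (norming_form G)"
  unfolding bilinear_on_ZA_def norming_form_def char_coeff_add char_coeff_smult
  by (simp add: algebra_simps sum.distrib sum_distrib_left)

lemma norming_form_le:
  assumes f: "f \<in> class_functions G" and h: "h \<in> class_functions G"
  shows "cmod (norming_form G f h) \<le> ZA_norm G f * ZA_norm G h"
proof -
  have "cmod (norming_form G f h) \<le> (\<Sum>\<pi>\<in>dual G. \<Sum>\<pi>'\<in>dual G.
      cmod (real (degree_of G \<pi>) * real (degree_of G \<pi>') * cnj (sgn (diagonal_coeff G \<pi> \<pi>')) *
        char_coeff G f \<pi> * char_coeff G h \<pi>'))"
    unfolding norming_form_def by (intro order_trans[OF norm_sum] sum_mono norm_sum)
  also have "\<dots> \<le> (\<Sum>\<pi>\<in>dual G. \<Sum>\<pi>'\<in>dual G. (real (degree_of G \<pi>) * cmod (char_coeff G f \<pi>)) *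
      (real (degree_of G \<pi>') * cmod (char_coeff G h \<pi>')))"
  proof (intro sum_mono)
    fix \<pi> \<pi>'
    let ?A = "(real (degree_of G \<pi>) * cmod (char_coeff G f \<pi>)) *
      (real (degree_of G \<pi>') * cmod (char_coeff G h \<pi>'))"
    have "cmod (real (degree_of G \<pi>) * real (degree_of G \<pi>') * cnj (sgn (diagonal_coeff G \<pi> \<pi>')) *
        char_coeff G f \<pi> * char_coeff G h \<pi>') = ?A * cmod (sgn (diagonal_coeff G \<pi> \<pi>'))"
      by (simp add: norm_mult)
    also have "\<dots> \<le> ?A * 1"
      by (intro mult_left_mono) (auto simp: norm_sgn)
    finally show "cmod (real (degree_of G \<pi>) * real (degree_of G \<pi>') * cnj (sgn (diagonal_coeff G \<pi> \<pi>')) *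
        char_coeff G f \<pi> * char_coeff G h \<pi>') \<le> ?A" by simp
  qed
  also have "\<dots> = ZA_norm G f * ZA_norm G h"
    by (simp add: ZA_norm_eq[OF f] ZA_norm_eq[OF h] sum_product)
  finally show ?thesis .
qed

lemma char_coeff_irr_char:
  assumes "\<pi> \<in> dual G" "\<rho> \<in> dual G"
  shows "char_coeff G (irr_char G \<pi>) \<rho> = (if \<rho> = \<pi> then 1 else 0)"
proof -
  have "char_coeff G (irr_char G \<pi>) \<rho> =
      (\<Sum>x\<in>carrier G. char_of \<pi> x * cnj (char_of \<rho> x)) / of_nat (card (carrier G))"
    by (simp add: char_coeff_def irr_char_def)
  then show ?thesis
    using char_of_orthogonality[OF assms] card_carrier_pos by simp
qed

lemma norming_form_irr_char:
  assumes "\<pi> \<in> dual G" "\<pi>' \<in> dual G"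
  shows "norming_form G (irr_char G \<pi>) (irr_char G \<pi>') =
    real (degree_of G \<pi>) * real (degree_of G \<pi>') * cnj (sgn (diagonal_coeff G \<pi> \<pi>'))"
proof -
  have "norming_form G (irr_char G \<pi>) (irr_char G \<pi>') = (\<Sum>\<rho>\<in>dual G. \<Sum>\<rho>'\<in>dual G.
      if \<rho>' = \<pi>' then (if \<rho> = \<pi> then real (degree_of G \<pi>) * real (degree_of G \<pi>') *
        cnj (sgn (diagonal_coeff G \<pi> \<pi>')) else 0) else 0)"
    unfolding norming_form_def using assms
    by (intro sum.cong refl) (simp add: char_coeff_irr_char)
  then show ?thesis using assms finite_dual by simp
qed

lemma diagonal_tensor_norming_form: "diagonal_tensor G (norming_form G) = diagonal_norm G"
proof -
  have sgn: "z * cnj (sgn z) = complex_of_real (cmod z)" for z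
  proof -
    have "z * cnj (sgn z) = of_real ((cmod z)\<^sup>2) / of_real (cmod z)"
      unfolding complex_norm_square by (simp add: sgn_eq)
    then show ?thesis by (simp add: power2_eq_square)
  qed
  have "diagonal_coeff G \<pi> \<pi>' * norming_form G (irr_char G \<pi>) (irr_char G \<pi>') =
      real (degree_of G \<pi>) * real (degree_of G \<pi>') * cmod (diagonal_coeff G \<pi> \<pi>')"
    if "\<pi> \<in> dual G" "\<pi>' \<in> dual G" for \<pi> \<pi>'
    using that by (simp add: norming_form_irr_char mult.left_commute[of "diagonal_coeff G \<pi> \<pi>'"] sgn)
  then show ?thesis
    by (simp add: diagonal_tensor_char_expansion[OF norming_form_bilinear] diagonal_norm_def)
qed

text \<open>Expansion of a tensor in the basis \<open>1\<^sub>C \<otimes> 1\<^sub>D\<close>; its coefficients are the values at pairs of points.\<close>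

lemma proj_tensor_class_expansion:
  assumes u: "u \<in> proj_tensor (ZA G)" and F: "bilinear_on_ZA G F"
  shows "u F = (\<Sum>s\<in>conj_classes G \<times> conj_classes G. F (class_ind G (fst s)) (class_ind G (snd s)) *
    u (point_form (class_rep (fst s)) (class_rep (snd s))))"
proof (rule proj_tensor_combination[OF u])
  show "finite (conj_classes G \<times> conj_classes G)" using finite_conj_classes by simp
  show "F \<in> bounded_bilinear_forms (ZA G)" using F by (simp add: bounded_bilinear_forms_ZA)
  show "point_form (class_rep (fst s)) (class_rep (snd s)) \<in> bounded_bilinear_forms (ZA G)"
    if "s \<in> conj_classes G \<times> conj_classes G" for s
    using that by (intro point_form_mem class_rep_carrier) auto
  fix x y assume "x \<in> carrier (ZA G)" "y \<in> carrier (ZA G)"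
  then have x: "x \<in> class_functions G" and y: "y \<in> class_functions G" by simp_all
  note fc = finite_conj_classes and ci = class_ind_class_function
  have "F (\<lambda>v\<in>carrier G. \<Sum>C\<in>conj_classes G. x (class_rep C) * class_ind G C v)
      (\<lambda>v\<in>carrier G. \<Sum>C\<in>conj_classes G. y (class_rep C) * class_ind G C v) =
    (\<Sum>C\<in>conj_classes G. \<Sum>D\<in>conj_classes G.
      x (class_rep C) * y (class_rep D) * F (class_ind G C) (class_ind G D))"
    by (rule bilinear_combination[OF F fc ci fc ci])
  then have "F x y = (\<Sum>C\<in>conj_classes G. \<Sum>D\<in>conj_classes G.
      x (class_rep C) * y (class_rep D) * F (class_ind G C) (class_ind G D))"
    by (simp only: class_function_eq_class_ind[OF x, symmetric] class_function_eq_class_ind[OF y, symmetric])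
  then show "F x y = (\<Sum>s\<in>conj_classes G \<times> conj_classes G. F (class_ind G (fst s)) (class_ind G (snd s)) *
      point_form (class_rep (fst s)) (class_rep (snd s)) x y)"
    by (simp add: sum.cartesian_product case_prod_unfold point_form_def mult_ac)
qed

lemma tensor_commutator_eq:
  assumes u: "u \<in> proj_tensor (ZA G)" and c: "c \<in> class_functions G"
  shows "tensor_diff (ZA G) (left_act (ZA G) c u) (right_act (ZA G) u c) =
    (\<lambda>F\<in>bounded_bilinear_forms (ZA G). \<Sum>s\<in>conj_classes G \<times> conj_classes G.
      (c (class_rep (fst s)) - c (class_rep (snd s))) *
        u (point_form (class_rep (fst s)) (class_rep (snd s))) *
      F (class_ind G (fst s)) (class_ind G (snd s)))"
  unfolding tensor_diff_def
proof (rule restrict_ext)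
  fix F assume "F \<in> bounded_bilinear_forms (ZA G)"
  then have F: "bilinear_on_ZA G F" by (simp add: bounded_bilinear_forms_ZA)
  let ?S = "conj_classes G \<times> conj_classes G"
  let ?w = "\<lambda>s. u (point_form (class_rep (fst s)) (class_rep (snd s)))"
  let ?F = "\<lambda>s. F (class_ind G (fst s)) (class_ind G (snd s))"
  have "left_act (ZA G) c u F = (\<Sum>s\<in>?S. F (\<lambda>v\<in>carrier G. c v * class_ind G (fst s) v) (class_ind G (snd s)) * ?w s)"
    unfolding left_act_ZA[OF c F] by (rule proj_tensor_class_expansion[OF u bilinear_on_ZA_mult(1)[OF F c]])
  also have "\<dots> = (\<Sum>s\<in>?S. c (class_rep (fst s)) * ?F s * ?w s)"
  proof (rule sum.cong)
    fix s assume "s \<in> ?S"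
    then have s: "fst s \<in> conj_classes G" "snd s \<in> conj_classes G" by auto
    show "F (\<lambda>v\<in>carrier G. c v * class_ind G (fst s) v) (class_ind G (snd s)) * ?w s =
        c (class_rep (fst s)) * ?F s * ?w s"
      unfolding class_ind_mult[OF c s(1)]
      by (simp only: bilinear_on_ZA_smult(1)[OF F class_ind_class_function[OF s(1)]
            class_ind_class_function[OF s(2)]])
  qed simp
  finally have l: "left_act (ZA G) c u F = (\<Sum>s\<in>?S. c (class_rep (fst s)) * ?F s * ?w s)" .
  have "right_act (ZA G) u c F = (\<Sum>s\<in>?S. F (class_ind G (fst s)) (\<lambda>v\<in>carrier G. class_ind G (snd s) v * c v) * ?w s)"
    unfolding left_act_ZA[OF c F] by (rule proj_tensor_class_expansion[OF u bilinear_on_ZA_mult(2)[OF F c]])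
  also have "\<dots> = (\<Sum>s\<in>?S. c (class_rep (snd s)) * ?F s * ?w s)"
  proof (rule sum.cong)
    fix s assume "s \<in> ?S"
    then have s: "fst s \<in> conj_classes G" "snd s \<in> conj_classes G" by auto
    show "F (class_ind G (fst s)) (\<lambda>v\<in>carrier G. class_ind G (snd s) v * c v) * ?w s =
        c (class_rep (snd s)) * ?F s * ?w s"
      unfolding mult.commute[of "class_ind G (snd s) _"] class_ind_mult[OF c s(2)]
      by (simp only: bilinear_on_ZA_smult(2)[OF F class_ind_class_function[OF s(2)]
            class_ind_class_function[OF s(1)]])
  qed simp
  finally have r: "right_act (ZA G) u c F = (\<Sum>s\<in>?S. c (class_rep (snd s)) * ?F s * ?w s)" .
  show "left_act (ZA G) c u F - right_act (ZA G) u c F =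
      (\<Sum>s\<in>?S. (c (class_rep (fst s)) - c (class_rep (snd s))) * ?w s * ?F s)"
    unfolding l r sum_subtractf[symmetric] by (intro sum.cong refl) (simp add: algebra_simps)
qed

text \<open>Commutation with \<open>1\<^sub>C\<close> controls the coefficients off the diagonal.\<close>

lemma commutator_norm_ge:
  assumes u: "u \<in> proj_tensor (ZA G)" and C: "C \<in> conj_classes G" and D: "D \<in> conj_classes G"
    and ne: "C \<noteq> D"
  shows "cmod (u (point_form (class_rep C) (class_rep D))) \<le> proj_norm (ZA G)
    (tensor_diff (ZA G) (left_act (ZA G) (class_ind G C) u) (right_act (ZA G) u (class_ind G C)))"
    (is "_ \<le> proj_norm _ ?d")
proof -
  let ?S = "conj_classes G \<times> conj_classes G"
  let ?w = "\<lambda>s. u (point_form (class_rep (fst s)) (class_rep (snd s)))"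
  let ?c = "class_ind G C"
  have S: "finite ?S" using finite_conj_classes by simp
  note ci = class_ind_class_function and rc = class_rep_carrier
  note d = tensor_commutator_eq[OF u ci[OF C]]
  have "?d \<in> proj_tensor (ZA G)"
    unfolding d by (rule ZA_finite_tensor(1)[OF S]) (auto intro: ci)
  then have "cmod (?d (point_form (class_rep C) (class_rep D))) \<le> proj_norm (ZA G) ?d"
    using rc[OF C] rc[OF D] by (rule cmod_point_form_le)
  also have "?d (point_form (class_rep C) (class_rep D)) = (\<Sum>s\<in>?S.
      (?c (class_rep (fst s)) - ?c (class_rep (snd s))) * ?w s *
      point_form (class_rep C) (class_rep D) (class_ind G (fst s)) (class_ind G (snd s)))"
    unfolding d using point_form_mem[OF rc[OF C] rc[OF D]] by simp
  also have "\<dots> = (\<Sum>s\<in>?S. if s = (C, D) then ?w (C, D) else 0)"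
  proof (rule sum.cong)
    fix s assume "s \<in> ?S"
    then have s: "fst s \<in> conj_classes G" "snd s \<in> conj_classes G" by auto
    show "(?c (class_rep (fst s)) - ?c (class_rep (snd s))) * ?w s *
        point_form (class_rep C) (class_rep D) (class_ind G (fst s)) (class_ind G (snd s)) =
        (if s = (C, D) then ?w (C, D) else 0)"
      using s C D ne by (cases s) (auto simp: point_form_def class_ind_class_rep)
  qed simp
  also have "\<dots> = u (point_form (class_rep C) (class_rep D))" using S C D by simp
  finally show ?thesis .
qed

text \<open>The product controls the coefficients on the diagonal.\<close>

lemma unit_defect_norm_ge:
  assumes u: "u \<in> proj_tensor (ZA G)" and x: "x \<in> carrier G"
  shows "cmod (u (point_form x x) - 1) \<le>
    nrm (ZA G) (tensor_mult (ZA G) u \<otimes>\<^bsub>ZA G\<^esub> \<one>\<^bsub>ZA G\<^esub> \<ominus>\<^bsub>ZA G\<^esub> \<one>\<^bsub>ZA G\<^esub>)"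
proof -
  let ?m = "tensor_mult (ZA G) u"
  have m: "?m \<in> class_functions G"
  proof -
    have "u (point_form (g \<otimes> y \<otimes> inv g) (g \<otimes> y \<otimes> inv g)) = u (point_form y y)"
      if "g \<in> carrier G" "y \<in> carrier G" for g y
      using proj_tensor_combination[OF u, of "{()}" _ "\<lambda>_. point_form y y" "\<lambda>_. 1",
          OF _ point_form_mem point_form_mem, of "g \<otimes> y \<otimes> inv g" "g \<otimes> y \<otimes> inv g"] that
      by (simp add: point_form_def class_function_conj)
    then show ?thesis
      unfolding tensor_mult_ZA[OF u] by (intro class_function_restrictI)
  qed
  let ?o = "\<lambda>x\<in>carrier G. 1 :: complex"
  have o: "?o \<in> class_functions G" by (rule class_function_const)
  have mo: "(\<lambda>x\<in>carrier G. ?m x * ?o x) \<in> class_functions G" by (rule class_function_mult[OF m o])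
  let ?e = "?m \<otimes>\<^bsub>ZA G\<^esub> \<one>\<^bsub>ZA G\<^esub> \<ominus>\<^bsub>ZA G\<^esub> \<one>\<^bsub>ZA G\<^esub>"
  have e: "?e = (\<lambda>x\<in>carrier G. (\<lambda>x\<in>carrier G. ?m x * ?o x) x - ?o x)"
    unfolding ZA_simps(2,3) by (rule ZA_minus[OF mo o])
  have "?e \<in> class_functions G"
    unfolding e using mo o by (intro class_function_restrictI) (simp only: class_function_conj)
  from cmod_le_ZA_norm[OF this x] show ?thesis
    unfolding e using x by (simp add: tensor_mult_ZA[OF u])
qed

text \<open>Far out in the net the coefficients in the basis \<open>1\<^sub>C \<otimes> 1\<^sub>D\<close> are close to those of the diagonal, so
  that the value at the norming form is close to \<open>diagonal_norm\<close>; this value is at most \<open>M\<close>.\<close>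

lemma diagonal_norm_le_bound:
  assumes bad: "bounded_approx_diagonal (ZA G) M I rel d"
  shows "diagonal_norm G \<le> M"
proof (rule field_le_epsilon)
  fix e :: real assume e: "e > 0"
  let ?cc = "conj_classes G"
  let ?S = "?cc \<times> ?cc"
  let ?F = "\<lambda>s. norming_form G (class_ind G (fst s)) (class_ind G (snd s))"
  define B where "B = (\<Sum>s\<in>?S. cmod (?F s))"
  have B: "B \<ge> 0" by (simp add: B_def sum_nonneg)
  \<comment> \<open>The summand \<open>1\<close> covers the case \<open>B = 0\<close>.\<close>
  define \<epsilon> where "\<epsilon> = e / (B + 1)"
  have \<epsilon>: "\<epsilon> > 0" and B\<epsilon>: "B * \<epsilon> \<le> e"
    using e B by (simp_all add: \<epsilon>_def field_simps)
  \<comment> \<open>\<open>None\<close> stands for the defect of the unit, \<open>Some C\<close> for the commutator with the indicator of \<open>C\<close>.\<close>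
  define def where "def s i = (case s of
      None \<Rightarrow> nrm (ZA G) (tensor_mult (ZA G) (d i) \<otimes>\<^bsub>ZA G\<^esub> \<one>\<^bsub>ZA G\<^esub> \<ominus>\<^bsub>ZA G\<^esub> \<one>\<^bsub>ZA G\<^esub>)
    | Some C \<Rightarrow> proj_norm (ZA G) (tensor_diff (ZA G) (left_act (ZA G) (class_ind G C) (d i))
        (right_act (ZA G) (d i) (class_ind G C))))" for s i
  have dir: "directed_set I rel"
    and d: "\<And>i. i \<in> I \<Longrightarrow> d i \<in> proj_tensor (ZA G)" "\<And>i. i \<in> I \<Longrightarrow> proj_norm (ZA G) (d i) \<le> M"
    and null: "\<And>x. x \<in> carrier (ZA G) \<Longrightarrow>
        net_null I rel (\<lambda>i. proj_norm (ZA G) (tensor_diff (ZA G) (left_act (ZA G) x (d i)) (right_act (ZA G) (d i) x)))"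
      "\<And>x. x \<in> carrier (ZA G) \<Longrightarrow>
        net_null I rel (\<lambda>i. nrm (ZA G) (tensor_mult (ZA G) (d i) \<otimes>\<^bsub>ZA G\<^esub> x \<ominus>\<^bsub>ZA G\<^esub> x))"
    using bad unfolding bounded_approx_diagonal_def by blast+
  have "\<exists>i\<in>I. \<forall>s\<in>insert None (Some ` ?cc). \<bar>def s i\<bar> < \<epsilon>"
  proof (rule net_null_common_index[OF dir _ _ \<epsilon>])
    show "finite (insert None (Some ` ?cc))" using finite_conj_classes by simp
    fix s assume s: "s \<in> insert None (Some ` ?cc)"
    show "net_null I rel (def s)"
    proof (cases s)
      case None
      have "\<one>\<^bsub>ZA G\<^esub> \<in> carrier (ZA G)" using class_function_const by simp
      moreover have "def None = (\<lambda>i. nrm (ZA G) (tensor_mult (ZA G) (d i) \<otimes>\<^bsub>ZA G\<^esub> \<one>\<^bsub>ZA G\<^esub> \<ominus>\<^bsub>ZA G\<^esub> \<one>\<^bsub>ZA G\<^esub>))"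
        by (rule ext) (simp only: def_def option.case)
      ultimately show ?thesis using null(2) by (simp only: None)
    next
      case (Some C)
      then have "class_ind G C \<in> carrier (ZA G)" using s class_ind_class_function by auto
      moreover have "def (Some C) = (\<lambda>i. proj_norm (ZA G) (tensor_diff (ZA G)
          (left_act (ZA G) (class_ind G C) (d i)) (right_act (ZA G) (d i) (class_ind G C))))"
        by (rule ext) (simp only: def_def option.case)
      ultimately show ?thesis using null(1) by (simp only: Some)
    qed
  qed
  then obtain i where i: "i \<in> I" and small: "\<And>s. s \<in> insert None (Some ` ?cc) \<Longrightarrow> \<bar>def s i\<bar> < \<epsilon>"
    by blast
  let ?u = "d i"
  have u: "?u \<in> proj_tensor (ZA G)" by (rule d(1)[OF i])
  let ?w = "\<lambda>s. ?u (point_form (class_rep (fst s)) (class_rep (snd s)))"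
  have close: "cmod (?w s - (if fst s = snd s then 1 else 0)) \<le> \<epsilon>" if s: "s \<in> ?S" for s
  proof (cases "fst s = snd s")
    case True
    then have "class_rep (snd s) \<in> carrier G" using s class_rep_carrier by auto
    from unit_defect_norm_ge[OF u this] have "cmod (?w s - 1) \<le> def None i"
      by (simp only: True def_def option.case)
    moreover have "\<bar>def None i\<bar> < \<epsilon>" by (rule small) simp
    ultimately have "cmod (?w s - 1) \<le> \<epsilon>" by linarith
    then show ?thesis by (simp add: True)
  next
    case False
    then have "cmod (?w s) \<le> def (Some (fst s)) i"
      using commutator_norm_ge[OF u, of "fst s" "snd s"] s by (auto simp: def_def)
    with small[of "Some (fst s)"] False s show ?thesis by (auto simp: mem_Times_iff)
  qed
  have "complex_of_real (diagonal_norm G) = (\<Sum>C\<in>?cc. norming_form G (class_ind G C) (class_ind G C))"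
    using diagonal_tensor_norming_form diagonal_tensor_apply[OF norming_form_bilinear] by simp
  also have "\<dots> = (\<Sum>C\<in>?cc. \<Sum>D\<in>?cc. if C = D then norming_form G (class_ind G C) (class_ind G D) else 0)"
    using finite_conj_classes by simp
  also have "\<dots> = (\<Sum>s\<in>?S. ?F s * (if fst s = snd s then 1 else 0))"
    unfolding sum.cartesian_product by (rule sum.cong[OF refl]) (simp add: case_prod_unfold)
  finally have "complex_of_real (diagonal_norm G) - ?u (norming_form G) =
      (\<Sum>s\<in>?S. ?F s * (if fst s = snd s then 1 else 0)) - (\<Sum>s\<in>?S. ?F s * ?w s)"
    by (simp only: proj_tensor_class_expansion[OF u norming_form_bilinear])
  also have "\<dots> = - (\<Sum>s\<in>?S. ?F s * (?w s - (if fst s = snd s then 1 else 0)))"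
    by (simp only: sum_subtractf[symmetric] sum_negf[symmetric] right_diff_distrib minus_diff_eq)
  finally have "cmod (complex_of_real (diagonal_norm G) - ?u (norming_form G)) \<le>
      (\<Sum>s\<in>?S. cmod (?F s * (?w s - (if fst s = snd s then 1 else 0))))"
    by (simp only: norm_minus_cancel norm_sum)
  also have "\<dots> \<le> (\<Sum>s\<in>?S. cmod (?F s) * \<epsilon>)"
    unfolding norm_mult by (intro sum_mono mult_left_mono close) auto
  also have "\<dots> = B * \<epsilon>" by (simp add: B_def sum_distrib_right)
  finally have "cmod (complex_of_real (diagonal_norm G) - ?u (norming_form G)) \<le> e" using B\<epsilon> by linarith
  moreover have "cmod (?u (norming_form G)) \<le> proj_norm (ZA G) ?u"
    by (rule proj_norm_ge_form[OF u])
      (use norming_form_bilinear norming_form_le in \<open>simp_all add: bounded_bilinear_forms_ZA\<close>)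
  moreover have "diagonal_norm G \<le> cmod (complex_of_real (diagonal_norm G))" by simp
  moreover have "cmod (complex_of_real (diagonal_norm G)) \<le>
      cmod (complex_of_real (diagonal_norm G) - ?u (norming_form G)) + cmod (?u (norming_form G))"
    by (metis norm_triangle_sub add.commute)
  ultimately show "diagonal_norm G \<le> M + e" using d(2)[OF i] by linarith
qed

lemma amenability_constant_ZA: "amenability_constant (ZA G) = ereal (diagonal_norm G)"
  unfolding amenability_constant_def
proof (rule antisym)
  let ?X = "{ereal M | M. M > 0 \<and> (\<exists>(I :: (('a \<Rightarrow> complex) tensor \<times> ('a \<Rightarrow> complex) tensor set) set) rel d.
    bounded_approx_diagonal (ZA G) M I rel d)}"
  have "ereal (diagonal_norm G) \<in> ?X"
  proof (intro CollectI exI conjI)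
    show "0 < diagonal_norm G" using one_le_diagonal_norm by simp
  qed (rule refl, rule bounded_approx_diagonal_diagonal_tensor)
  then show "Inf ?X \<le> ereal (diagonal_norm G)" by (rule Inf_lower)
  show "ereal (diagonal_norm G) \<le> Inf ?X"
    by (rule Inf_greatest) (auto dest: diagonal_norm_le_bound)
qed

lemma diagonal_norm_comm:
  assumes comm: "comm_group G"
  shows "diagonal_norm G = 1"
proof -
  interpret comm_group G by (rule comm)
  let ?N = "card (carrier G)"
  have N: "?N > 0" by (rule card_carrier_pos)
  have card1: "card C = 1" if C: "C \<in> conj_classes G" for C
  proof -
    obtain x where x: "x \<in> carrier G" "C = (\<lambda>g. g \<otimes> x \<otimes> inv g) ` carrier G"
      using conj_classes_obtain[OF C] by metis
    have "g \<otimes> x \<otimes> inv g = x" if "g \<in> carrier G" for g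
      using that x(1) by (simp add: m_comm[of g x] m_assoc)
    then have "C = (\<lambda>g. x) ` carrier G" unfolding x(2) by (intro image_cong) auto
    then have "C = {x}" by auto
    then show ?thesis by simp
  qed
  have "(\<Sum>C\<in>conj_classes G. of_nat ((card C)\<^sup>2) * char_on_class \<pi> C * cnj (char_on_class \<pi>' C)) =
      (if \<pi> = \<pi>' then of_nat ?N else 0)" if \<pi>: "\<pi> \<in> dual G" "\<pi>' \<in> dual G" for \<pi> \<pi>'
  proof -
    have "(\<Sum>C\<in>conj_classes G. of_nat ((card C)\<^sup>2) * char_on_class \<pi> C * cnj (char_on_class \<pi>' C)) =
        (\<Sum>C\<in>conj_classes G. of_nat (card C) * (char_of \<pi> (class_rep C) * cnj (char_of \<pi>' (class_rep C))))"
      using \<pi> by (intro sum.cong refl) (simp add: card1 char_on_class_eq)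
    also have "\<dots> = (\<Sum>x\<in>carrier G. char_of \<pi> x * cnj (char_of \<pi>' x))"
    proof (rule sum_conj_class_card)
      fix C x assume C: "C \<in> conj_classes G" and x: "x \<in> C"
      obtain y where "C = {y}" using card1[OF C] card_1_singletonE by metis
      then have "x = class_rep C" using x class_rep_in[OF C] by simp
      then show "char_of \<pi> x * cnj (char_of \<pi>' x) = char_of \<pi> (class_rep C) * cnj (char_of \<pi>' (class_rep C))"
        by simp
    qed
    also have "\<dots> = (if \<pi> = \<pi>' then of_nat ?N else 0)" by (rule char_of_orthogonality[OF \<pi>])
    finally show ?thesis .
  qed
  then have "(\<Sum>(\<pi>, \<pi>')\<in>dual G \<times> dual G. real (degree_of G \<pi>) * real (degree_of G \<pi>') *
      cmod (\<Sum>C\<in>conj_classes G. of_nat ((card C)\<^sup>2) * char_on_class \<pi> C * cnj (char_on_class \<pi>' C))) =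
      (\<Sum>\<pi>\<in>dual G. \<Sum>\<pi>'\<in>dual G. if \<pi> = \<pi>' then (real (degree_of G \<pi>))\<^sup>2 * real ?N else 0)"
    unfolding sum.cartesian_product[symmetric]
    by (intro sum.cong refl) (simp add: power2_eq_square)
  also have "\<dots> = (\<Sum>\<pi>\<in>dual G. (real (degree_of G \<pi>))\<^sup>2) * real ?N"
    using finite_dual by (simp add: sum_distrib_right)
  also have "\<dots> = (real ?N)\<^sup>2"
    unfolding sum_degree_square by (simp add: power2_eq_square)
  finally show ?thesis unfolding diagonal_norm_eq using N by simp
qed

text \<open>The value of the diagonal at \<open>(x, x)\<close> is \<open>1\<close>. Each term of its expansion is at most the term with
  degrees in place of characters, in absolute value, and the latter terms also sum to \<open>1\<close>; so no
  term changes. The coefficient at \<open>\<pi>\<close> and its conjugate is not \<open>0\<close>, being up to a factor a sum of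
  squares in which the class of the identity contributes.\<close>

lemma diagonal_norm_eq_1_char:
  assumes one: "diagonal_norm G = 1" and \<pi>: "\<pi> \<in> dual G" and x: "x \<in> carrier G"
  shows "cmod (char_of \<pi> x) = real (degree_of G \<pi>)"
proof -
  obtain bar where bar: "bij_betw bar (dual G) (dual G)"
    "\<And>\<pi>. \<pi> \<in> dual G \<Longrightarrow> degree_of G (bar \<pi>) = degree_of G \<pi>"
    "\<And>\<pi> g. \<pi> \<in> dual G \<Longrightarrow> g \<in> carrier G \<Longrightarrow> char_of (bar \<pi>) g = cnj (char_of \<pi> g)"
    using dual_conj_involution by metis
  have bar_dual: "bar \<pi> \<in> dual G" using bar(1) \<pi> by (auto simp: bij_betw_def)
  let ?S = "dual G \<times> dual G"
  define a where "a s = cmod (diagonal_coeff G (fst s) (snd s))" for s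
  define p where "p s = a s * (real (degree_of G (fst s)) * real (degree_of G (snd s)))" for s
  define q where "q s = a s * (cmod (char_of (fst s) x) * cmod (char_of (snd s) x))" for s
  have S: "finite ?S" using finite_dual by simp
  have qp: "q s \<le> p s" if "s \<in> ?S" for s
    unfolding p_def q_def using that char_of_bound[OF _ x]
    by (intro mult_left_mono mult_mono) (auto simp: a_def)
  have "sum p ?S = 1"
    using one unfolding diagonal_norm_def sum.cartesian_product
    by (simp add: p_def a_def case_prod_unfold mult_ac)
  moreover have "1 \<le> sum q ?S"
  proof -
    have "1 = cmod (diagonal_tensor G (point_form x x))" by (simp add: diagonal_tensor_point_form[OF x])
    also have "diagonal_tensor G (point_form x x) =
        (\<Sum>s\<in>?S. diagonal_coeff G (fst s) (snd s) * (char_of (fst s) x * char_of (snd s) x))"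
      unfolding diagonal_tensor_char_expansion[OF point_form_bilinear[OF x x]]
      using x by (simp add: sum.cartesian_product case_prod_unfold point_form_def irr_char_def)
    also have "cmod \<dots> \<le> (\<Sum>s\<in>?S. cmod (diagonal_coeff G (fst s) (snd s) * (char_of (fst s) x * char_of (snd s) x)))"
      by (rule norm_sum)
    also have "\<dots> = sum q ?S" by (simp add: q_def a_def norm_mult)
    finally show ?thesis .
  qed
  ultimately have "(\<Sum>s\<in>?S. p s - q s) \<le> 0" by (simp add: sum_subtractf)
  moreover have "0 \<le> (\<Sum>s\<in>?S. p s - q s)" using qp by (intro sum_nonneg) simp
  ultimately have "(\<Sum>s\<in>?S. p s - q s) = 0" by linarith
  then have "p (\<pi>, bar \<pi>) - q (\<pi>, bar \<pi>) = 0"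
    using sum_nonneg_eq_0_iff[OF S, of "\<lambda>s. p s - q s"] qp \<pi> bar_dual by auto
  moreover have "a (\<pi>, bar \<pi>) > 0"
  proof -
    let ?f = "\<lambda>C. (real (card C))\<^sup>2 * (cmod (char_on_class \<pi> C))\<^sup>2"
    have "(\<Sum>C\<in>conj_classes G. of_nat ((card C)\<^sup>2) * char_on_class \<pi> C * cnj (char_on_class \<pi> C)) =
        of_real (\<Sum>C\<in>conj_classes G. ?f C)"
      unfolding of_real_sum by (intro sum.cong refl)
        (simp add: mult.assoc flip: complex_norm_square)
    moreover have "0 < (\<Sum>C\<in>conj_classes G. ?f C)"
    proof (rule sum_pos2[OF finite_conj_classes conj_class_one])
      have "class_rep {\<one>} = \<one>" using class_rep_in[OF conj_class_one] by simp
      then show "0 < ?f {\<one>}"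
        using degree_pos[OF \<pi>] char_on_class_eq[OF \<pi> conj_class_one] char_of_one[OF \<pi>]
        by simp
    qed simp
    ultimately show ?thesis
      using cmod_diagonal_coeff[OF \<pi> \<pi> bar_dual bar(3)[OF \<pi>]] card_carrier_pos
      by (simp add: a_def del: of_real_sum)
  qed
  ultimately have "(real (degree_of G \<pi>))\<^sup>2 = (cmod (char_of \<pi> x))\<^sup>2"
    using bar(2)[OF \<pi>] bar(3)[OF \<pi> x] by (simp add: p_def q_def power2_eq_square)
  then show ?thesis by simp
qed

text \<open>Column orthogonality at \<open>x\<close> and at the identity gives classes of the same size.\<close>

lemma comm_group_if_diagonal_norm_eq_1:
  assumes one: "diagonal_norm G = 1"
  shows "comm_group G"
proof (rule group_comm_groupI)
  fix g x assume g: "g \<in> carrier G" and x: "x \<in> carrier G"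
  obtain C where C: "C \<in> conj_classes G" "x \<in> C" using Union_conj_classes x by blast
  have "(\<Sum>\<pi>\<in>dual G. (cmod (char_of \<pi> (class_rep C)))\<^sup>2) = (\<Sum>\<pi>\<in>dual G. (real (degree_of G \<pi>))\<^sup>2)"
    using diagonal_norm_eq_1_char[OF one _ class_rep_carrier[OF C(1)]] by simp
  then have "real (card (carrier G)) * card C = card (carrier G)"
    using char_of_column_norm[OF C(1)] sum_degree_square by simp
  then have "card C = 1" using card_carrier_pos by simp
  then obtain y where "C = {y}" using card_1_singletonE by metis
  then have "g \<otimes> x \<otimes> inv g = x" using conj_class_conj[OF C g] C(2) by simp
  then have "g \<otimes> x = x \<otimes> g"
    using g x by (metis inv_solve_right' m_closed)
  then show "g \<otimes> x = x \<otimes> g" .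
qed

end

theorem proposition4p2:
  fixes G :: "('a, 'b) monoid_scheme"
  assumes "group G" and "finite (carrier G)"
  shows "amenability_constant (ZA G) =
           ereal (1 / (real (card (carrier G)))\<^sup>2 *
             (\<Sum>(\<pi>, \<pi>')\<in>dual G \<times> dual G.
                real (degree_of G \<pi>) * real (degree_of G \<pi>') *
                cmod (\<Sum>C\<in>conj_classes G.
                        of_nat ((card C)\<^sup>2) * char_on_class \<pi> C * cnj (char_on_class \<pi>' C))))
         \<and> 1 \<le> amenability_constant (ZA G)
         \<and> (amenability_constant (ZA G) = 1 \<longleftrightarrow> comm_group G)"
proof (intro conjI)
  interpret finite_group G
    using assms by (simp add: finite_group_def finite_group_axioms_def)
  note AM = amenability_constant_ZA
  show "amenability_constant (ZA G) =
           ereal (1 / (real (card (carrier G)))\<^sup>2 *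
             (\<Sum>(\<pi>, \<pi>')\<in>dual G \<times> dual G.
                real (degree_of G \<pi>) * real (degree_of G \<pi>') *
                cmod (\<Sum>C\<in>conj_classes G.
                        of_nat ((card C)\<^sup>2) * char_on_class \<pi> C * cnj (char_on_class \<pi>' C))))"
    unfolding AM diagonal_norm_eq ..
  show "1 \<le> amenability_constant (ZA G)"
    unfolding AM using one_le_diagonal_norm by simp
  have "amenability_constant (ZA G) = 1 \<longleftrightarrow> diagonal_norm G = 1"
    unfolding AM by (simp add: one_ereal_def)
  then show "amenability_constant (ZA G) = 1 \<longleftrightarrow> comm_group G"
    using comm_group_if_diagonal_norm_eq_1 diagonal_norm_comm by blast
qed

end
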